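(* Let $\Omega\subset\mathbb{R}^n$ be a nonempty open set and assume that $u$ is quasicontinuous in $\Omega$. Then $u\in W^{1,p(\cdot)}_0(\Omega)$ if and only if the function $$\tilde u:=\begin{cases}u & \text{in }\Omega,\\ 0 & \text{otherwise (i.e. in } \mathbb{R}^n\setminus\Omega),\end{cases}$$ is quasicontinuous (in $\mathbb{R}^n$) and belongs to $W^{1,p(\cdot)}(\mathbb{R}^n)$.
   Context: Standing assumptions: $p:\mathbb{R}^n\to[1,\infty]$ is measurable, $1<p^-:=\operatorname{ess\,inf}_{\mathbb{R}^n}p\le p^+:=\operatorname{ess\,sup}_{\mathbb{R}^n}p<\infty$, and $p$ is log-H\"older continuous: there is $L>0$ with $|p(x)-p(y)|\le L/\log(e+1/|x-y|)$ for all $x,y\in\mathbb{R}^n$. For an open set $\Omega$, $L^{p(\cdot)}(\Omega)$ is the space of measurable $u:\Omega\to\mathbb{R}$ with finite norm $\|u\|_{L^{p(\cdot)}(\Omega)}=\inf\{\lambda>0:\int_\Omega|u(x)/\lambda|^{p(x)}\,dx\le1\}$; $W^{1,p(\cdot)}(\Omega)$ consists of $u\in L^{p(\cdot)}(\Omega)$ with distributional gradient $\nabla u\in L^{p(\cdot)}(\Omega)$, with norm $\|u\|_{L^{p(\cdot)}(\Omega)}+\|\nabla u\|_{L^{p(\cdot)}(\Omega)}$. $W^{1,p(\cdot)}_0(\Omega)$ is the closure in $W^{1,p(\cdot)}(\Omega)$ of the $W^{1,p(\cdot)}(\mathbb{R}^n)$-functions with compact support in $\Omega$. The $p(\cdot)$-capacity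 of $E\subset\mathbb{R}^n$ is $C_{p(\cdot)}(E)=\inf_u\int_{\mathbb{R}^n}(|u|^{p(x)}+|\nabla u|^{p(x)})\,dx$, the infimum being over all $u\in W^{1,p(\cdot)}(\mathbb{R}^n)$ with $u\ge1$ in a neighbourhood of $E$. A function $u:\Omega\to[-\infty,\infty]$ is quasicontinuous in $\Omega$ if for every $\varepsilon>0$ there is an open set $U\subset\mathbb{R}^n$ with $C_{p(\cdot)}(U)<\varepsilon$ such that $u|_{\Omega\setminus U}$ is real-valued and continuous. *)

theory Defs
  imports "HOL-Analysis.Analysis" "HOL-Probability.Essential_Supremum"
begin

text \<open>
  Functions on an open set \<open>\<Omega>\<close> are total functions whose values outside \<open>\<Omega>\<close> are never used.
  Measure-theoretic notions refer to Lebesgue measure, restricted to \<open>\<Omega>\<close> where appropriate.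
  The exponent is real-valued: a function into \<open>[1,\<infinity>]\<close> satisfying the log-Hoelder inequality for
  all pairs of points is finite everywhere.
\<close>

definition essinf :: "'a measure \<Rightarrow> ('a \<Rightarrow> ereal) \<Rightarrow> ereal" where
  "essinf M f = Liminf (ae_filter M) f"

text \<open>At \<open>x = y\<close> the quotient \<open>1 / dist x y\<close> is \<open>0\<close>, and the condition holds trivially.\<close>

definition log_Hoelder :: "('a::euclidean_space \<Rightarrow> real) \<Rightarrow> bool" where
  "log_Hoelder p \<longleftrightarrow>
     (\<exists>L>0. \<forall>x y. \<bar>p x - p y\<bar> \<le> L / ln (exp 1 + 1 / dist x y))"


subsection \<open>Variable exponent Lebesgue spaces\<close>

definition modular ::
  "('a::euclidean_space \<Rightarrow> real) \<Rightarrow> 'a set \<Rightarrow> ('a \<Rightarrow> 'b::euclidean_space) \<Rightarrow> ennreal" where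
  "modular p \<Omega> u = (\<integral>\<^sup>+x. ennreal (norm (u x) powr p x) \<partial>lebesgue_on \<Omega>)"

text \<open>The Luxemburg norm; it is \<open>\<infinity>\<close> when no \<open>c\<close> is admissible.\<close>

definition Lp_norm ::
  "('a::euclidean_space \<Rightarrow> real) \<Rightarrow> 'a set \<Rightarrow> ('a \<Rightarrow> 'b::euclidean_space) \<Rightarrow> ennreal" where
  "Lp_norm p \<Omega> u = (INF c \<in> {c::real. c > 0 \<and> modular p \<Omega> (\<lambda>x. u x /\<^sub>R c) \<le> 1}. ennreal c)"

definition Lp_space ::
  "('a::euclidean_space \<Rightarrow> real) \<Rightarrow> 'a set \<Rightarrow> ('a \<Rightarrow> 'b::euclidean_space) set" where
  "Lp_space p \<Omega> = {u \<in> borel_measurable (lebesgue_on \<Omega>). Lp_norm p \<Omega> u < \<infinity>}"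


subsection \<open>Distributional gradients\<close>

primrec Ck :: "nat \<Rightarrow> ('a::euclidean_space \<Rightarrow> real) \<Rightarrow> bool" where
  "Ck 0 f \<longleftrightarrow> continuous_on UNIV f"
| "Ck (Suc k) f \<longleftrightarrow>
     (\<forall>x. f differentiable (at x)) \<and> (\<forall>b\<in>Basis. Ck k (\<lambda>x. frechet_derivative f (at x) b))"

definition compactly_supported_in :: "('a::euclidean_space \<Rightarrow> real) \<Rightarrow> 'a set \<Rightarrow> bool" where
  "compactly_supported_in f \<Omega> \<longleftrightarrow> compact (closure {x. f x \<noteq> 0}) \<and> closure {x. f x \<noteq> 0} \<subseteq> \<Omega>"

text \<open>\<open>C\<^sub>c\<^sup>\<infinity>(\<Omega>)\<close>, extended by zero to the whole space.\<close>

definition test_functions :: "'a::euclidean_space set \<Rightarrow> ('a \<Rightarrow> real) set" where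
  "test_functions \<Omega> = {\<phi>. (\<forall>k. Ck k \<phi>) \<and> compactly_supported_in \<phi> \<Omega>}"

definition locally_integrable ::
  "'a::euclidean_space set \<Rightarrow> ('a \<Rightarrow> 'b::euclidean_space) \<Rightarrow> bool" where
  "locally_integrable \<Omega> f \<longleftrightarrow> (\<forall>K. compact K \<and> K \<subseteq> \<Omega> \<longrightarrow> integrable (lebesgue_on K) f)"

definition weak_gradient ::
  "'a::euclidean_space set \<Rightarrow> ('a \<Rightarrow> real) \<Rightarrow> ('a \<Rightarrow> 'a) \<Rightarrow> bool" where
  "weak_gradient \<Omega> u G \<longleftrightarrow>
     locally_integrable \<Omega> u \<and> locally_integrable \<Omega> G \<and>
     (\<forall>\<phi>\<in>test_functions \<Omega>. \<forall>b\<in>Basis.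
        (\<integral>x. u x * frechet_derivative \<phi> (at x) b \<partial>lebesgue_on \<Omega>)
          = - (\<integral>x. (G x \<bullet> b) * \<phi> x \<partial>lebesgue_on \<Omega>))"

text \<open>Weak gradients on an open set are unique almost everywhere, so the choice is immaterial.\<close>

definition wgrad :: "'a::euclidean_space set \<Rightarrow> ('a \<Rightarrow> real) \<Rightarrow> 'a \<Rightarrow> 'a" where
  "wgrad \<Omega> u = (SOME G. weak_gradient \<Omega> u G)"


subsection \<open>Variable exponent Sobolev spaces\<close>

definition W1p :: "('a::euclidean_space \<Rightarrow> real) \<Rightarrow> 'a set \<Rightarrow> ('a \<Rightarrow> real) set" where
  "W1p p \<Omega> = {u \<in> Lp_space p \<Omega>. \<exists>G \<in> Lp_space p \<Omega>. weak_gradient \<Omega> u G}"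

definition W1p_norm :: "('a::euclidean_space \<Rightarrow> real) \<Rightarrow> 'a set \<Rightarrow> ('a \<Rightarrow> real) \<Rightarrow> ennreal" where
  "W1p_norm p \<Omega> u = Lp_norm p \<Omega> u + Lp_norm p \<Omega> (wgrad \<Omega> u)"

definition W1p_0 :: "('a::euclidean_space \<Rightarrow> real) \<Rightarrow> 'a set \<Rightarrow> ('a \<Rightarrow> real) set" where
  "W1p_0 p \<Omega> = {u \<in> W1p p \<Omega>. \<forall>\<epsilon>::real. \<epsilon> > 0 \<longrightarrow> (\<exists>v \<in> W1p p UNIV.
      compactly_supported_in v \<Omega> \<and> W1p_norm p \<Omega> (\<lambda>x. u x - v x) < ennreal \<epsilon>)}"

text \<open>
  Elements of Sobolev spaces are determined up to null sets; an extended real-valued function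
  belongs to such a space if it agrees almost everywhere with a real-valued member.
\<close>

definition ae_in_space ::
  "'a::euclidean_space set \<Rightarrow> ('a \<Rightarrow> ereal) \<Rightarrow> ('a \<Rightarrow> real) set \<Rightarrow> bool" where
  "ae_in_space \<Omega> u S \<longleftrightarrow> (\<exists>v\<in>S. AE x in lebesgue_on \<Omega>. u x = ereal (v x))"


subsection \<open>Capacity and quasicontinuity\<close>

definition capacity :: "('a::euclidean_space \<Rightarrow> real) \<Rightarrow> 'a set \<Rightarrow> ennreal" where
  "capacity p E =
     (INF u \<in> {u \<in> W1p p UNIV. \<exists>V. open V \<and> E \<subseteq> V \<and> (\<forall>x\<in>V. u x \<ge> 1)}.
        \<integral>\<^sup>+x. ennreal (\<bar>u x\<bar> powr p x + norm (wgrad UNIV u x) powr p x) \<partial>lebesgue)"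

definition quasicontinuous_in ::
  "('a::euclidean_space \<Rightarrow> real) \<Rightarrow> 'a set \<Rightarrow> ('a \<Rightarrow> ereal) \<Rightarrow> bool" where
  "quasicontinuous_in p \<Omega> u \<longleftrightarrow>
     (\<forall>\<epsilon>::real. \<epsilon> > 0 \<longrightarrow> (\<exists>U. open U \<and> capacity p U < ennreal \<epsilon> \<and>
        (\<forall>x \<in> \<Omega> - U. \<bar>u x\<bar> \<noteq> \<infinity>) \<and> continuous_on (\<Omega> - U) u))"

end

theory Submission
  imports Defs
begin

text \<open>
  Forward direction: mollification approximates \<open>u\<close> by continuous Sobolev functions \<open>f\<^sub>j\<close> vanishing off \<open>\<Omega>\<close>.
  If they converge fast, then \<open>\<bar>f\<^sub>j - f\<^sub>j\<^sub>+\<^sub>1\<bar> > 2\<^sup>-\<^sup>j\<close> only on an open set of small capacity, so off the union of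
  these sets they converge uniformly to a continuous \<open>w\<close> with \<open>w = 0\<close> off \<open>\<Omega>\<close> and \<open>w = u\<close> almost everywhere
  in \<open>\<Omega>\<close>. The relatively open set where \<open>u \<noteq> w\<close> is null and does not increase capacity, since
  admissible functions may be changed on null sets.

  Backward direction: multiply truncations of \<open>u\<close> that vanish where \<open>\<bar>u\<bar> \<le> 1/k\<close> by a function vanishing on an
  open set of small capacity off which \<open>u\<close> is continuous, and by a radial cutoff. The products have
  compact support in \<open>\<Omega>\<close> and converge to \<open>u\<close>, because the gradient vanishes almost everywhere on \<open>{u = 0}\<close>.

  Throughout, \<open>C\<^sup>1\<close> truncations replace positive parts and minima, so the chain rule follows from mollification, and
  modulars replace norms; they are quasi-subadditive because the exponent is bounded.
\<close>

section \<open>Smooth kernels\<close>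

text \<open>Apart from making the exponent continuous, the log-Hoelder condition serves one
  estimate. Convolution is in general not bounded on a variable exponent space, since translating
  \<open>f\<close> moves its values to points with another exponent. For integrable \<open>f\<close>
  the mollified value at scale r is at most a constant times r^(-n), and on a ball of radius r such
  a number raised to \<open>p x - p y\<close> stays bounded. Hence |f_r|^p \<le> C (1 + (|f|^p)_r),
  and convergence in the modular follows from the L^1 theory applied to |f|^p.

  Every triangle inequality costs a factor 2^P, and countable sums and rescalings cost more. These
  losses are beaten by prescribing distances and capacities small enough before the approximants are
  chosen; this is the origin of the explicit weights. In the backward direction a truncation of
  height k multiplies the gradient of the capacity function, so the corresponding capacity is taken
  below (4 k)^(-P) 2^(-n) with k = n + 1.

  The statement about {u = 0} comes from the chain rule and uniqueness of weak gradients.\<close>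

definition flat :: "nat \<Rightarrow> real \<Rightarrow> real" where
  "flat j t = (if t > 0 then exp (- (1 / t)) / t ^ j else 0)"

lemma flat_nonpos [simp]: "t \<le> 0 \<Longrightarrow> flat j t = 0"
  by (simp add: flat_def)

lemma flat_nonneg: "flat j t \<ge> 0"
  by (simp add: flat_def)

lemma power_le_fact_exp:
  fixes x :: real
  assumes "x \<ge> 0"
  shows "x ^ n \<le> fact n * exp x"
proof -
  have "(\<Sum>k\<in>{n}. x ^ k /\<^sub>R fact k) \<le> (\<Sum>k. x ^ k /\<^sub>R fact k)"
    by (rule sum_le_suminf) (use assms summable_exp_generic[of x] in auto)
  then show ?thesis
    by (simp add: exp_def field_simps)
qed

text \<open>In the exponential series at 1/t the term of order j + 2 leaves t^2 after division by
  t^j. The quadratic bound forces the difference quotient at 0, the only point where the two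
  branches of \<open>flat\<close> meet, to tend to 0.\<close>

lemma flat_le_square: "flat j t \<le> fact (j + 2) * t\<^sup>2"
proof (cases "t > 0")
  case True
  have "(1 / t) ^ (j + 2) \<le> fact (j + 2) * exp (1 / t)"
    by (rule power_le_fact_exp) (use True in auto)
  then have "1 \<le> fact (j + 2) * exp (1 / t) * t ^ (j + 2)"
    using True by (simp add: power_divide field_simps)
  then have "exp (- (1 / t)) \<le> fact (j + 2) * t ^ (j + 2)"
    by (simp add: exp_minus field_simps)
  then have "exp (- (1 / t)) / t ^ j \<le> fact (j + 2) * t ^ (j + 2) / t ^ j"
    using True by (intro divide_right_mono) auto
  then show ?thesis
    using True by (simp add: flat_def power_add power2_eq_square del: fact_Suc)
qed (simp add: flat_def)

text \<open>The derivative is again a combination of members of the family, which is why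
  \<open>flat\<close> carries the index \<open>j\<close>: derivatives of exp(-1/t) of every order
  are covered at once.\<close>

lemma flat_DERIV:
  "(flat j has_real_derivative (- real j * flat (j + 1) t + flat (j + 2) t)) (at t)"
proof -
  consider "t > 0" | "t < 0" | "t = 0" by linarith
  then show ?thesis
  proof cases
    case 1
    have "((\<lambda>t. exp (- (1 / t)) / t ^ j) has_real_derivative
        (- real j * flat (j + 1) t + flat (j + 2) t)) (at t)"
      using 1 by (auto intro!: derivative_eq_intros simp: flat_def field_simps power2_eq_square)
         (cases j; simp add: field_simps)
    moreover have ev: "\<forall>\<^sub>F s in nhds t. flat j s = exp (- (1 / s)) / s ^ j"
      using eventually_nhds_in_open[of "{0<..}" t] 1
      by (auto elim!: eventually_mono simp: flat_def)
    ultimately show ?thesis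
      by (simp add: DERIV_cong_ev[OF refl ev refl])
  next
    case 2
    have ev: "\<forall>\<^sub>F s in nhds t. flat j s = 0"
      using eventually_nhds_in_open[of "{..<0}" t] 2 by (auto elim!: eventually_mono simp: flat_def)
    moreover have "((\<lambda>s. 0::real) has_real_derivative (- real j * flat (j + 1) t + flat (j + 2) t)) (at t)"
      using 2 by (simp add: flat_def)
    ultimately show ?thesis
      by (simp add: DERIV_cong_ev[OF refl ev refl])
  next
    case 3
    have "((\<lambda>h. flat j h / h) \<longlongrightarrow> 0) (at 0)"
    proof (rule Lim_null_comparison)
      show "\<forall>\<^sub>F h in at 0. norm (flat j h / h) \<le> fact (j + 2) * \<bar>h\<bar>"
      proof (rule always_eventually, rule allI)
        fix h
        have "norm (flat j h / h) \<le> fact (j + 2) * h\<^sup>2 / \<bar>h\<bar>"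
          using flat_le_square[of j h] flat_nonneg[of j h] by (auto intro!: divide_right_mono simp del: fact_Suc)
        then show "norm (flat j h / h) \<le> fact (j + 2) * \<bar>h\<bar>"
          by (cases "h = 0") (auto simp: power2_eq_square abs_if split: if_splits simp del: fact_Suc)
      qed
      show "((\<lambda>h. fact (j + 2) * \<bar>h\<bar>) \<longlongrightarrow> (0::real)) (at 0)"
        by (auto intro!: tendsto_eq_intros)
    qed
    then show ?thesis
      using 3 by (simp add: DERIV_def)
  qed
qed

text \<open>Smoothness of all orders by a closure argument: the class contains the radial bumps and
  is invariant under every directional derivative, so \<open>Ck k\<close> follows by induction on
  \<open>k\<close> from differentiability of its members. Multiplication by the coordinates of x - a
  is included because differentiating |x - a|^2 produces them.\<close>

inductive_set bump_class :: "'a::euclidean_space \<Rightarrow> real \<Rightarrow> ('a \<Rightarrow> real) set" for a r where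
  base: "(\<lambda>x. flat j (1 - (norm (x - a))\<^sup>2 / r\<^sup>2)) \<in> bump_class a r"
| coord: "f \<in> bump_class a r \<Longrightarrow> (\<lambda>x. ((x - a) \<bullet> b) * f x) \<in> bump_class a r"
| add: "f \<in> bump_class a r \<Longrightarrow> g \<in> bump_class a r \<Longrightarrow> (\<lambda>x. f x + g x) \<in> bump_class a r"
| scale: "f \<in> bump_class a r \<Longrightarrow> (\<lambda>x. c * f x) \<in> bump_class a r"

text \<open>Differentiability and the membership of all directional derivatives go through one
  induction, because the product rule in the case \<open>coord\<close> combines \<open>f\<close>
  with its derivative.\<close>

lemma bump_class_has_derivative:
  assumes "f \<in> bump_class a r"
  shows "\<exists>D. (\<forall>x. (f has_derivative D x) (at x)) \<and> (\<forall>b. (\<lambda>x. D x b) \<in> bump_class a r)"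
  using assms
proof induction
  case (base j)
  let ?q = "\<lambda>x. 1 - (norm (x - a))\<^sup>2 / r\<^sup>2"
  define D where "D x b = (-2 / r\<^sup>2) * (((x - a) \<bullet> b) * (- real j * flat (j + 1) (?q x) + flat (j + 2) (?q x)))" for x b
  have "((\<lambda>x. flat j (?q x)) has_derivative D x) (at x)" for x
  proof -
    have "((\<lambda>x. (x - a) \<bullet> (x - a)) has_derivative (\<lambda>b. (x - a) \<bullet> b + b \<bullet> (x - a))) (at x)"
      by (rule has_derivative_inner) (auto intro!: derivative_eq_intros)
    then have "((\<lambda>x. 1 - (1 / r\<^sup>2) * ((x - a) \<bullet> (x - a))) has_derivative
        (\<lambda>b. 0 - (1 / r\<^sup>2) * ((x - a) \<bullet> b + b \<bullet> (x - a)))) (at x)"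
      by (intro has_derivative_diff has_derivative_const has_derivative_mult_right)
    then have "(?q has_derivative (\<lambda>b. 0 - (1 / r\<^sup>2) * ((x - a) \<bullet> b + b \<bullet> (x - a)))) (at x)"
      by (simp add: power2_norm_eq_inner)
    from has_derivative_compose[OF this flat_DERIV[THEN has_field_derivative_imp_has_derivative, of j "?q x"]]
    show ?thesis
      by (rule has_derivative_eq_rhs) (simp add: D_def fun_eq_iff inner_commute algebra_simps)
  qed
  moreover have "(\<lambda>x. D x b) \<in> bump_class a r" for b
    unfolding D_def by (intro bump_class.intros)
  ultimately show ?case by (intro exI[of _ D]) simp
next
  case (coord f c)
  then obtain D where D: "\<And>x. (f has_derivative D x) (at x)" "\<And>b. (\<lambda>x. D x b) \<in> bump_class a r" by blast
  have "((\<lambda>x. ((x - a) \<bullet> c) * f x) has_derivative (\<lambda>b. ((x - a) \<bullet> c) * D x b + (b \<bullet> c) * f x)) (at x)" for x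
    by (auto intro!: derivative_eq_intros D)
  moreover have "(\<lambda>x. ((x - a) \<bullet> c) * D x b + (b \<bullet> c) * f x) \<in> bump_class a r" for b
    by (intro bump_class.intros D coord)
  ultimately show ?case
    by (intro exI[of _ "\<lambda>x b. ((x - a) \<bullet> c) * D x b + (b \<bullet> c) * f x"]) simp
next
  case (add f g)
  then obtain D E where D: "\<And>x. (f has_derivative D x) (at x)" "\<And>b. (\<lambda>x. D x b) \<in> bump_class a r"
    and E: "\<And>x. (g has_derivative E x) (at x)" "\<And>b. (\<lambda>x. E x b) \<in> bump_class a r" by blast
  have "((\<lambda>x. f x + g x) has_derivative (\<lambda>b. D x b + E x b)) (at x)" for x
    by (auto intro!: derivative_eq_intros D E)
  moreover have "(\<lambda>x. D x b + E x b) \<in> bump_class a r" for b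
    by (intro bump_class.intros D E)
  ultimately show ?case
    by (intro exI[of _ "\<lambda>x b. D x b + E x b"]) simp
next
  case (scale f c)
  then obtain D where D: "\<And>x. (f has_derivative D x) (at x)" "\<And>b. (\<lambda>x. D x b) \<in> bump_class a r" by blast
  have "((\<lambda>x. c * f x) has_derivative (\<lambda>b. c * D x b)) (at x)" for x
    by (auto intro!: derivative_eq_intros D)
  moreover have "(\<lambda>x. c * D x b) \<in> bump_class a r" for b
    by (intro bump_class.intros D)
  ultimately show ?case
    by (intro exI[of _ "\<lambda>x b. c * D x b"]) simp
qed

lemma bump_class_frechet:
  assumes "f \<in> bump_class a r"
  shows "f differentiable (at x)" "(\<lambda>x. frechet_derivative f (at x) b) \<in> bump_class a r"
proof -
  obtain D where D: "\<And>x. (f has_derivative D x) (at x)" "\<And>b. (\<lambda>x. D x b) \<in> bump_class a r"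
    using bump_class_has_derivative[OF assms] by blast
  show "f differentiable (at x)" using D(1) by (auto simp: differentiable_def)
  have "frechet_derivative f (at x) = D x" for x
    using D(1) frechet_derivative_at by metis
  then show "(\<lambda>x. frechet_derivative f (at x) b) \<in> bump_class a r"
    using D(2) by simp
qed

lemma bump_class_Ck: "f \<in> bump_class a r \<Longrightarrow> Ck k f"
proof (induction k arbitrary: f)
  case 0
  then show ?case
    using bump_class_frechet(1)[OF 0]
    by (simp add: continuous_on_eq_continuous_at differentiable_imp_continuous_within)
next
  case (Suc k)
  then show ?case using bump_class_frechet[OF Suc.prems] by simp
qed

lemma bump_class_zero:
  assumes "f \<in> bump_class a r" "r > 0" "norm (x - a) \<ge> r"
  shows "f x = 0"
proof -
  have "r\<^sup>2 \<le> (norm (x - a))\<^sup>2" using assms(2,3) by (intro power_mono) auto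
  with assms(1) show ?thesis
    by induction (use assms(2) in \<open>auto simp: field_simps\<close>)
qed

lemma bump_class_test:
  assumes f: "f \<in> bump_class a r" and "r > 0" "cball a r \<subseteq> \<Omega>"
  shows "f \<in> test_functions \<Omega>"
proof -
  have "{x. f x \<noteq> 0} \<subseteq> cball a r"
    using bump_class_zero[OF f \<open>r > 0\<close>] by (force simp: dist_norm norm_minus_commute)
  then have "closure {x. f x \<noteq> 0} \<subseteq> cball a r"
    by (simp add: closure_minimal)
  moreover then have "bounded (closure {x. f x \<noteq> 0})"
    using bounded_cball bounded_subset by blast
  ultimately show ?thesis
    using bump_class_Ck[OF f] assms
    by (auto simp: test_functions_def compactly_supported_in_def compact_eq_bounded_closed)
qed

text \<open>The dimension decides the value but cannot be read off from \<open>r\<close>, hence the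
  type argument.\<close>

definition bump_mass :: "'a::euclidean_space itself \<Rightarrow> real \<Rightarrow> real" where
  "bump_mass _ r = (\<integral>z. flat 0 (1 - (norm (z::'a))\<^sup>2 / r\<^sup>2) \<partial>lborel)"

definition kern :: "real \<Rightarrow> 'a::euclidean_space \<Rightarrow> real" where
  "kern r z = flat 0 (1 - (norm z)\<^sup>2 / r\<^sup>2) / bump_mass TYPE('a) r"

definition dkern :: "real \<Rightarrow> 'a::euclidean_space \<Rightarrow> 'a \<Rightarrow> real" where
  "dkern r b z = frechet_derivative (kern r) (at z) b"

lemma kern_bump_class: "(\<lambda>y::'a::euclidean_space. kern r (x - y)) \<in> bump_class x r"
  using bump_class.scale[OF bump_class.base[of 0 x r], of "1 / bump_mass TYPE('a) r"]
  by (simp add: kern_def norm_minus_commute)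

lemma kern_bump_class0: "kern r \<in> bump_class (0::'a::euclidean_space) r"
  using bump_class.scale[OF bump_class.base[of 0 "0::'a" r], of "1 / bump_mass TYPE('a) r"]
  by (simp add: kern_def[abs_def])

lemma integrable_continuous_compact_support:
  fixes f :: "'a::euclidean_space \<Rightarrow> 'b::euclidean_space"
  assumes "continuous_on UNIV f" "\<And>x. x \<notin> K \<Longrightarrow> f x = 0" "compact K"
  shows "integrable lborel f"
proof -
  have "set_integrable lborel K f"
    unfolding set_integrable_def using assms
    by (intro borel_integrable_compact) (auto intro: continuous_on_subset)
  moreover have "(\<lambda>x. indicator K x *\<^sub>R f x) = f"
    using assms(2) by (auto simp: fun_eq_iff indicator_def)
  ultimately show ?thesis by (simp add: set_integrable_def)
qed

lemma flat_bump_continuous [continuous_intros]: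
  "continuous_on UNIV (\<lambda>z::'a::euclidean_space. flat j (1 - (norm z)\<^sup>2 / r\<^sup>2))"
proof -
  have "continuous_on UNIV (flat j)"
    using flat_DERIV by (meson DERIV_isCont continuous_at_imp_continuous_on)
  moreover have "continuous_on UNIV (\<lambda>z::'a. 1 - (norm z)\<^sup>2 / r\<^sup>2)"
    unfolding divide_inverse by (intro continuous_intros)
  ultimately show ?thesis
    by (rule continuous_on_compose2) auto
qed

lemma flat_bump_integrable:
  assumes "r > 0"
  shows "integrable lborel (\<lambda>z::'a::euclidean_space. flat j (1 - (norm z)\<^sup>2 / r\<^sup>2))"
  using bump_class_zero[OF bump_class.base[of j "0::'a" r] assms]
  by (intro integrable_continuous_compact_support[where K="cball 0 r"] flat_bump_continuous)
     (auto simp: dist_norm)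

text \<open>On the ball of radius r/2 the argument of \<open>flat\<close> is at least 3/4, so the
  profile is at least exp(-4/3) there. What matters is the order r^n of the bound, which carries
  over to \<open>kern_bound\<close>.\<close>

lemma bump_mass_lower:
  assumes "r > 0"
  shows "bump_mass TYPE('a::euclidean_space) r \<ge> exp (-4/3) * measure lborel (ball (0::'a) 1) * (r / 2) ^ DIM('a)"
proof -
  have le: "indicator (ball 0 (r/2)) z * exp (-4/3) \<le> flat 0 (1 - (norm z)\<^sup>2 / r\<^sup>2)" for z :: 'a
  proof (cases "z \<in> ball 0 (r/2)")
    case True
    then have "(norm z)\<^sup>2 \<le> (r/2)\<^sup>2" by (intro power_mono) auto
    then have "(norm z)\<^sup>2 / r\<^sup>2 \<le> 1/4" using assms by (simp add: field_simps power2_eq_square)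
    then have 1: "1 - (norm z)\<^sup>2 / r\<^sup>2 \<ge> 3/4" by simp
    then have "1 / (1 - (norm z)\<^sup>2 / r\<^sup>2) \<le> 1 / (3/4)"
      by (intro divide_left_mono) auto
    moreover have "0 < 1 - (norm z)\<^sup>2 / r\<^sup>2" using 1 by linarith
    ultimately show ?thesis using True unfolding flat_def by simp
  qed (simp add: flat_nonneg)
  have "(\<integral>z. indicator (ball 0 (r/2)) (z::'a) * exp (-4/3) \<partial>lborel) \<le> bump_mass TYPE('a) r"
    unfolding bump_mass_def
  proof (rule integral_mono[OF _ flat_bump_integrable[OF assms] le])
    have "integrable lborel (indicator (ball (0::'a) (r/2)) :: 'a \<Rightarrow> real)"
      using emeasure_bounded_finite[of "ball (0::'a) (r/2)"] by (intro integrable_real_indicator) auto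
    then show "integrable lborel (\<lambda>z. indicator (ball (0::'a) (r/2)) z * exp (-4/3) :: real)"
      by (rule integrable_mult_left)
  qed
  moreover have "measure lborel (ball (0::'a) (r/2)) = (r/2) ^ DIM('a) * measure lborel (ball (0::'a) 1)"
    using assms content_ball_conv_unit_ball[of "r/2" "0::'a"] by (simp add: measure_completion)
  ultimately show ?thesis
    by (simp add: mult.commute mult.left_commute)
qed

lemma bump_mass_pos: "r > 0 \<Longrightarrow> bump_mass TYPE('a::euclidean_space) r > 0"
proof -
  assume r: "r > 0"
  have "0 < exp (-4/3) * measure lborel (ball (0::'a) 1) * (r / 2) ^ DIM('a)"
    using r content_ball_pos[of 1 "0::'a"] by (auto simp: measure_completion)
  then show ?thesis using bump_mass_lower[OF r, where 'a='a] by linarith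
qed

lemma kern_nonneg: "kern r z \<ge> 0"
  unfolding kern_def bump_mass_def by (intro divide_nonneg_nonneg flat_nonneg Bochner_Integration.integral_nonneg) 

lemma kern_zero: "r > 0 \<Longrightarrow> norm z \<ge> r \<Longrightarrow> kern r z = 0"
  using bump_class_zero[OF kern_bump_class0] by fastforce

lemma kern_test: "r > 0 \<Longrightarrow> cball x r \<subseteq> \<Omega> \<Longrightarrow> (\<lambda>y. kern r (x - y)) \<in> test_functions \<Omega>"
  by (rule bump_class_test[OF kern_bump_class])

lemma kern_continuous: "continuous_on UNIV (kern r)"
  using bump_class_Ck[OF kern_bump_class0, of 0] by simp

lemma kern_measurable [measurable]: "kern r \<in> borel_measurable borel"
  by (intro borel_measurable_continuous_onI kern_continuous)

lemma kern_integrable: "r > 0 \<Longrightarrow> integrable lborel (kern r :: 'a::euclidean_space \<Rightarrow> real)"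
  unfolding kern_def[abs_def] by (intro integrable_divide flat_bump_integrable)

lemma kern_integral: "r > 0 \<Longrightarrow> (\<integral>z. kern r (z::'a::euclidean_space) \<partial>lborel) = 1"
  using bump_mass_pos[of r, where 'a='a]
  unfolding kern_def[abs_def] by (simp add: bump_mass_def)

lemma kern_nn_integral: "r > 0 \<Longrightarrow> (\<integral>\<^sup>+z. ennreal (kern r (z::'a::euclidean_space)) \<partial>lborel) = 1"
  using nn_integral_eq_integral[OF kern_integrable[where 'a='a]] by (simp add: kern_integral kern_nonneg)

text \<open>The constant does not depend on \<open>r\<close>, in contrast to that of
  \<open>kern_bounded\<close>. This matters in \<open>moll_powr_le\<close>, where mollified values
  are compared with powers of 1/r.\<close>

lemma kern_bound:
  obtains C where "C > 0" "\<And>r (z::'a::euclidean_space). r > 0 \<Longrightarrow> kern r z \<le> C / r ^ DIM('a)"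
proof
  let ?c = "exp (-4/3) * measure lborel (ball (0::'a) 1) / 2 ^ DIM('a)"
  have c: "?c > 0" using content_ball_pos[of 1 "0::'a"] by (simp add: measure_completion)
  then show "1 / ?c > 0" by simp
  fix r :: real and z :: 'a
  assume r: "r > 0"
  have "flat 0 (1 - (norm z)\<^sup>2 / r\<^sup>2) \<le> 1" by (simp add: flat_def)
  then have "kern r z \<le> 1 / bump_mass TYPE('a) r"
    unfolding kern_def using bump_mass_pos[OF r, where 'a='a] by (intro divide_right_mono) auto
  also have "\<dots> \<le> 1 / (?c * r ^ DIM('a))"
    using bump_mass_lower[OF r, where 'a='a] c r by (intro divide_left_mono) (auto simp: power_divide mult_pos_pos bump_mass_pos)
  finally show "kern r z \<le> 1 / ?c / r ^ DIM('a)" by simp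
qed

lemma dkern_has_derivative: "(kern r has_derivative (\<lambda>b. dkern r b z)) (at z)"
  unfolding dkern_def using bump_class_frechet(1)[OF kern_bump_class0]
  by (simp add: frechet_derivative_works[symmetric])

lemma dkern_continuous: "continuous_on UNIV (dkern r b)"
  using bump_class_Ck[OF bump_class_frechet(2)[OF kern_bump_class0], of 0 r b]
  by (simp add: dkern_def[abs_def])

lemma dkern_zero: "r > 0 \<Longrightarrow> norm z \<ge> r \<Longrightarrow> dkern r b z = 0"
  using bump_class_zero[OF bump_class_frechet(2)[OF kern_bump_class0]] by (fastforce simp: dkern_def)

lemma dkern_measurable [measurable]: "dkern r b \<in> borel_measurable borel"
  by (intro borel_measurable_continuous_onI dkern_continuous)

lemma frechet_kern_diff: "frechet_derivative (\<lambda>y. kern r (x - y)) (at y) b = - dkern r b (x - y)"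
proof -
  have "((\<lambda>y. kern r (x - y)) has_derivative (\<lambda>b. dkern r (- b) (x - y))) (at y)"
    by (rule has_derivative_compose[OF _ dkern_has_derivative]) (auto intro!: derivative_eq_intros)
  then have "frechet_derivative (\<lambda>y. kern r (x - y)) (at y) b = dkern r (- b) (x - y)"
    using frechet_derivative_at by metis
  moreover have "linear (\<lambda>b. dkern r b (x - y))"
    using dkern_has_derivative has_derivative_linear by blast
  ultimately show ?thesis using linear_neg[of "\<lambda>b. dkern r b (x - y)" b] by simp
qed

lemma dkern_bounded:
  assumes "r > 0"
  obtains C where "C > 0" "\<And>z. \<bar>dkern r b z\<bar> \<le> C"
proof -
  have "compact (dkern r b ` cball 0 r)"
    by (intro compact_continuous_image continuous_on_subset[OF dkern_continuous]) auto
  then obtain C where C: "\<And>z. z \<in> cball 0 r \<Longrightarrow> \<bar>dkern r b z\<bar> \<le> C"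
    by (metis bounded_real compact_imp_bounded imageI)
  have "\<bar>dkern r b z\<bar> \<le> \<bar>C\<bar> + 1" for z
    using C[of z] dkern_zero[OF assms, of z b] by (cases "norm z \<le> r") auto
  then show ?thesis by (intro that[of "\<bar>C\<bar> + 1"]) auto
qed

section \<open>Mollification in \<open>L\<^sup>1\<close>\<close>

lemma lborel_distr_reflect:
  fixes t :: "'a::euclidean_space"
  shows "distr lborel borel (\<lambda>x. t - x) = lborel"
  using lborel_affine[of "-1" t] by (simp add: density_1)

lemma nn_integral_lborel_shift:
  fixes t :: "'a::euclidean_space"
  assumes [measurable]: "f \<in> borel_measurable borel"
  shows "(\<integral>\<^sup>+x. f (t + x) \<partial>lborel) = (\<integral>\<^sup>+x. f x \<partial>lborel)"
proof -
  have "(\<integral>\<^sup>+x. f x \<partial>distr lborel borel ((+) t)) = (\<integral>\<^sup>+x. f (t + x) \<partial>lborel)"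
    by (rule nn_integral_distr) auto
  then show ?thesis by (simp add: lborel_distr_plus)
qed

lemma nn_integral_lborel_diff:
  fixes t :: "'a::euclidean_space"
  assumes "f \<in> borel_measurable borel"
  shows "(\<integral>\<^sup>+x. f (x - t) \<partial>lborel) = (\<integral>\<^sup>+x. f x \<partial>lborel)"
  using nn_integral_lborel_shift[OF assms, of "- t"] by simp

lemma integral_lborel_reflect:
  fixes t :: "'a::euclidean_space" and f :: "'a \<Rightarrow> 'b::{banach, second_countable_topology}"
  assumes [measurable]: "f \<in> borel_measurable borel"
  shows "(\<integral>x. f (t - x) \<partial>lborel) = (\<integral>x. f x \<partial>lborel)"
    "integrable lborel (\<lambda>x. f (t - x)) \<longleftrightarrow> integrable lborel f"
proof -
  have "(\<integral>x. f x \<partial>distr lborel borel (\<lambda>x. t - x)) = (\<integral>x. f (t - x) \<partial>lborel)"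
    by (rule integral_distr) auto
  then show "(\<integral>x. f (t - x) \<partial>lborel) = (\<integral>x. f x \<partial>lborel)" by (simp add: lborel_distr_reflect)
  have "integrable (distr lborel borel (\<lambda>x. t - x)) f \<longleftrightarrow> integrable lborel (\<lambda>x. f (t - x))"
    by (rule integrable_distr_eq) auto
  then show "integrable lborel (\<lambda>x. f (t - x)) \<longleftrightarrow> integrable lborel f" by (simp add: lborel_distr_reflect)
qed

lemma integral_lborel_shift:
  fixes t :: "'a::euclidean_space" and f :: "'a \<Rightarrow> 'b::{banach, second_countable_topology}"
  assumes [measurable]: "f \<in> borel_measurable borel"
  shows "(\<integral>x. f (x + t) \<partial>lborel) = (\<integral>x. f x \<partial>lborel)"
    "integrable lborel (\<lambda>x. f (x + t)) \<longleftrightarrow> integrable lborel f"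
proof -
  have "(\<integral>x. f x \<partial>distr lborel borel ((+) t)) = (\<integral>x. f (t + x) \<partial>lborel)"
    by (rule integral_distr) auto
  then show "(\<integral>x. f (x + t) \<partial>lborel) = (\<integral>x. f x \<partial>lborel)" by (simp add: lborel_distr_plus add.commute)
  have "integrable (distr lborel borel ((+) t)) f \<longleftrightarrow> integrable lborel (\<lambda>x. f (t + x))"
    by (rule integrable_distr_eq) auto
  then show "integrable lborel (\<lambda>x. f (x + t)) \<longleftrightarrow> integrable lborel f" by (simp add: lborel_distr_plus add.commute)
qed

section \<open>Continuity of translations in L^1\<close>

definition shift_continuous :: "('a::euclidean_space \<Rightarrow> 'b::euclidean_space) \<Rightarrow> bool" where
  "shift_continuous f \<longleftrightarrow> (\<forall>h::nat \<Rightarrow> 'a. h \<longlonglongrightarrow> 0 \<longrightarrow> (\<lambda>n. \<integral>\<^sup>+x. norm (f (x - h n) - f x) \<partial>lborel) \<longlonglongrightarrow> 0)"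

lemma ennreal_tendsto_0I:
  fixes a :: "nat \<Rightarrow> ennreal"
  assumes "\<And>e::real. e > 0 \<Longrightarrow> \<forall>\<^sub>F n in sequentially. a n \<le> ennreal e"
  shows "a \<longlonglongrightarrow> 0"
proof (rule order_tendstoI)
  fix y :: ennreal assume "0 < y"
  then obtain z where "0 < z" "z < y" using dense by blast
  then obtain e where e: "z = ennreal e" "e > 0"
    by (cases z) (auto simp: less_top[symmetric])
  show "\<forall>\<^sub>F n in sequentially. a n < y"
    using assms[OF e(2)] by eventually_elim (use e \<open>z < y\<close> in auto)
qed simp

lemma ennreal_tendsto_0D:
  fixes a :: "nat \<Rightarrow> ennreal"
  assumes "a \<longlonglongrightarrow> 0" "e > 0"
  shows "\<forall>\<^sub>F n in sequentially. a n < ennreal e"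
  using order_tendstoD(2)[OF assms(1), of "ennreal e"] assms(2) by simp

lemma ennreal_tendsto_0_le:
  fixes a b :: "nat \<Rightarrow> ennreal"
  assumes "b \<longlonglongrightarrow> 0" "\<And>n. a n \<le> b n"
  shows "a \<longlonglongrightarrow> 0"
  by (rule tendsto_sandwich[OF _ _ tendsto_const assms(1)]) (simp_all add: assms(2))

lemma half_power_tendsto_0: "(\<lambda>n. ennreal ((1/2) ^ n)) \<longlonglongrightarrow> 0"
  by (subst ennreal_tendsto_0_iff) (auto intro!: LIMSEQ_power_zero)

lemma nn_integral_norm_triangle3:
  fixes a b c :: "'a \<Rightarrow> 'b::{second_countable_topology, real_normed_vector}"
  assumes [measurable]: "a \<in> borel_measurable M" "b \<in> borel_measurable M" "c \<in> borel_measurable M" "d \<in> borel_measurable M"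
  shows "(\<integral>\<^sup>+x. norm (a x - d x) \<partial>M) \<le> (\<integral>\<^sup>+x. norm (a x - b x) \<partial>M) + (\<integral>\<^sup>+x. norm (b x - c x) \<partial>M) + (\<integral>\<^sup>+x. norm (c x - d x) \<partial>M)"
proof -
  have "(\<integral>\<^sup>+x. norm (a x - d x) \<partial>M) \<le> (\<integral>\<^sup>+x. ennreal (norm (a x - b x)) + ennreal (norm (b x - c x)) + ennreal (norm (c x - d x)) \<partial>M)"
  proof (rule nn_integral_mono)
    fix x
    have "norm (a x - d x) \<le> norm (a x - b x) + norm (b x - c x) + norm (c x - d x)"
      by norm
    then show "ennreal (norm (a x - d x)) \<le> ennreal (norm (a x - b x)) + ennreal (norm (b x - c x)) + ennreal (norm (c x - d x))"
      by (simp add: ennreal_plus[symmetric] ennreal_leI del: ennreal_plus)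
  qed
  also have "\<dots> = (\<integral>\<^sup>+x. norm (a x - b x) \<partial>M) + (\<integral>\<^sup>+x. norm (b x - c x) \<partial>M) + (\<integral>\<^sup>+x. norm (c x - d x) \<partial>M)"
    by (subst nn_integral_add; (subst nn_integral_add)?) auto
  finally show ?thesis .
qed

text \<open>A three-term estimate: translation does not change the L^1 distance between
  \<open>f\<close> and \<open>g\<close>, so the same third of \<open>e\<close> is paid before and
  after the shift.\<close>

lemma shift_continuous_approx:
  fixes f :: "'a::euclidean_space \<Rightarrow> 'b::euclidean_space"
  assumes [measurable]: "f \<in> borel_measurable borel"
    and "\<And>e::real. e > 0 \<Longrightarrow> \<exists>g \<in> borel_measurable borel. shift_continuous g \<and> (\<integral>\<^sup>+x. norm (f x - g x) \<partial>lborel) \<le> ennreal e"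
  shows "shift_continuous f"
  unfolding shift_continuous_def
proof (intro allI impI ennreal_tendsto_0I)
  fix h :: "nat \<Rightarrow> 'a" and e :: real
  assume h: "h \<longlonglongrightarrow> 0" and "e > 0"
  obtain g where [measurable]: "g \<in> borel_measurable borel" and g: "shift_continuous g"
    "(\<integral>\<^sup>+x. norm (f x - g x) \<partial>lborel) \<le> ennreal (e/3)"
    using assms(2)[of "e/3"] \<open>e > 0\<close> by auto
  have "\<forall>\<^sub>F n in sequentially. (\<integral>\<^sup>+x. norm (g (x - h n) - g x) \<partial>lborel) < ennreal (e/3)"
    using g(1) h \<open>e > 0\<close> by (intro ennreal_tendsto_0D) (auto simp: shift_continuous_def)
  then show "\<forall>\<^sub>F n in sequentially. (\<integral>\<^sup>+x. norm (f (x - h n) - f x) \<partial>lborel) \<le> ennreal e"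
  proof eventually_elim
    case (elim n)
    have "(\<integral>\<^sup>+x. norm (f (x - h n) - f x) \<partial>lborel) \<le>
       (\<integral>\<^sup>+x. norm (f (x - h n) - g (x - h n)) \<partial>lborel) + (\<integral>\<^sup>+x. norm (g (x - h n) - g x) \<partial>lborel) + (\<integral>\<^sup>+x. norm (g x - f x) \<partial>lborel)"
      by (rule nn_integral_norm_triangle3) measurable
    also have "(\<integral>\<^sup>+x. norm (f (x - h n) - g (x - h n)) \<partial>lborel) = (\<integral>\<^sup>+x. norm (f x - g x) \<partial>lborel)"
      by (rule nn_integral_lborel_diff[of "\<lambda>x. norm (f x - g x)"]) measurable
    also have "(\<integral>\<^sup>+x. norm (g x - f x) \<partial>lborel) = (\<integral>\<^sup>+x. norm (f x - g x) \<partial>lborel)"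
      by (simp add: norm_minus_commute)
    also have "(\<integral>\<^sup>+x. norm (f x - g x) \<partial>lborel) + (\<integral>\<^sup>+x. norm (g (x - h n) - g x) \<partial>lborel) + (\<integral>\<^sup>+x. norm (f x - g x) \<partial>lborel) \<le> ennreal (e/3) + ennreal (e/3) + ennreal (e/3)"
      using g(2) elim by (intro add_mono) auto
    also have "\<dots> = ennreal e" using \<open>e > 0\<close> by (simp add: ennreal_plus[symmetric] del: ennreal_plus)
    finally show ?case .
  qed
qed

lemma shift_continuous_add:
  fixes f g :: "'a::euclidean_space \<Rightarrow> 'b::euclidean_space"
  assumes [measurable]: "f \<in> borel_measurable borel" "g \<in> borel_measurable borel"
    and "shift_continuous f" "shift_continuous g"
  shows "shift_continuous (\<lambda>x. f x + g x)"
  unfolding shift_continuous_def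
proof (intro allI impI)
  fix h :: "nat \<Rightarrow> 'a" assume h: "h \<longlonglongrightarrow> 0"
  have "(\<lambda>n. (\<integral>\<^sup>+x. norm (f (x - h n) - f x) \<partial>lborel) + (\<integral>\<^sup>+x. norm (g (x - h n) - g x) \<partial>lborel)) \<longlonglongrightarrow> 0 + 0"
    using assms(3,4) h by (intro tendsto_add) (auto simp: shift_continuous_def)
  moreover have "(\<integral>\<^sup>+x. norm (f (x - h n) + g (x - h n) - (f x + g x)) \<partial>lborel) \<le>
     (\<integral>\<^sup>+x. norm (f (x - h n) - f x) \<partial>lborel) + (\<integral>\<^sup>+x. norm (g (x - h n) - g x) \<partial>lborel)" for n
  proof -
    have "(\<integral>\<^sup>+x. norm (f (x - h n) + g (x - h n) - (f x + g x)) \<partial>lborel) \<le>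
      (\<integral>\<^sup>+x. ennreal (norm (f (x - h n) - f x)) + ennreal (norm (g (x - h n) - g x)) \<partial>lborel)"
      by (intro nn_integral_mono) (simp add: ennreal_plus[symmetric] norm_diff_triangle_ineq ennreal_leI del: ennreal_plus)
    then show ?thesis by (subst (asm) nn_integral_add) auto
  qed
  ultimately show "(\<lambda>n. \<integral>\<^sup>+x. norm (f (x - h n) + g (x - h n) - (f x + g x)) \<partial>lborel) \<longlonglongrightarrow> 0"
    using ennreal_tendsto_0_le by simp
qed

text \<open>The part of \<open>U\<close> lost under a small shift tends to 0 by dominated
  convergence, since a point of an open set stays in it under small displacements. The part gained
  is, after translating back, the part lost under the opposite shift; \<open>w\<close> describes
  both.\<close>

lemma shift_continuous_open:
  fixes U :: "'a::euclidean_space set" and c :: "'b::euclidean_space"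
  assumes "open U" and fin: "emeasure lborel U < \<infinity>"
  shows "shift_continuous (\<lambda>x. indicator U x *\<^sub>R c)"
  unfolding shift_continuous_def
proof (intro allI impI)
  fix h :: "nat \<Rightarrow> 'a" assume h: "h \<longlonglongrightarrow> 0"
  have [measurable]: "U \<in> sets borel" using assms(1) by auto
  define w :: "'a \<Rightarrow> 'a \<Rightarrow> ennreal" where "w k x = indicator U x * (1 - indicator U (x - k))" for k x
  have [measurable]: "w k \<in> borel_measurable borel" for k
    unfolding w_def by measurable
  have conv: "(\<lambda>n. \<integral>\<^sup>+x. w (k n) x \<partial>lborel) \<longlonglongrightarrow> 0" if "k \<longlonglongrightarrow> 0" for k
  proof -
    have "(\<lambda>n. \<integral>\<^sup>+x. w (k n) x \<partial>lborel) \<longlonglongrightarrow> (\<integral>\<^sup>+(x::'a). 0 \<partial>lborel)"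
    proof (rule nn_integral_dominated_convergence[where w="indicator U"])
      show "(\<integral>\<^sup>+x. indicator U x \<partial>lborel) < \<infinity>" using fin by simp
      show "AE x in lborel. w (k n) x \<le> indicator U x" for n
        by (rule AE_I2) (auto simp: w_def indicator_def)
      show "AE x in lborel. (\<lambda>n. w (k n) x) \<longlonglongrightarrow> 0"
      proof (rule AE_I2)
        fix x
        show "(\<lambda>n. w (k n) x) \<longlonglongrightarrow> 0"
        proof (cases "x \<in> U")
          case True
          have "(\<lambda>n. x - k n) \<longlonglongrightarrow> x - 0" using that by (intro tendsto_intros)
          then have "\<forall>\<^sub>F n in sequentially. x - k n \<in> U"
            using topological_tendstoD[of _ x sequentially U] True assms(1) by simp
          then have "\<forall>\<^sub>F n in sequentially. w (k n) x = 0"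
            by eventually_elim (simp add: w_def)
          then show ?thesis by (simp add: tendsto_eventually)
        qed (simp add: w_def)
      qed
    qed auto
    then show ?thesis by simp
  qed
  have eq: "(\<integral>\<^sup>+x. norm (indicator U (x - h n) *\<^sub>R c - indicator U x *\<^sub>R c) \<partial>lborel)
     = ennreal (norm c) * ((\<integral>\<^sup>+x. w (- h n) x \<partial>lborel) + (\<integral>\<^sup>+x. w (h n) x \<partial>lborel))" for n
  proof -
    have "(\<integral>\<^sup>+x. norm (indicator U (x - h n) *\<^sub>R c - indicator U x *\<^sub>R c) \<partial>lborel)
       = (\<integral>\<^sup>+x. ennreal (norm c) * (w (- h n) (x - h n) + w (h n) x) \<partial>lborel)"
      by (intro nn_integral_cong) (auto simp: w_def indicator_def)
    also have "\<dots> = ennreal (norm c) * ((\<integral>\<^sup>+x. w (- h n) (x - h n) \<partial>lborel) + (\<integral>\<^sup>+x. w (h n) x \<partial>lborel))"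
      by (subst nn_integral_cmult; (subst nn_integral_add)?) auto
    also have "(\<integral>\<^sup>+x. w (- h n) (x - h n) \<partial>lborel) = (\<integral>\<^sup>+x. w (- h n) x \<partial>lborel)"
      by (rule nn_integral_lborel_diff) measurable
    finally show ?thesis .
  qed
  have "(\<lambda>n. ennreal (norm c) * ((\<integral>\<^sup>+x. w (- h n) x \<partial>lborel) + (\<integral>\<^sup>+x. w (h n) x \<partial>lborel))) \<longlonglongrightarrow> ennreal (norm c) * (0 + 0)"
    using h tendsto_minus[OF h] by (intro ennreal_tendsto_cmult tendsto_add conv) auto
  then show "(\<lambda>n. \<integral>\<^sup>+x. norm (indicator U (x - h n) *\<^sub>R c - indicator U x *\<^sub>R c) \<partial>lborel) \<longlonglongrightarrow> 0"
    unfolding eq by simp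
qed

text \<open>Induction over integrable functions. Indicators of measurable sets are reduced to open
  sets by outer regularity, and limits are handled by dominated convergence in L^1; both cases end
  in \<open>shift_continuous_approx\<close>.\<close>

lemma shift_continuous_integrable:
  fixes f :: "'a::euclidean_space \<Rightarrow> 'b::euclidean_space"
  assumes "integrable lborel f"
  shows "shift_continuous f"
  using assms
proof induction
  case (base A c)
  show ?case
  proof (rule shift_continuous_approx)
    show "(\<lambda>x. indicator A x *\<^sub>R c) \<in> borel_measurable borel" using base by measurable
    fix e :: real assume e: "e > 0"
    \<comment> \<open>The summand 1 keeps the denominator positive when \<open>c\<close> is
      0.\<close>
    define d where "d = e / (norm c + 1)"
    have d: "d > 0" using e by (auto simp: d_def intro!: divide_pos_pos add_nonneg_pos)
    obtain U where U: "open U" "A \<subseteq> U" "emeasure lborel (U - A) < ennreal d"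
      using outer_regular_lborel[of A d] base d by (auto simp: ennreal_less_zero_iff)
    have [measurable]: "U \<in> sets borel" "A \<in> sets borel" using U base by auto
    have "emeasure lborel U = emeasure lborel A + emeasure lborel (U - A)"
      using U base by (subst plus_emeasure) (auto intro!: arg_cong[where f="emeasure lborel"])
    also have "\<dots> < \<infinity>" using base U(3) by (auto simp: less_top[symmetric] intro: less_trans)
    finally have "shift_continuous (\<lambda>x. indicator U x *\<^sub>R c)"
      using U by (intro shift_continuous_open)
    moreover have "(\<integral>\<^sup>+x. norm (indicator A x *\<^sub>R c - indicator U x *\<^sub>R c) \<partial>lborel) \<le> ennreal e"
    proof -
      have "(\<integral>\<^sup>+x. norm (indicator A x *\<^sub>R c - indicator U x *\<^sub>R c) \<partial>lborel)
        = (\<integral>\<^sup>+x. ennreal (norm c) * indicator (U - A) x \<partial>lborel)"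
        using U(2) by (intro nn_integral_cong) (auto simp: indicator_def)
      also have "\<dots> = ennreal (norm c) * emeasure lborel (U - A)"
        by (rule nn_integral_cmult_indicator) auto
      also have "\<dots> \<le> ennreal (norm c) * ennreal d"
        using U(3) by (intro mult_left_mono) auto
      also have "\<dots> = ennreal (norm c * d)" using d by (simp add: ennreal_mult)
      also have "\<dots> \<le> ennreal e"
      proof (rule ennreal_leI)
        have "norm c * d \<le> (norm c + 1) * d" using d by (intro mult_right_mono) auto
        also have "\<dots> = e" by (simp add: d_def add_nonneg_eq_0_iff)
        finally show "norm c * d \<le> e" .
      qed
      finally show ?thesis .
    qed
    ultimately show "\<exists>g\<in>borel_measurable borel. shift_continuous g \<and>
       (\<integral>\<^sup>+x. norm (indicator A x *\<^sub>R c - g x) \<partial>lborel) \<le> ennreal e"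
      by (intro bexI[of _ "\<lambda>x. indicator U x *\<^sub>R c"]) auto
  qed
next
  case (add f g)
  then show ?case using shift_continuous_add[of f g] by auto
next
  case (lim f s)
  have [measurable]: "f \<in> borel_measurable borel" "\<And>i. s i \<in> borel_measurable borel"
    using lim.hyps by auto
  show ?case
  proof (rule shift_continuous_approx)
    have "(\<lambda>i. \<integral>\<^sup>+x. norm (f x - s i x) \<partial>lborel) \<longlonglongrightarrow> 0"
    proof (rule nn_integral_dominated_convergence_norm[where w="\<lambda>x. 2 * norm (f x)"])
      show "(\<integral>\<^sup>+x. ennreal (2 * norm (f x)) \<partial>lborel) < \<infinity>"
        using integrable_mult_right[OF integrable_norm[OF lim.hyps(4)], of 2] unfolding integrable_iff_bounded by simp
    qed (use lim.hyps in auto)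
    note conv = this
    fix e :: real assume "e > 0"
    obtain i where "(\<integral>\<^sup>+x. norm (f x - s i x) \<partial>lborel) < ennreal e"
      using ennreal_tendsto_0D[OF conv \<open>e > 0\<close>] by (auto simp: eventually_sequentially)
    then show "\<exists>g\<in>borel_measurable borel. shift_continuous g \<and> (\<integral>\<^sup>+x. norm (f x - g x) \<partial>lborel) \<le> ennreal e"
      using lim.IH by (intro bexI[of _ "s i"]) auto
  qed simp
qed

text \<open>Dominated convergence speaks about sequences; a sequence of bad shifts of length below
  1/(n + 1) turns the sequential statement into a uniform one.\<close>

lemma shift_small:
  fixes f :: "'a::euclidean_space \<Rightarrow> 'b::euclidean_space"
  assumes "integrable lborel f" "e > 0"
  shows "\<exists>d>0. \<forall>h. norm h < d \<longrightarrow> (\<integral>\<^sup>+x. norm (f (x - h) - f x) \<partial>lborel) \<le> ennreal e"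
proof (rule ccontr)
  assume "\<not> ?thesis"
  then have all: "\<And>d. d > 0 \<Longrightarrow> \<exists>h. norm h < d \<and> \<not> (\<integral>\<^sup>+x. norm (f (x - h) - f x) \<partial>lborel) \<le> ennreal e"
    by blast
  have "\<forall>n. \<exists>h. norm h < 1 / Suc n \<and> \<not> (\<integral>\<^sup>+x. norm (f (x - h) - f x) \<partial>lborel) \<le> ennreal e"
    by (intro allI all) simp
  then obtain h where h: "\<And>n. norm (h n) < 1 / Suc n" "\<And>n. \<not> (\<integral>\<^sup>+x. norm (f (x - h n) - f x) \<partial>lborel) \<le> ennreal e"
    by metis
  have "h \<longlonglongrightarrow> 0"
    by (rule Lim_null_comparison[OF always_eventually LIMSEQ_Suc[OF lim_1_over_n]]) (use h(1) in \<open>auto intro: less_imp_le\<close>)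
  then have "(\<lambda>n. \<integral>\<^sup>+x. norm (f (x - h n) - f x) \<partial>lborel) \<longlonglongrightarrow> 0"
    using shift_continuous_integrable[OF assms(1)] by (auto simp: shift_continuous_def)
  from ennreal_tendsto_0D[OF this assms(2)] h(2) show False
    by (auto simp: eventually_sequentially intro: less_imp_le)
qed

section \<open>Mollification and its convergence in L^1\<close>

definition moll :: "real \<Rightarrow> ('a::euclidean_space \<Rightarrow> 'b::euclidean_space) \<Rightarrow> 'a \<Rightarrow> 'b" where
  "moll r f x = (\<integral>z. kern r z *\<^sub>R f (x - z) \<partial>lborel)"

lemma kern_bounded:
  assumes "r > 0"
  obtains C where "C > 0" "\<And>z::'a::euclidean_space. norm (kern r z) \<le> C"
proof -
  obtain C where C: "C > 0" "\<And>r (z::'a). r > 0 \<Longrightarrow> kern r z \<le> C / r ^ DIM('a)"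
    using kern_bound by blast
  show ?thesis
    by (rule that[of "C / r ^ DIM('a)"]) (use C assms in \<open>auto simp: abs_of_nonneg[OF kern_nonneg]\<close>)
qed

lemma bounded_mult_integrable:
  fixes f :: "'a::euclidean_space \<Rightarrow> 'b::euclidean_space"
  assumes "k \<in> borel_measurable borel" "\<And>z. norm (k z) \<le> C" "integrable lborel f"
  shows "integrable lborel (\<lambda>z. k z *\<^sub>R f z)"
proof (rule Bochner_Integration.integrable_bound)
  show "integrable lborel (\<lambda>z. C *\<^sub>R norm (f z))" using assms by auto
  show "(\<lambda>z. k z *\<^sub>R f z) \<in> borel_measurable lborel" using assms by auto
  show "AE x in lborel. norm (k x *\<^sub>R f x) \<le> norm (C *\<^sub>R norm (f x))"
  proof (rule AE_I2)
    fix x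
    have "norm (k x) * norm (f x) \<le> C * norm (f x)" by (rule mult_right_mono[OF assms(2)]) auto
    also have "\<dots> \<le> norm (C *\<^sub>R norm (f x))" by simp
    finally show "norm (k x *\<^sub>R f x) \<le> norm (C *\<^sub>R norm (f x))" by simp
  qed
qed

lemma moll_integrable:
  fixes f :: "'a::euclidean_space \<Rightarrow> 'b::euclidean_space"
  assumes "r > 0" "integrable lborel f"
  shows "integrable lborel (\<lambda>z. kern r z *\<^sub>R f (x - z))"
proof -
  obtain C where "C > 0" and C: "\<And>z::'a. norm (kern r z) \<le> C" using kern_bounded[OF assms(1)] by blast
  have [measurable]: "f \<in> borel_measurable borel" using assms by auto
  have "integrable lborel (\<lambda>z. f (x - z))"
    using assms(2) integral_lborel_reflect(2)[of f x] by simp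
  then show ?thesis by (intro bounded_mult_integrable[OF _ C]) auto
qed

text \<open>The definition puts the shift into \<open>f\<close>, which suits translation estimates;
  this form puts it into the kernel, which suits differentiation and pairing with test
  functions.\<close>

lemma moll_reflect:
  fixes f :: "'a::euclidean_space \<Rightarrow> 'b::euclidean_space"
  assumes [measurable]: "f \<in> borel_measurable borel"
  shows "moll r f x = (\<integral>y. kern r (x - y) *\<^sub>R f y \<partial>lborel)"
  using integral_lborel_reflect(1)[of "\<lambda>y. kern r (x - y) *\<^sub>R f y" x] by (simp add: moll_def)

lemma moll_measurable [measurable]:
  fixes f :: "'a::euclidean_space \<Rightarrow> 'b::euclidean_space"
  assumes [measurable]: "f \<in> borel_measurable borel"
  shows "moll r f \<in> borel_measurable borel"
proof -
  have "(\<lambda>x. \<integral>z. kern r z *\<^sub>R f (x - z) \<partial>lborel) \<in> borel_measurable borel"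
    by measurable
  then show ?thesis by (simp add: moll_def[abs_def])
qed

text \<open>Since the kernel has mass 1, f_r - f is an average of translation errors. By Fubini its
  L^1 norm is at most the kernel average of their norms, and only shifts with |z| < r carry
  weight.\<close>

lemma moll_L1:
  fixes f :: "'a::euclidean_space \<Rightarrow> 'b::euclidean_space"
  assumes f: "integrable lborel f" and r: "\<And>n. r n > 0" "r \<longlonglongrightarrow> 0"
  shows "(\<lambda>n. \<integral>\<^sup>+x. norm (moll (r n) f x - f x) \<partial>lborel) \<longlonglongrightarrow> 0"
proof (rule ennreal_tendsto_0I)
  fix e :: real assume "e > 0"
  have [measurable]: "f \<in> borel_measurable borel" using f by auto
  obtain d where d: "d > 0" "\<And>h. norm h < d \<Longrightarrow> (\<integral>\<^sup>+x. norm (f (x - h) - f x) \<partial>lborel) \<le> ennreal e"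
    using shift_small[OF f \<open>e > 0\<close>] by blast
  have "\<forall>\<^sub>F n in sequentially. r n < d" using order_tendstoD(2)[OF r(2) d(1)] .
  then show "\<forall>\<^sub>F n in sequentially. (\<integral>\<^sup>+x. norm (moll (r n) f x - f x) \<partial>lborel) \<le> ennreal e"
  proof eventually_elim
    case (elim n)
    let ?k = "kern (r n) :: 'a \<Rightarrow> real"
    have le: "ennreal (norm (moll (r n) f x - f x)) \<le> (\<integral>\<^sup>+z. ennreal (?k z) * norm (f (x - z) - f x) \<partial>lborel)" for x
    proof -
      have i: "integrable lborel (\<lambda>z. ?k z *\<^sub>R f (x - z))" "integrable lborel (\<lambda>z. ?k z *\<^sub>R f x)"
        using moll_integrable[OF r(1) f] kern_integrable[OF r(1)] by auto
      have "(\<integral>z. ?k z *\<^sub>R f x \<partial>lborel) = f x"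
        using kern_integral[OF r(1), of n, where 'a='a] kern_integrable[OF r(1), of n, where 'a='a] by simp
      then have "moll (r n) f x - f x = (\<integral>z. ?k z *\<^sub>R f (x - z) - ?k z *\<^sub>R f x \<partial>lborel)"
        using i by (simp add: moll_def)
      also have "ennreal (norm \<dots>) \<le> (\<integral>\<^sup>+z. norm (?k z *\<^sub>R f (x - z) - ?k z *\<^sub>R f x) \<partial>lborel)"
        by (intro integral_norm_bound_ennreal Bochner_Integration.integrable_diff i)
      also have "\<dots> = (\<integral>\<^sup>+z. ennreal (?k z) * norm (f (x - z) - f x) \<partial>lborel)"
        by (intro nn_integral_cong) (simp add: scaleR_diff_right[symmetric] ennreal_mult kern_nonneg abs_of_nonneg)
      finally show ?thesis .
    qed
    have "(\<integral>\<^sup>+x. norm (moll (r n) f x - f x) \<partial>lborel) \<le> (\<integral>\<^sup>+x. \<integral>\<^sup>+z. ennreal (?k z) * norm (f (x - z) - f x) \<partial>lborel \<partial>lborel)"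
      by (intro nn_integral_mono le)
    also have "\<dots> = (\<integral>\<^sup>+z. \<integral>\<^sup>+x. ennreal (?k z) * norm (f (x - z) - f x) \<partial>lborel \<partial>lborel)"
      by (rule lborel_pair.Fubini') measurable
    also have "\<dots> = (\<integral>\<^sup>+z. ennreal (?k z) * (\<integral>\<^sup>+x. norm (f (x - z) - f x) \<partial>lborel) \<partial>lborel)"
      by (intro nn_integral_cong nn_integral_cmult) measurable
    also have "\<dots> \<le> (\<integral>\<^sup>+z. ennreal (?k z) * ennreal e \<partial>(lborel :: 'a measure))"
    proof (rule nn_integral_mono)
      fix z :: 'a
      show "ennreal (?k z) * (\<integral>\<^sup>+x. norm (f (x - z) - f x) \<partial>lborel) \<le> ennreal (?k z) * ennreal e"
        using d(2)[of z] kern_zero[OF r(1), of n z] elim by (cases "norm z < r n") (auto intro!: mult_left_mono)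
    qed
    also have "\<dots> = ennreal e"
      using kern_nn_integral[OF r(1)[of n], where 'a='a] by (simp add: nn_integral_multc)
    finally show ?case .
  qed
qed

lemma moll_local:
  fixes f g :: "'a::euclidean_space \<Rightarrow> 'b::euclidean_space"
  assumes "r > 0" "\<And>y. y \<in> ball x r \<Longrightarrow> f y = g y"
  shows "moll r f x = moll r g x"
  unfolding moll_def
proof (rule Bochner_Integration.integral_cong)
  show "kern r z *\<^sub>R f (x - z) = kern r z *\<^sub>R g (x - z)" for z
    using assms kern_zero[OF assms(1), of z] by (cases "norm z < r") (auto simp: dist_norm)
qed simp

section \<open>Weak gradients\<close>

lemma lebesgue_on_UNIV: "lebesgue_on UNIV = lebesgue"
  by (rule measure_eqI) (auto simp: sets_restrict_space emeasure_restrict_space)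

lemma sets_lebesgue_compact: "compact K \<Longrightarrow> K \<in> sets lebesgue"
  by (simp add: compact_imp_closed)

lemma integrable_lebesgue_AE:
  fixes f g :: "'a::euclidean_space \<Rightarrow> 'b::euclidean_space"
  assumes "integrable lebesgue f" "AE x in lebesgue. f x = g x"
  shows "integrable lebesgue g"
proof -
  have "g \<in> borel_measurable lebesgue"
    using borel_measurable_AE[OF _ assms(2)] assms(1) by auto
  then show ?thesis using assms integrable_cong_AE_imp by blast
qed

lemma locally_integrable_iff:
  "locally_integrable \<Omega> f \<longleftrightarrow> (\<forall>K. compact K \<and> K \<subseteq> \<Omega> \<longrightarrow> integrable lebesgue (\<lambda>x. indicator K x *\<^sub>R f x))"
  by (auto simp: locally_integrable_def integrable_restrict_space sets_lebesgue_compact)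

lemma locally_integrableD:
  "locally_integrable \<Omega> f \<Longrightarrow> compact K \<Longrightarrow> K \<subseteq> \<Omega> \<Longrightarrow> integrable lebesgue (\<lambda>x. indicator K x *\<^sub>R f x)"
  by (simp add: locally_integrable_iff)

lemma locally_integrable_AE:
  fixes f g :: "'a::euclidean_space \<Rightarrow> 'b::euclidean_space"
  assumes "locally_integrable \<Omega> f" "AE x in lebesgue. x \<in> \<Omega> \<longrightarrow> f x = g x"
  shows "locally_integrable \<Omega> g"
  unfolding locally_integrable_iff
proof (intro allI impI)
  fix K assume K: "compact K \<and> K \<subseteq> \<Omega>"
  have "AE x in lebesgue. indicator K x *\<^sub>R f x = indicator K x *\<^sub>R g x"
    using assms(2)
  proof eventually_elim
    case (elim x)
    then show ?case using K by (cases "x \<in> K") auto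
  qed
  then show "integrable lebesgue (\<lambda>x. indicator K x *\<^sub>R g x)"
    by (rule integrable_lebesgue_AE[OF locally_integrableD[OF assms(1)], rotated 2]) (use K in auto)
qed

lemma locally_integrable_subset: "locally_integrable \<Omega> f \<Longrightarrow> \<Omega>' \<subseteq> \<Omega> \<Longrightarrow> locally_integrable \<Omega>' f"
  unfolding locally_integrable_def by blast

lemma locally_integrable_add:
  "locally_integrable \<Omega> f \<Longrightarrow> locally_integrable \<Omega> g \<Longrightarrow> locally_integrable \<Omega> (\<lambda>x. f x + g x)"
  unfolding locally_integrable_def by auto

lemma locally_integrable_scale:
  "locally_integrable \<Omega> f \<Longrightarrow> locally_integrable \<Omega> (\<lambda>x. c *\<^sub>R f x)"
  unfolding locally_integrable_def by auto

lemma locally_integrable_measurable: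
  assumes "locally_integrable (UNIV :: 'a::euclidean_space set) (f :: 'a \<Rightarrow> 'b::euclidean_space)"
  shows "f \<in> borel_measurable lebesgue"
proof (rule borel_measurable_LIMSEQ_metric)
  show "(\<lambda>x. indicator (cball 0 (real n)) x *\<^sub>R f x) \<in> borel_measurable lebesgue" for n
    using locally_integrableD[OF assms] by auto
  show "(\<lambda>n. indicator (cball 0 (real n)) x *\<^sub>R f x) \<longlonglongrightarrow> f x" for x
  proof -
    have "\<forall>\<^sub>F n in sequentially. norm x \<le> real n"
      by (meson eventually_at_top_linorderI nat_ceiling_le_eq)
    then have "\<forall>\<^sub>F n in sequentially. indicator (cball 0 (real n)) x *\<^sub>R f x = f x"
      by eventually_elim (auto simp: indicator_def)
    then show ?thesis by (rule tendsto_eventually)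
  qed
qed

section \<open>Test functions and elementary rules for weak gradients\<close>

lemma test_function_facts:
  fixes \<phi> :: "'a::euclidean_space \<Rightarrow> real"
  assumes "\<phi> \<in> test_functions \<Omega>"
  obtains K M where "compact K" "K \<subseteq> \<Omega>" "M > 0"
    "\<And>x. x \<notin> K \<Longrightarrow> \<phi> x = 0" "\<And>x b. x \<notin> K \<Longrightarrow> frechet_derivative \<phi> (at x) b = 0"
    "\<And>x. \<bar>\<phi> x\<bar> \<le> M" "\<And>x b. b \<in> Basis \<Longrightarrow> \<bar>frechet_derivative \<phi> (at x) b\<bar> \<le> M"
proof -
  define K where "K = closure {x. \<phi> x \<noteq> 0}"
  have K: "compact K" "K \<subseteq> \<Omega>"
    using assms by (auto simp: test_functions_def compactly_supported_in_def K_def)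
  have 0: "\<phi> x = 0" if "x \<notin> K" for x
    using that closure_subset[of "{x. \<phi> x \<noteq> 0}"] by (auto simp: K_def)
  have 1: "frechet_derivative \<phi> (at x) b = 0" if "x \<notin> K" for x b
  proof -
    have "(\<phi> has_derivative (\<lambda>_. 0)) (at x)"
      by (rule has_derivative_transform_within_open[of "\<lambda>_. 0" _ _ _ "- K"])
         (use that 0 K in \<open>auto intro: compact_imp_closed\<close>)
    then show ?thesis using frechet_derivative_at by metis
  qed
  have bd: "\<exists>M. \<forall>x. \<bar>g x\<bar> \<le> M" if "continuous_on UNIV g" "\<And>x. x \<notin> K \<Longrightarrow> g x = 0" for g :: "'a \<Rightarrow> real"
  proof -
    have "compact (g ` K)" by (intro compact_continuous_image K continuous_on_subset[OF that(1)]) auto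
    then obtain M where "\<And>x. x \<in> K \<Longrightarrow> \<bar>g x\<bar> \<le> M" by (metis bounded_real compact_imp_bounded imageI)
    then have "\<bar>g x\<bar> \<le> \<bar>M\<bar>" for x using that(2)[of x] by (cases "x \<in> K") force+
    then show ?thesis by blast
  qed
  have c: "Ck 0 \<phi>" "Ck 1 \<phi>" using assms unfolding test_functions_def by blast+
  then obtain M where M: "\<And>x. \<bar>\<phi> x\<bar> \<le> M" using bd[of \<phi>] 0 by auto
  have "\<exists>M. \<forall>x. \<bar>frechet_derivative \<phi> (at x) b\<bar> \<le> M" if "b \<in> Basis" for b
    using c(2) that 1 by (intro bd) auto
  then obtain N where N: "\<And>b x. b \<in> Basis \<Longrightarrow> \<bar>frechet_derivative \<phi> (at x) b\<bar> \<le> N b" by metis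
  \<comment> \<open>One bound for the function and for all its partial derivatives; the summand 1
    makes it positive.\<close>
  define L where "L = \<bar>M\<bar> + 1 + (\<Sum>b\<in>Basis. \<bar>N b\<bar>)"
  have nn: "(\<Sum>b\<in>Basis. \<bar>N b\<bar>) \<ge> 0" by (intro sum_nonneg) auto
  have Nb: "\<bar>N b\<bar> \<le> (\<Sum>b\<in>Basis. \<bar>N b\<bar>)" if "b \<in> Basis" for b
    using that by (intro member_le_sum) auto
  show ?thesis
  proof (rule that[OF K _ 0 1])
    show "L > 0" using nn abs_ge_zero[of M] unfolding L_def by linarith
    show "\<bar>\<phi> x\<bar> \<le> L" for x using M[of x] nn abs_ge_self[of M] unfolding L_def by linarith
    show "\<bar>frechet_derivative \<phi> (at x) b\<bar> \<le> L" if "b \<in> Basis" for x b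
      using N[OF that, of x] Nb[OF that] abs_ge_zero[of M] abs_ge_self[of "N b"] unfolding L_def by linarith
  qed
qed

lemma test_function_continuous:
  assumes "\<phi> \<in> test_functions \<Omega>"
  shows "continuous_on UNIV \<phi>" "b \<in> Basis \<Longrightarrow> continuous_on UNIV (\<lambda>x. frechet_derivative \<phi> (at x) b)"
    "(\<phi> has_derivative frechet_derivative \<phi> (at x)) (at x)"
proof -
  have c: "Ck 0 \<phi>" "Ck 1 \<phi>" using assms unfolding test_functions_def by blast+
  then show "continuous_on UNIV \<phi>" "b \<in> Basis \<Longrightarrow> continuous_on UNIV (\<lambda>x. frechet_derivative \<phi> (at x) b)"
    "(\<phi> has_derivative frechet_derivative \<phi> (at x)) (at x)"
    by (auto simp: frechet_derivative_works[symmetric])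
qed

lemma continuous_lebesgue_measurable:
  "continuous_on UNIV (f :: 'a::euclidean_space \<Rightarrow> 'b::euclidean_space) \<Longrightarrow> f \<in> borel_measurable lebesgue"
  by (intro measurable_completion) (auto intro: borel_measurable_continuous_onI)

lemma locally_integrable_mult:
  fixes f :: "'a::euclidean_space \<Rightarrow> real"
  assumes f: "locally_integrable \<Omega> f" and K: "compact K" "K \<subseteq> \<Omega>"
    and [measurable]: "\<psi> \<in> borel_measurable lebesgue" and \<psi>: "\<And>x. x \<notin> K \<Longrightarrow> \<psi> x = 0" "\<And>x. \<bar>\<psi> x\<bar> \<le> M"
  shows "integrable lebesgue (\<lambda>x. f x * \<psi> x)"
proof -
  have i: "integrable lebesgue (\<lambda>x. indicator K x *\<^sub>R f x)" using locally_integrableD[OF f K] .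
  have eq: "(\<lambda>x. f x * \<psi> x) = (\<lambda>x. (indicator K x *\<^sub>R f x) * \<psi> x)"
    using \<psi>(1) by (auto simp: fun_eq_iff indicator_def)
  show ?thesis
    unfolding eq
  proof (rule Bochner_Integration.integrable_bound)
    show "integrable lebesgue (\<lambda>x. M * norm (indicator K x *\<^sub>R f x))"
      by (intro integrable_mult_right integrable_norm i)
    show "(\<lambda>x. (indicator K x *\<^sub>R f x) * \<psi> x) \<in> borel_measurable lebesgue"
      using i by (intro borel_measurable_times) auto
    show "AE x in lebesgue. norm ((indicator K x *\<^sub>R f x) * \<psi> x) \<le> norm (M * norm (indicator K x *\<^sub>R f x))"
    proof (rule AE_I2)
      fix x
      have "\<bar>indicator K x *\<^sub>R f x\<bar> * \<bar>\<psi> x\<bar> \<le> \<bar>indicator K x *\<^sub>R f x\<bar> * \<bar>M\<bar>"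
        using \<psi>(2)[of x] by (intro mult_left_mono) auto
      then show "norm ((indicator K x *\<^sub>R f x) * \<psi> x) \<le> norm (M * norm (indicator K x *\<^sub>R f x))"
        by (simp add: abs_mult mult_ac)
    qed
  qed
qed

lemma locally_integrable_inner:
  assumes "locally_integrable \<Omega> G"
  shows "locally_integrable \<Omega> (\<lambda>x. G x \<bullet> b)"
  using assms unfolding locally_integrable_def by auto

lemma test_pairing_integrable:
  fixes u :: "'a::euclidean_space \<Rightarrow> real"
  assumes "locally_integrable \<Omega> u" "\<phi> \<in> test_functions \<Omega>"
  shows "integrable lebesgue (\<lambda>x. u x * \<phi> x)"
    "b \<in> Basis \<Longrightarrow> integrable lebesgue (\<lambda>x. u x * frechet_derivative \<phi> (at x) b)"
proof -
  obtain K M where K: "compact K" "K \<subseteq> \<Omega>" "M > 0"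
    "\<And>x. x \<notin> K \<Longrightarrow> \<phi> x = 0" "\<And>x b. x \<notin> K \<Longrightarrow> frechet_derivative \<phi> (at x) b = 0"
    "\<And>x. \<bar>\<phi> x\<bar> \<le> M" "\<And>x b. b \<in> Basis \<Longrightarrow> \<bar>frechet_derivative \<phi> (at x) b\<bar> \<le> M"
    using test_function_facts[OF assms(2)] by blast
  note c = test_function_continuous[OF assms(2)]
  show "integrable lebesgue (\<lambda>x. u x * \<phi> x)"
    by (rule locally_integrable_mult[OF assms(1) K(1,2) continuous_lebesgue_measurable[OF c(1)] K(4,6)])
  show "integrable lebesgue (\<lambda>x. u x * frechet_derivative \<phi> (at x) b)" if "b \<in> Basis"
    by (rule locally_integrable_mult[OF assms(1) K(1,2) continuous_lebesgue_measurable[OF c(2)[OF that]] K(5,7)[OF _] ]) (use that in auto)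
qed

text \<open>Test functions and their derivatives vanish off \<Omega>, so the integrals may be taken
  over the whole space. The rules below are derived in this form, in which restriction to a smaller
  open set only shrinks the class of test functions.\<close>

lemma weak_gradient_iff:
  fixes \<Omega> :: "'a::euclidean_space set"
  assumes "open \<Omega>"
  shows "weak_gradient \<Omega> u G \<longleftrightarrow> locally_integrable \<Omega> u \<and> locally_integrable \<Omega> G \<and>
     (\<forall>\<phi>\<in>test_functions \<Omega>. \<forall>b\<in>Basis.
        (\<integral>x. u x * frechet_derivative \<phi> (at x) b \<partial>lebesgue) = - (\<integral>x. (G x \<bullet> b) * \<phi> x \<partial>lebesgue))"
proof -
  have 1: "(\<integral>x. f x * g x \<partial>lebesgue_on \<Omega>) = (\<integral>x. f x * g x \<partial>lebesgue)"
    if "\<And>x. x \<notin> \<Omega> \<Longrightarrow> g x = 0" for f g :: "'a \<Rightarrow> real"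
    by (subst integral_restrict_space) (use that assms in \<open>auto simp: indicator_def intro!: Bochner_Integration.integral_cong\<close>)
  have 2: "\<phi> x = 0 \<and> frechet_derivative \<phi> (at x) b = 0" if "\<phi> \<in> test_functions \<Omega>" "x \<notin> \<Omega>" for \<phi> x b
    using test_function_facts[OF that(1)] that(2) by (metis subsetD)
  show ?thesis
    unfolding weak_gradient_def using 1 2 by (intro conj_cong refl ball_cong) (simp_all add: 1 2)
qed

lemma weak_gradient_loc:
  assumes "weak_gradient \<Omega> u G" shows "locally_integrable \<Omega> u" "locally_integrable \<Omega> G"
  using assms by (auto simp: weak_gradient_def)

lemma weak_gradientD:
  assumes "weak_gradient \<Omega> u G" "open \<Omega>" "\<phi> \<in> test_functions \<Omega>" "b \<in> Basis"
  shows "(\<integral>x. u x * frechet_derivative \<phi> (at x) b \<partial>lebesgue) = - (\<integral>x. (G x \<bullet> b) * \<phi> x \<partial>lebesgue)"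
  using assms weak_gradient_iff by blast

lemma weak_gradient_AE:
  fixes \<Omega> :: "'a::euclidean_space set"
  assumes w: "weak_gradient \<Omega> u G" and "open \<Omega>"
    and "AE x in lebesgue. x \<in> \<Omega> \<longrightarrow> u x = u' x" "AE x in lebesgue. x \<in> \<Omega> \<longrightarrow> G x = G' x"
  shows "weak_gradient \<Omega> u' G'"
  unfolding weak_gradient_iff[OF \<open>open \<Omega>\<close>]
proof (intro conjI ballI)
  show l: "locally_integrable \<Omega> u'" "locally_integrable \<Omega> G'"
    using locally_integrable_AE weak_gradient_loc[OF w] assms(3,4) by blast+
  fix \<phi> b assume \<phi>: "\<phi> \<in> test_functions \<Omega>" and b: "b \<in> (Basis::'a set)"
  have z: "\<phi> x = 0" "frechet_derivative \<phi> (at x) b = 0" if "x \<notin> \<Omega>" for x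
    using test_function_facts[OF \<phi>] that by (metis subsetD)+
  have "(\<integral>x. u' x * frechet_derivative \<phi> (at x) b \<partial>lebesgue) = (\<integral>x. u x * frechet_derivative \<phi> (at x) b \<partial>lebesgue)"
  proof (rule integral_cong_AE)
    show "AE x in lebesgue. u' x * frechet_derivative \<phi> (at x) b = u x * frechet_derivative \<phi> (at x) b"
      using assms(3) by eventually_elim (use z in auto)
  qed (use test_pairing_integrable(2)[OF _ \<phi> b] l weak_gradient_loc[OF w] in auto)
  moreover have "(\<integral>x. (G' x \<bullet> b) * \<phi> x \<partial>lebesgue) = (\<integral>x. (G x \<bullet> b) * \<phi> x \<partial>lebesgue)"
  proof (rule integral_cong_AE)
    show "AE x in lebesgue. (G' x \<bullet> b) * \<phi> x = (G x \<bullet> b) * \<phi> x"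
      using assms(4) by eventually_elim (use z in auto)
  qed (use test_pairing_integrable(1)[OF _ \<phi>] locally_integrable_inner l weak_gradient_loc[OF w] in auto)
  ultimately show "(\<integral>x. u' x * frechet_derivative \<phi> (at x) b \<partial>lebesgue) = - (\<integral>x. (G' x \<bullet> b) * \<phi> x \<partial>lebesgue)"
    using weak_gradientD[OF w \<open>open \<Omega>\<close> \<phi> b] by simp
qed

lemma test_functions_mono: "\<Omega>' \<subseteq> \<Omega> \<Longrightarrow> test_functions \<Omega>' \<subseteq> test_functions \<Omega>"
  by (auto simp: test_functions_def compactly_supported_in_def)

lemma weak_gradient_restrict:
  assumes "weak_gradient \<Omega> u G" "open \<Omega>" "open \<Omega>'" "\<Omega>' \<subseteq> \<Omega>"
  shows "weak_gradient \<Omega>' u G"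
  unfolding weak_gradient_iff[OF assms(3)]
  using locally_integrable_subset[OF weak_gradient_loc(1)[OF assms(1)] assms(4)]
    locally_integrable_subset[OF weak_gradient_loc(2)[OF assms(1)] assms(4)]
    weak_gradientD[OF assms(1,2)] test_functions_mono[OF assms(4)] by auto

lemma weak_gradient_add:
  assumes w: "weak_gradient \<Omega> u G" "weak_gradient \<Omega> v H" and "open (\<Omega> :: 'a::euclidean_space set)"
  shows "weak_gradient \<Omega> (\<lambda>x. u x + v x) (\<lambda>x. G x + H x)"
  unfolding weak_gradient_iff[OF \<open>open \<Omega>\<close>]
proof (intro conjI ballI)
  show "locally_integrable \<Omega> (\<lambda>x. u x + v x)" "locally_integrable \<Omega> (\<lambda>x. G x + H x)"
    using w by (auto intro: locally_integrable_add dest: weak_gradient_loc)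
  fix \<phi> b assume \<phi>: "\<phi> \<in> test_functions \<Omega>" and b: "b \<in> (Basis::'a set)"
  have "integrable lebesgue (\<lambda>x. u x * frechet_derivative \<phi> (at x) b)" "integrable lebesgue (\<lambda>x. v x * frechet_derivative \<phi> (at x) b)"
    using w \<phi> b by (auto intro: test_pairing_integrable dest: weak_gradient_loc)
  moreover have "integrable lebesgue (\<lambda>x. (G x \<bullet> b) * \<phi> x)" "integrable lebesgue (\<lambda>x. (H x \<bullet> b) * \<phi> x)"
    using w \<phi> b by (auto intro!: test_pairing_integrable locally_integrable_inner dest: weak_gradient_loc)
  ultimately show "(\<integral>x. (u x + v x) * frechet_derivative \<phi> (at x) b \<partial>lebesgue) = - (\<integral>x. ((G x + H x) \<bullet> b) * \<phi> x \<partial>lebesgue)"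
    using weak_gradientD[OF w(1) \<open>open \<Omega>\<close> \<phi> b] weak_gradientD[OF w(2) \<open>open \<Omega>\<close> \<phi> b]
    by (simp add: inner_add_left distrib_right)
qed

lemma weak_gradient_scale:
  assumes w: "weak_gradient \<Omega> u G" and "open (\<Omega> :: 'a::euclidean_space set)"
  shows "weak_gradient \<Omega> (\<lambda>x. c * u x) (\<lambda>x. c *\<^sub>R G x)"
  unfolding weak_gradient_iff[OF \<open>open \<Omega>\<close>]
proof (intro conjI ballI)
  show "locally_integrable \<Omega> (\<lambda>x. c * u x)" "locally_integrable \<Omega> (\<lambda>x. c *\<^sub>R G x)"
    using locally_integrable_scale[OF weak_gradient_loc(1)[OF w], of c] locally_integrable_scale[OF weak_gradient_loc(2)[OF w], of c] by simp_all
  fix \<phi> b assume \<phi>: "\<phi> \<in> test_functions \<Omega>" and b: "b \<in> (Basis::'a set)"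
  show "(\<integral>x. (c * u x) * frechet_derivative \<phi> (at x) b \<partial>lebesgue) = - (\<integral>x. ((c *\<^sub>R G x) \<bullet> b) * \<phi> x \<partial>lebesgue)"
    using weak_gradientD[OF w \<open>open \<Omega>\<close> \<phi> b] by (simp add: mult.assoc)
qed

lemma weak_gradient_diff:
  assumes "weak_gradient \<Omega> u G" "weak_gradient \<Omega> v H" and "open (\<Omega> :: 'a::euclidean_space set)"
  shows "weak_gradient \<Omega> (\<lambda>x. u x - v x) (\<lambda>x. G x - H x)"
  using weak_gradient_add[OF assms(1) weak_gradient_scale[OF assms(2,3), of "-1"] assms(3)] by simp

section \<open>Stability of weak gradients under L^1 convergence on compact sets\<close>

definition L1_on :: "'a::euclidean_space set \<Rightarrow> (nat \<Rightarrow> 'a \<Rightarrow> 'b::euclidean_space) \<Rightarrow> ('a \<Rightarrow> 'b) \<Rightarrow> bool" where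
  "L1_on K f g \<longleftrightarrow> (\<lambda>n. \<integral>\<^sup>+x. ennreal (norm (f n x - g x)) * indicator K x \<partial>lebesgue) \<longlonglongrightarrow> 0"

lemma L1_on_pairing:
  fixes f :: "nat \<Rightarrow> 'a::euclidean_space \<Rightarrow> real"
  assumes conv: "L1_on K f g" and int: "\<And>n. integrable lebesgue (\<lambda>x. f n x * \<psi> x)" "integrable lebesgue (\<lambda>x. g x * \<psi> x)"
    and \<psi>: "\<And>x. x \<notin> K \<Longrightarrow> \<psi> x = 0" "\<And>x. \<bar>\<psi> x\<bar> \<le> M"
    and fg: "locally_integrable \<Omega> g" "\<And>n. locally_integrable \<Omega> (f n)" "compact K" "K \<subseteq> \<Omega>"
  shows "(\<lambda>n. \<integral>x. f n x * \<psi> x \<partial>lebesgue) \<longlonglongrightarrow> (\<integral>x. g x * \<psi> x \<partial>lebesgue)"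
proof -
  have le: "ennreal (norm ((\<integral>x. f n x * \<psi> x \<partial>lebesgue) - (\<integral>x. g x * \<psi> x \<partial>lebesgue)))
     \<le> ennreal \<bar>M\<bar> * (\<integral>\<^sup>+x. ennreal (norm (f n x - g x)) * indicator K x \<partial>lebesgue)" for n
  proof -
    have m: "(\<lambda>x. indicator K x *\<^sub>R (f n x - g x)) \<in> borel_measurable lebesgue"
      using locally_integrableD[OF fg(1,3,4)] locally_integrableD[OF fg(2,3,4), of n]
      by (simp add: algebra_simps)
    have "(\<lambda>x. ennreal (norm (indicator K x *\<^sub>R (f n x - g x)))) \<in> borel_measurable lebesgue"
      using m by measurable
    moreover have eq: "(\<lambda>x. ennreal (norm (indicator K x *\<^sub>R (f n x - g x)))) = (\<lambda>x. ennreal (norm (f n x - g x)) * indicator K x)"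
      by (auto simp: fun_eq_iff indicator_def)
    ultimately have m': "(\<lambda>x. ennreal (norm (f n x - g x)) * indicator K x) \<in> borel_measurable lebesgue"
      unfolding eq[symmetric] by simp
    have "ennreal (norm ((\<integral>x. f n x * \<psi> x \<partial>lebesgue) - (\<integral>x. g x * \<psi> x \<partial>lebesgue)))
       = ennreal (norm (\<integral>x. f n x * \<psi> x - g x * \<psi> x \<partial>lebesgue))" using int by simp
    also have "\<dots> \<le> (\<integral>\<^sup>+x. norm (f n x * \<psi> x - g x * \<psi> x) \<partial>lebesgue)"
      using int by (intro integral_norm_bound_ennreal) auto
    also have "\<dots> \<le> (\<integral>\<^sup>+x. ennreal \<bar>M\<bar> * (ennreal (norm (f n x - g x)) * indicator K x) \<partial>lebesgue)"
    proof (rule nn_integral_mono)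
      fix x
      have "norm (f n x * \<psi> x - g x * \<psi> x) = \<bar>\<psi> x\<bar> * \<bar>f n x - g x\<bar>"
        by (simp add: left_diff_distrib[symmetric] abs_mult)
      also have "\<dots> \<le> \<bar>M\<bar> * \<bar>f n x - g x\<bar>" using \<psi>(2)[of x] by (intro mult_right_mono) auto
      finally show "ennreal (norm (f n x * \<psi> x - g x * \<psi> x)) \<le> ennreal \<bar>M\<bar> * (ennreal (norm (f n x - g x)) * indicator K x)"
        using \<psi>(1)[of x] by (cases "x \<in> K") (auto simp: ennreal_mult[symmetric] ennreal_leI)
    qed
    also have "\<dots> = ennreal \<bar>M\<bar> * (\<integral>\<^sup>+x. ennreal (norm (f n x - g x)) * indicator K x \<partial>lebesgue)"
      by (rule nn_integral_cmult[OF m'])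
    finally show ?thesis .
  qed
  have "(\<lambda>n. ennreal \<bar>M\<bar> * (\<integral>\<^sup>+x. ennreal (norm (f n x - g x)) * indicator K x \<partial>lebesgue)) \<longlonglongrightarrow> ennreal \<bar>M\<bar> * 0"
    using conv unfolding L1_on_def by (intro ennreal_tendsto_cmult) auto
  then have "(\<lambda>n. ennreal (norm ((\<integral>x. f n x * \<psi> x \<partial>lebesgue) - (\<integral>x. g x * \<psi> x \<partial>lebesgue)))) \<longlonglongrightarrow> 0"
    by (intro ennreal_tendsto_0_le[OF _ le]) simp
  then have "(\<lambda>n. norm ((\<integral>x. f n x * \<psi> x \<partial>lebesgue) - (\<integral>x. g x * \<psi> x \<partial>lebesgue))) \<longlonglongrightarrow> 0"
    by (subst (asm) ennreal_tendsto_0_iff) auto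
  then show ?thesis
    by (simp only: tendsto_norm_zero_iff LIM_zero_iff)
qed

lemma L1_on_inner:
  assumes "L1_on K f g" "b \<in> Basis"
  shows "L1_on K (\<lambda>n x. f n x \<bullet> b) (\<lambda>x. g x \<bullet> b)"
  unfolding L1_on_def
proof (rule ennreal_tendsto_0_le[OF assms(1)[unfolded L1_on_def]])
  show "(\<integral>\<^sup>+x. ennreal (norm (f n x \<bullet> b - g x \<bullet> b)) * indicator K x \<partial>lebesgue)
     \<le> (\<integral>\<^sup>+x. ennreal (norm (f n x - g x)) * indicator K x \<partial>lebesgue)" for n
    using Basis_le_norm[OF assms(2)]
    by (intro nn_integral_mono mult_right_mono ennreal_leI) (auto simp: inner_diff_left[symmetric])
qed

text \<open>A test function sees only its compact support, so the approximating sequence may depend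
  on \<open>K\<close>. The chain rule uses this freedom: there an almost everywhere convergent
  subsequence is extracted for each compact set.\<close>

lemma weak_gradient_closed:
  fixes \<Omega> :: "'a::euclidean_space set"
  assumes "open \<Omega>" and loc: "locally_integrable \<Omega> u" "locally_integrable \<Omega> G"
    and appr: "\<And>K. compact K \<Longrightarrow> K \<subseteq> \<Omega> \<Longrightarrow> \<exists>v H. (\<forall>n::nat. weak_gradient \<Omega> (v n) (H n)) \<and> L1_on K v u \<and> L1_on K H G"
  shows "weak_gradient \<Omega> u G"
  unfolding weak_gradient_iff[OF \<open>open \<Omega>\<close>]
proof (intro conjI ballI loc)
  fix \<phi> b assume \<phi>: "\<phi> \<in> test_functions \<Omega>" and b: "b \<in> (Basis::'a set)"
  obtain K M where K: "compact K" "K \<subseteq> \<Omega>" "M > 0"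
    "\<And>x. x \<notin> K \<Longrightarrow> \<phi> x = 0" "\<And>x b. x \<notin> K \<Longrightarrow> frechet_derivative \<phi> (at x) b = 0"
    "\<And>x. \<bar>\<phi> x\<bar> \<le> M" "\<And>x b. b \<in> Basis \<Longrightarrow> \<bar>frechet_derivative \<phi> (at x) b\<bar> \<le> M"
    using test_function_facts[OF \<phi>] by blast
  obtain v H where w: "\<And>n::nat. weak_gradient \<Omega> (v n) (H n)" and c: "L1_on K v u" "L1_on K H G"
    using appr[OF K(1,2)] by blast
  have "(\<lambda>n. \<integral>x. v n x * frechet_derivative \<phi> (at x) b \<partial>lebesgue) \<longlonglongrightarrow> (\<integral>x. u x * frechet_derivative \<phi> (at x) b \<partial>lebesgue)"
    by (rule L1_on_pairing[OF c(1) _ _ K(5) K(7)[OF b] loc(1) _ K(1,2)])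
       (auto intro!: test_pairing_integrable(2)[OF _ \<phi> b] loc weak_gradient_loc[OF w])
  moreover have "(\<lambda>n. \<integral>x. (H n x \<bullet> b) * \<phi> x \<partial>lebesgue) \<longlonglongrightarrow> (\<integral>x. (G x \<bullet> b) * \<phi> x \<partial>lebesgue)"
    by (rule L1_on_pairing[OF L1_on_inner[OF c(2) b] _ _ K(4) K(6) locally_integrable_inner[OF loc(2)] _ K(1,2)])
       (auto intro!: test_pairing_integrable(1)[OF _ \<phi>] locally_integrable_inner loc weak_gradient_loc[OF w])
  then have "(\<lambda>n. \<integral>x. v n x * frechet_derivative \<phi> (at x) b \<partial>lebesgue) \<longlonglongrightarrow> - (\<integral>x. (G x \<bullet> b) * \<phi> x \<partial>lebesgue)"
    unfolding weak_gradientD[OF w \<open>open \<Omega>\<close> \<phi> b] by (rule tendsto_minus)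
  ultimately show "(\<integral>x. u x * frechet_derivative \<phi> (at x) b \<partial>lebesgue) = - (\<integral>x. (G x \<bullet> b) * \<phi> x \<partial>lebesgue)"
    by (rule LIMSEQ_unique)
qed

text \<open>Coordinate by coordinate. Convolution and Fubini are carried out with Borel functions,
  whereas Sobolev functions are only Lebesgue measurable; weak gradients do not notice the change on
  a null set.\<close>

lemma borel_version:
  fixes f :: "'a::euclidean_space \<Rightarrow> 'b::euclidean_space"
  assumes "f \<in> borel_measurable lebesgue"
  shows "\<exists>g \<in> borel_measurable borel. AE x in lebesgue. f x = g x"
proof -
  have "\<forall>b. \<exists>g. g \<in> borel_measurable lborel \<and> (AE x in lborel. f x \<bullet> b = g x)"
  proof
    fix b
    have "(\<lambda>x. f x \<bullet> b) \<in> borel_measurable lebesgue" using assms by measurable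
    from completion_ex_borel_measurable_real[OF this]
    show "\<exists>g. g \<in> borel_measurable lborel \<and> (AE x in lborel. f x \<bullet> b = g x)" by blast
  qed
  from choice[OF this] obtain g where
    g: "\<And>b. g b \<in> borel_measurable borel" "\<And>b. AE x in lborel. f x \<bullet> b = g b x" by auto
  have "AE x in lborel. \<forall>b\<in>Basis. f x \<bullet> b = g b x"
    by (rule AE_finite_allI[OF finite_Basis]) (rule g(2))
  then have "AE x in lborel. f x = (\<Sum>b\<in>Basis. g b x *\<^sub>R b)"
  proof eventually_elim
    case (elim x)
    have "f x = (\<Sum>b\<in>Basis. (f x \<bullet> b) *\<^sub>R b)" by (simp add: euclidean_representation)
    also have "\<dots> = (\<Sum>b\<in>Basis. g b x *\<^sub>R b)" using elim by (intro sum.cong) auto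
    finally show ?case .
  qed
  moreover have "(\<lambda>x. \<Sum>b\<in>Basis. g b x *\<^sub>R b) \<in> borel_measurable borel"
    using g(1) by (intro borel_measurable_sum borel_measurable_scaleR) auto
  ultimately show ?thesis
    by (meson AE_completion)
qed

section \<open>Integration by parts for functions with continuous partial derivatives\<close>

lemma tendsto_at_0_sequence:
  fixes F :: "real \<Rightarrow> 'a::topological_space"
  assumes "(F \<longlongrightarrow> L) (at 0)" "X \<longlonglongrightarrow> 0" "\<And>i::nat. X i \<noteq> 0"
  shows "(\<lambda>i. F (X i)) \<longlonglongrightarrow> L"
proof -
  have "filterlim X (at 0) sequentially"
    using assms(2,3) by (simp add: filterlim_at)
  then show ?thesis by (rule filterlim_compose[OF assms(1)])
qed

text \<open>Translation invariance makes the integral of each difference quotient vanish.\<close>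

lemma integral_directional_derivative_zero:
  fixes \<psi> E :: "'a::euclidean_space \<Rightarrow> real"
  assumes cont: "continuous_on UNIV \<psi>" "continuous_on UNIV E"
    and deriv: "\<And>x. ((\<lambda>t. \<psi> (x + t *\<^sub>R b)) has_real_derivative E x) (at 0)"
    and supp: "\<And>x. x \<notin> K \<Longrightarrow> \<psi> x = 0" "\<And>x. x \<notin> K \<Longrightarrow> E x = 0" "compact K"
  shows "(\<integral>x. E x \<partial>lborel) = 0"
proof -
  have "compact (E ` K)" by (intro compact_continuous_image supp continuous_on_subset[OF cont(2)]) auto
  then obtain M0 where "\<And>x. x \<in> K \<Longrightarrow> \<bar>E x\<bar> \<le> M0" by (metis bounded_real compact_imp_bounded imageI)
  then have M: "\<bar>E x\<bar> \<le> \<bar>M0\<bar>" for x using supp(2)[of x] by (cases "x \<in> K") force+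
  obtain R where R: "\<And>x. x \<in> K \<Longrightarrow> norm x \<le> R" using supp(3) compact_imp_bounded bounded_iff by metis
  define t where "t n = 1 / real (Suc n)" for n
  have t: "t n > 0" "t n \<le> 1" for n by (auto simp: t_def)
  have t0: "t \<longlonglongrightarrow> 0" unfolding t_def using LIMSEQ_Suc[OF lim_1_over_n] by simp
  define q where "q n x = (\<psi> (x + t n *\<^sub>R b) - \<psi> x) / t n" for n x
  have [measurable]: "\<psi> \<in> borel_measurable borel" "E \<in> borel_measurable borel"
    using cont by (auto intro: borel_measurable_continuous_onI)
  have i\<psi>: "integrable lborel \<psi>"
    using integrable_continuous_compact_support[OF cont(1) supp(1,3)] .
  have deriv': "((\<lambda>t. \<psi> (x + t *\<^sub>R b)) has_real_derivative E (x + s *\<^sub>R b)) (at s)" for x s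
  proof -
    have "((\<lambda>t. \<psi> ((x + s *\<^sub>R b) + t *\<^sub>R b)) has_real_derivative E (x + s *\<^sub>R b)) (at (s + (- s)))"
      using deriv[of "x + s *\<^sub>R b"] by simp
    then have "((\<lambda>t. \<psi> ((x + s *\<^sub>R b) + (t + - s) *\<^sub>R b)) has_real_derivative E (x + s *\<^sub>R b)) (at s)"
      by (simp only: DERIV_shift)
    moreover have "(x + s *\<^sub>R b) + (t + - s) *\<^sub>R b = x + t *\<^sub>R b" for t by (simp add: algebra_simps)
    ultimately show ?thesis by (simp only:)
  qed
  \<comment> \<open>By the mean value theorem the quotient is a value of \<open>E\<close>; it
    vanishes outside one fixed ball because the steps \<open>t n\<close> are at most 1.\<close>
  have bound: "\<bar>q n x\<bar> \<le> \<bar>M0\<bar> * indicator (cball 0 (R + norm b)) x" for n x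
  proof (cases "x \<in> cball 0 (R + norm b)")
    case True
    obtain z where "\<psi> (x + t n *\<^sub>R b) - \<psi> (x + 0 *\<^sub>R b) = (t n - 0) * E (x + z *\<^sub>R b)"
      using MVT2[OF t(1)[of n], of "\<lambda>t. \<psi> (x + t *\<^sub>R b)" "\<lambda>s. E (x + s *\<^sub>R b)"] deriv' by blast
    then have "q n x = E (x + z *\<^sub>R b)" using t(1)[of n] by (simp add: q_def)
    then show ?thesis using M True by simp
  next
    case False
    have nx: "norm x > R + norm b" using False by simp
    have "norm (t n *\<^sub>R b) \<le> 1 * norm b" using t[of n] unfolding norm_scaleR by (intro mult_right_mono) auto
    then have "norm (x + t n *\<^sub>R b) > R"
      using nx norm_triangle_ineq4[of "x + t n *\<^sub>R b" "t n *\<^sub>R b"] by simp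
    moreover have "norm x > R" using nx norm_ge_zero[of b] by linarith
    ultimately have "\<psi> (x + t n *\<^sub>R b) = 0" "\<psi> x = 0" using R supp(1) by (meson not_le)+
    then show ?thesis by (simp add: q_def)
  qed
  have "(\<lambda>n. \<integral>x. q n x \<partial>lborel) \<longlonglongrightarrow> (\<integral>x. E x \<partial>lborel)"
  proof (rule integral_dominated_convergence[where w="\<lambda>x. \<bar>M0\<bar> * indicator (cball 0 (R + norm b)) x"])
    show "integrable lborel (\<lambda>x. \<bar>M0\<bar> * indicator (cball 0 (R + norm b)) (x::'a))"
      using emeasure_bounded_finite[of "cball (0::'a) (R + norm b)"]
      by (intro integrable_mult_right integrable_real_indicator) auto
    show "AE x in lborel. (\<lambda>n. q n x) \<longlonglongrightarrow> E x"
    proof (rule AE_I2)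
      fix x
      have "((\<lambda>h. (\<psi> (x + (0 + h) *\<^sub>R b) - \<psi> (x + 0 *\<^sub>R b)) / h) \<longlongrightarrow> E x) (at 0)"
        using deriv[of x] unfolding DERIV_def .
      from tendsto_at_0_sequence[OF this t0] t(1)
      have "(\<lambda>n. (\<psi> (x + (0 + t n) *\<^sub>R b) - \<psi> (x + 0 *\<^sub>R b)) / t n) \<longlonglongrightarrow> E x"
        by (metis less_irrefl)
      then show "(\<lambda>n. q n x) \<longlonglongrightarrow> E x" by (simp add: q_def)
    qed
    show "AE x in lborel. norm (q n x) \<le> \<bar>M0\<bar> * indicator (cball 0 (R + norm b)) x" for n
      using bound by auto
  qed (auto simp: q_def)
  moreover have "(\<integral>x. q n x \<partial>lborel) = 0" for n
  proof -
    have "(\<integral>x. \<psi> (x + t n *\<^sub>R b) - \<psi> x \<partial>lborel) = 0"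
      using i\<psi> integral_lborel_shift[of \<psi> "t n *\<^sub>R b"] by (subst Bochner_Integration.integral_diff) auto
    then show ?thesis by (simp add: q_def)
  qed
  ultimately show ?thesis by (simp add: LIMSEQ_const_iff)
qed

lemma test_function_line_derivative:
  assumes "\<phi> \<in> test_functions \<Omega>"
  shows "((\<lambda>t. \<phi> (x + t *\<^sub>R b)) has_real_derivative frechet_derivative \<phi> (at x) b) (at 0)"
proof -
  note d = test_function_continuous(3)[OF assms, of x]
  have "((\<lambda>t. x + t *\<^sub>R b) has_derivative (\<lambda>t. t *\<^sub>R b)) (at 0)"
    by (auto intro!: derivative_eq_intros)
  moreover have "(\<phi> has_derivative frechet_derivative \<phi> (at x)) (at (x + 0 *\<^sub>R b))" using d by simp
  ultimately have "((\<lambda>t. \<phi> (x + t *\<^sub>R b)) has_derivative (\<lambda>t. frechet_derivative \<phi> (at x) (t *\<^sub>R b))) (at 0)"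
    by (rule has_derivative_compose)
  moreover have "frechet_derivative \<phi> (at x) (t *\<^sub>R b) = t * frechet_derivative \<phi> (at x) b" for t
    using linear_cmul[OF has_derivative_linear[OF d]] by simp
  ultimately show ?thesis by (simp add: has_field_derivative_def mult_commute_abs)
qed

lemma locally_integrable_continuous:
  fixes f :: "'a::euclidean_space \<Rightarrow> 'b::euclidean_space"
  assumes "continuous_on UNIV f"
  shows "locally_integrable \<Omega> f"
  unfolding locally_integrable_iff
proof (intro allI impI)
  fix K assume "compact K \<and> K \<subseteq> \<Omega>"
  then have "integrable lborel (\<lambda>x. indicator K x *\<^sub>R f x)"
    using assms by (intro borel_integrable_compact) (auto intro: continuous_on_subset)
  then show "integrable lebesgue (\<lambda>x. indicator K x *\<^sub>R f x)"
    by (subst integrable_completion) auto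
qed

text \<open>The product of \<open>w\<close> and a test function has compact support and directional
  derivative \<open>E\<close>, so \<open>E\<close> has integral 0. Only line derivatives in
  coordinate directions enter, which is the form in which mollifications and the radial cutoff
  supply them.\<close>

lemma weak_gradient_classical:
  fixes w :: "'a::euclidean_space \<Rightarrow> real"
  assumes cont: "continuous_on UNIV w" "continuous_on UNIV G"
    and deriv: "\<And>x b. b \<in> Basis \<Longrightarrow> ((\<lambda>t. w (x + t *\<^sub>R b)) has_real_derivative G x \<bullet> b) (at 0)"
    and "open \<Omega>"
  shows "weak_gradient \<Omega> w G"
  unfolding weak_gradient_iff[OF \<open>open \<Omega>\<close>]
proof (intro conjI ballI)
  show loc: "locally_integrable \<Omega> w" "locally_integrable \<Omega> G"
    using cont by (auto intro: locally_integrable_continuous)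
  fix \<phi> b assume \<phi>: "\<phi> \<in> test_functions \<Omega>" and b: "b \<in> (Basis::'a set)"
  obtain K where K: "compact K" "K \<subseteq> \<Omega>"
    "\<And>x. x \<notin> K \<Longrightarrow> \<phi> x = 0" "\<And>x b. x \<notin> K \<Longrightarrow> frechet_derivative \<phi> (at x) b = 0"
    by (rule test_function_facts[OF \<phi>]) (rule that, assumption+)
  note c = test_function_continuous[OF \<phi>]
  define E where "E x = w x * frechet_derivative \<phi> (at x) b + (G x \<bullet> b) * \<phi> x" for x
  have cE: "continuous_on UNIV E"
    unfolding E_def[abs_def]
    by (intro continuous_on_add continuous_on_mult continuous_on_inner continuous_on_const cont c b)
  have "(\<integral>x. E x \<partial>lborel) = 0"
  proof (rule integral_directional_derivative_zero[of "\<lambda>x. w x * \<phi> x" _ b K])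
    show "continuous_on UNIV (\<lambda>x. w x * \<phi> x)" by (intro continuous_on_mult cont c)
    show "((\<lambda>t. w (x + t *\<^sub>R b) * \<phi> (x + t *\<^sub>R b)) has_real_derivative E x) (at 0)" for x
      using DERIV_mult[OF deriv[OF b, of x] test_function_line_derivative[OF \<phi>, of x b]] by (simp add: E_def algebra_simps)
  qed (use K cE in \<open>auto simp: E_def\<close>)
  moreover have "(\<integral>x. E x \<partial>lebesgue) = (\<integral>x. E x \<partial>lborel)"
    using cE by (intro integral_completion) (auto intro: borel_measurable_continuous_onI)
  moreover have "(\<integral>x. E x \<partial>lebesgue) = (\<integral>x. w x * frechet_derivative \<phi> (at x) b \<partial>lebesgue) + (\<integral>x. (G x \<bullet> b) * \<phi> x \<partial>lebesgue)"
    unfolding E_def using test_pairing_integrable[OF loc(1) \<phi>] test_pairing_integrable[OF locally_integrable_inner[OF loc(2)] \<phi>] b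
    by (intro Bochner_Integration.integral_add) auto
  ultimately show "(\<integral>x. w x * frechet_derivative \<phi> (at x) b \<partial>lebesgue) = - (\<integral>x. (G x \<bullet> b) * \<phi> x \<partial>lebesgue)"
    by linarith
qed

section \<open>Differentiation of convolutions\<close>

lemma locally_integrable_lborel:
  fixes f :: "'a::euclidean_space \<Rightarrow> 'b::euclidean_space"
  assumes "locally_integrable UNIV f" "f \<in> borel_measurable borel" "compact K"
  shows "integrable lborel (\<lambda>x. indicator K x *\<^sub>R f x)"
proof -
  have [measurable]: "K \<in> sets borel" using assms(3) by (simp add: compact_imp_closed)
  show ?thesis
    using locally_integrableD[OF assms(1,3)] integrable_completion[of "\<lambda>x. indicator K x *\<^sub>R f x" lborel]
      assms(2) by auto
qed

context
  fixes f :: "'a::euclidean_space \<Rightarrow> 'b::euclidean_space" and k :: "'a \<Rightarrow> real" and r C :: real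
  assumes f: "locally_integrable UNIV f" and fm [measurable]: "f \<in> borel_measurable borel"
    and k: "continuous_on UNIV k" and k0: "\<And>z. norm z \<ge> r \<Longrightarrow> k z = 0" and kC: "\<And>z. \<bar>k z\<bar> \<le> C"
begin

lemma k_measurable [measurable]: "k \<in> borel_measurable borel"
  using k by (rule borel_measurable_continuous_onI)

lemma conv_integrable: "integrable lborel (\<lambda>y. k (x - y) *\<^sub>R f y)"
proof -
  have "integrable lborel (\<lambda>y. k (x - y) *\<^sub>R (indicator (cball x r) y *\<^sub>R f y))"
    by (rule bounded_mult_integrable[OF _ _ locally_integrable_lborel[OF f fm compact_cball]]) (use kC in auto)
  moreover have "(\<lambda>y. k (x - y) *\<^sub>R (indicator (cball x r) y *\<^sub>R f y)) = (\<lambda>y. k (x - y) *\<^sub>R f y)"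
    using k0[of "x - _"] by (force simp: fun_eq_iff indicator_def dist_norm)
  ultimately show ?thesis by simp
qed

text \<open>Base points \<open>X n\<close> within distance 1 of \<open>x\<close> confine all
  integrands to the ball of radius r + 1 about \<open>x\<close>, where \<open>f\<close> is
  integrable. A multiple of |f| on that ball is the majorant both for continuity and for
  differentiation.\<close>

lemma conv_dominated:
  fixes g :: "nat \<Rightarrow> 'a \<Rightarrow> 'c::euclidean_space"
  assumes "X \<longlonglongrightarrow> x" "\<And>n. dist (X n) x \<le> 1"
    and "\<And>n. g n \<in> borel_measurable borel"
    and "\<And>n y. norm (g n y) \<le> L * norm (f y)" "\<And>n y. y \<notin> cball x (r + 1) \<Longrightarrow> g n y = 0"
    and "\<And>y. (\<lambda>n. g n y) \<longlonglongrightarrow> h y" "h \<in> borel_measurable borel"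
  shows "(\<lambda>n. \<integral>y. g n y \<partial>lborel) \<longlonglongrightarrow> (\<integral>y. h y \<partial>lborel)"
proof (rule integral_dominated_convergence[where w="\<lambda>y. L * norm (indicator (cball x (r+1)) y *\<^sub>R f y)"])
  show "integrable lborel (\<lambda>y. L * norm (indicator (cball x (r+1)) y *\<^sub>R f y))"
    by (intro integrable_mult_right integrable_norm locally_integrable_lborel[OF f fm]) auto
  show "AE y in lborel. norm (g n y) \<le> L * norm (indicator (cball x (r+1)) y *\<^sub>R f y)" for n
    using assms(4)[of n] assms(5)[of _ n] by (intro AE_I2) (auto simp: indicator_def)
qed (use assms in auto)

lemma conv_continuous: "continuous_on UNIV (\<lambda>x. \<integral>y. k (x - y) *\<^sub>R f y \<partial>lborel)"
proof -
  have "((\<lambda>x. \<integral>y. k (x - y) *\<^sub>R f y \<partial>lborel) \<circ> X) \<longlonglongrightarrow> (\<integral>y. k (x - y) *\<^sub>R f y \<partial>lborel)"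
    if X: "X \<longlonglongrightarrow> x" for X x
  proof -
    obtain N where N: "\<And>n. n \<ge> N \<Longrightarrow> dist (X n) x < 1"
      using metric_LIMSEQ_D[OF X, of 1] by auto
    \<comment> \<open>Dropping the first \<open>N\<close> terms brings all points within distance 1,
      as \<open>conv_dominated\<close> requires.\<close>
    have X': "(\<lambda>n. X (n + N)) \<longlonglongrightarrow> x" using X by (rule LIMSEQ_ignore_initial_segment)
    have "(\<lambda>n. \<integral>y. k (X (n + N) - y) *\<^sub>R f y \<partial>lborel) \<longlonglongrightarrow> (\<integral>y. k (x - y) *\<^sub>R f y \<partial>lborel)"
    proof (rule conv_dominated[OF X', where L=C])
      show "dist (X (n + N)) x \<le> 1" for n using N[of "n + N"] by simp
      show "norm (k (X (n + N) - y) *\<^sub>R f y) \<le> C * norm (f y)" for n y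
        using kC by (auto intro: mult_right_mono)
      show "k (X (n + N) - y) *\<^sub>R f y = 0" if "y \<notin> cball x (r + 1)" for n y
      proof -
        have "norm (X (n + N) - y) \<ge> r"
          using that N[of "n + N"] dist_triangle[of x y "X (n + N)"] by (simp add: dist_norm norm_minus_commute)
        then show ?thesis using k0 by simp
      qed
      show "(\<lambda>n. k (X (n + N) - y) *\<^sub>R f y) \<longlonglongrightarrow> k (x - y) *\<^sub>R f y" for y
        using k X' by (intro tendsto_intros isCont_tendsto_compose[of _ k]) (auto simp: continuous_on_eq_continuous_at)
    qed auto
    then show ?thesis
      using LIMSEQ_offset[of "\<lambda>n. \<integral>y. k (X n - y) *\<^sub>R f y \<partial>lborel"] by (simp add: comp_def)
  qed
  then show ?thesis
    by (simp add: continuous_on_sequentially comp_def)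
qed

end

lemma moll_continuous:
  fixes f :: "'a::euclidean_space \<Rightarrow> 'b::euclidean_space"
  assumes "locally_integrable UNIV f" "f \<in> borel_measurable borel" "r > 0"
  shows "continuous_on UNIV (moll r f)"
proof -
  obtain C where C: "\<And>z::'a. norm (kern r z) \<le> C" using kern_bounded[OF assms(3)] by metis
  have "continuous_on UNIV (\<lambda>x. \<integral>y. kern r (x - y) *\<^sub>R f y \<partial>lborel)"
    by (rule conv_continuous[OF assms(1,2) kern_continuous kern_zero[OF assms(3)]]) (use C in auto)
  then show ?thesis using moll_reflect[OF assms(2)] by (simp add: fun_eq_iff cong: continuous_on_cong)
qed

lemma dkern_line: "((\<lambda>t. kern r (z + t *\<^sub>R b)) has_real_derivative dkern r b (z + s *\<^sub>R b)) (at s)"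
proof -
  have "((\<lambda>t. kern r (z + t *\<^sub>R b)) has_derivative (\<lambda>t. dkern r (t *\<^sub>R b) (z + s *\<^sub>R b))) (at s)"
    by (rule has_derivative_compose[OF _ dkern_has_derivative]) (auto intro!: derivative_eq_intros)
  moreover have "dkern r (t *\<^sub>R b) (z + s *\<^sub>R b) = t * dkern r b (z + s *\<^sub>R b)" for t
    using linear_cmul[OF has_derivative_linear[OF dkern_has_derivative[of r "z + s *\<^sub>R b"]]] by simp
  ultimately show ?thesis by (simp add: has_field_derivative_def mult_commute_abs)
qed

text \<open>Differentiation under the integral along an arbitrary null sequence of steps: the
  difference quotients of the kernel are bounded by the supremum of its derivative, and
  \<open>conv_dominated\<close> applies.\<close>

lemma moll_line_derivative:
  fixes f :: "'a::euclidean_space \<Rightarrow> real"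
  assumes f: "locally_integrable UNIV f" and [measurable]: "f \<in> borel_measurable borel" and r: "r > 0"
  shows "((\<lambda>t. moll r f (x + t *\<^sub>R b)) has_real_derivative (\<integral>y. dkern r b (x - y) * f y \<partial>lborel)) (at 0)"
proof -
  have fm: "f \<in> borel_measurable borel" by measurable
  obtain C where C: "\<And>z::'a. norm (kern r z) \<le> C" using kern_bounded[OF r] by metis
  obtain L where L: "L > 0" "\<And>z. \<bar>dkern r b z\<bar> \<le> L" using dkern_bounded[OF r] by blast
  have int: "integrable lborel (\<lambda>y. kern r (x - y) *\<^sub>R f y)" for x
    by (rule conv_integrable[OF f fm kern_continuous kern_zero[OF r]]) (use C in auto)
  have "((\<lambda>h. (moll r f (x + (0 + h) *\<^sub>R b) - moll r f (x + 0 *\<^sub>R b)) / h) \<longlongrightarrow> (\<integral>y. dkern r b (x - y) * f y \<partial>lborel)) (at 0)"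
    unfolding tendsto_at_iff_sequentially
  proof (intro allI impI)
    fix X :: "nat \<Rightarrow> real" assume nz: "\<forall>i. X i \<in> UNIV - {0}" and X: "X \<longlonglongrightarrow> 0"
    define Q where "Q n y = ((kern r (x + X n *\<^sub>R b - y) - kern r (x - y)) / X n) * f y" for n y
    have Xb: "(\<lambda>n. x + X n *\<^sub>R b) \<longlonglongrightarrow> x + 0 *\<^sub>R b" using X by (intro tendsto_intros)
    then obtain N where N: "\<And>n. n \<ge> N \<Longrightarrow> dist (x + X n *\<^sub>R b) x < 1"
      using metric_LIMSEQ_D[of _ x 1] by auto
    have eq: "(moll r f (x + X n *\<^sub>R b) - moll r f x) / X n = (\<integral>y. Q n y \<partial>lborel)" for n
    proof -
      have "moll r f (x + X n *\<^sub>R b) - moll r f x = (\<integral>y. kern r (x + X n *\<^sub>R b - y) *\<^sub>R f y - kern r (x - y) *\<^sub>R f y \<partial>lborel)"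
        using int C unfolding moll_reflect[OF fm] by (subst Bochner_Integration.integral_diff) auto
      also have "\<dots> / X n = (\<integral>y. (kern r (x + X n *\<^sub>R b - y) *\<^sub>R f y - kern r (x - y) *\<^sub>R f y) / X n \<partial>lborel)"
        by simp
      also have "\<dots> = (\<integral>y. Q n y \<partial>lborel)"
        by (intro Bochner_Integration.integral_cong) (auto simp: Q_def algebra_simps diff_divide_distrib)
      finally show ?thesis .
    qed
    have "(\<lambda>n. \<integral>y. Q (n + N) y \<partial>lborel) \<longlonglongrightarrow> (\<integral>y. dkern r b (x - y) * f y \<partial>lborel)"
    proof (rule conv_dominated[OF f fm kern_continuous kern_zero[OF r], where X="\<lambda>n. x + X (n + N) *\<^sub>R b" and L=L])
      show "(\<lambda>n. x + X (n + N) *\<^sub>R b) \<longlonglongrightarrow> x" using LIMSEQ_ignore_initial_segment[OF Xb, of N] by simp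
      show "dist (x + X (n + N) *\<^sub>R b) x \<le> 1" for n using N[of "n + N"] by simp
      have slope: "\<bar>(kern r (z + t *\<^sub>R b) - kern r z) / t\<bar> \<le> L" if "t \<noteq> 0" for z t
      proof -
        have "norm (kern r (z + t *\<^sub>R b) - kern r (z + 0 *\<^sub>R b)) \<le> L * norm (t - 0)"
          by (rule field_differentiable_bound[where S=UNIV and f'="\<lambda>s. dkern r b (z + s *\<^sub>R b)"])
             (use dkern_line[of r z b] L in auto)
        then show ?thesis using that by (simp add: field_simps)
      qed
      show "norm (Q (n + N) y) \<le> L * norm (f y)" for n y
      proof -
        have "\<bar>(kern r (x - y + X (n + N) *\<^sub>R b) - kern r (x - y)) / X (n + N)\<bar> \<le> L"
          using slope nz by simp
        moreover have "x - y + X (n + N) *\<^sub>R b = x + X (n + N) *\<^sub>R b - y" by simp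
        ultimately show ?thesis
          unfolding Q_def real_norm_def abs_mult by (intro mult_right_mono) (simp_all only: abs_ge_zero)
      qed
      show "Q (n + N) y = 0" if "y \<notin> cball x (r + 1)" for n y
      proof -
        have "norm (x + X (n + N) *\<^sub>R b - y) \<ge> r"
          using that N[of "n + N"] dist_triangle[of x y "x + X (n + N) *\<^sub>R b"]
          by (simp add: dist_norm norm_minus_commute)
        moreover have "norm (x - y) \<ge> r" using that by (simp add: dist_norm)
        ultimately have "kern r (x + X (n + N) *\<^sub>R b - y) = 0" "kern r (x - y) = 0"
          using kern_zero[OF r] by blast+
        then show ?thesis by (simp add: Q_def)
      qed
      show "(\<lambda>n. Q (n + N) y) \<longlonglongrightarrow> dkern r b (x - y) * f y" for y
      proof -
        have "((\<lambda>h. (kern r (x - y + (0 + h) *\<^sub>R b) - kern r (x - y + 0 *\<^sub>R b)) / h) \<longlongrightarrow> dkern r b (x - y + 0 *\<^sub>R b)) (at 0)"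
          using dkern_line[of r "x - y" b 0] unfolding DERIV_def .
        from tendsto_at_0_sequence[OF this X] nz
        have "(\<lambda>n. (kern r (x - y + (0 + X n) *\<^sub>R b) - kern r (x - y + 0 *\<^sub>R b)) / X n) \<longlonglongrightarrow> dkern r b (x - y + 0 *\<^sub>R b)"
          by blast
        then have "(\<lambda>n. (kern r (x + X n *\<^sub>R b - y) - kern r (x - y)) / X n) \<longlonglongrightarrow> dkern r b (x - y)"
          by (simp add: algebra_simps)
        then have "(\<lambda>n. Q n y) \<longlonglongrightarrow> dkern r b (x - y) * f y"
          unfolding Q_def by (intro tendsto_mult_right)
        then show ?thesis by (rule LIMSEQ_ignore_initial_segment)
      qed
    qed (use C in \<open>auto simp: Q_def\<close>)
    then show "((\<lambda>h. (moll r f (x + (0 + h) *\<^sub>R b) - moll r f (x + 0 *\<^sub>R b)) / h) \<circ> X) \<longlonglongrightarrow> (\<integral>y. dkern r b (x - y) * f y \<partial>lborel)"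
      using LIMSEQ_offset[of "\<lambda>n. \<integral>y. Q n y \<partial>lborel"] by (simp add: comp_def eq)
  qed
  then show ?thesis unfolding DERIV_def .
qed

lemma moll_inner:
  fixes F :: "'a::euclidean_space \<Rightarrow> 'b::euclidean_space"
  assumes "locally_integrable UNIV F" "F \<in> borel_measurable borel" "r > 0"
  shows "moll r F x \<bullet> b = (\<integral>y. kern r (x - y) * (F y \<bullet> b) \<partial>lborel)"
proof -
  obtain C where C: "\<And>z::'a. norm (kern r z) \<le> C" using kern_bounded[OF assms(3)] by metis
  have "integrable lborel (\<lambda>y. kern r (x - y) *\<^sub>R F y)"
    by (rule conv_integrable[OF assms(1,2) kern_continuous kern_zero[OF assms(3)]]) (use C in auto)
  then show ?thesis
    unfolding moll_reflect[OF assms(2)] by (subst integral_inner_left[symmetric]) auto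
qed

text \<open>For fixed \<open>x\<close> the reflected kernel is a test function in y. Its derivative
  carries a minus sign that cancels the one in the definition of the weak gradient, so the
  derivative passes to \<open>F\<close>.\<close>

lemma moll_derivative_weak:
  fixes f :: "'a::euclidean_space \<Rightarrow> real"
  assumes w: "weak_gradient UNIV f F" and m: "f \<in> borel_measurable borel" "F \<in> borel_measurable borel"
    and r: "r > 0" and b: "b \<in> Basis"
  shows "((\<lambda>t. moll r f (x + t *\<^sub>R b)) has_real_derivative moll r F x \<bullet> b) (at 0)"
proof -
  note [measurable] = m
  have t: "(\<lambda>y. kern r (x - y)) \<in> test_functions UNIV" by (rule kern_test[OF r]) simp
  have "(\<integral>y. f y * - dkern r b (x - y) \<partial>lebesgue) = - (\<integral>y. (F y \<bullet> b) * kern r (x - y) \<partial>lebesgue)"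
    using weak_gradientD[OF w open_UNIV t b] by (simp add: frechet_kern_diff)
  moreover have "(\<integral>y. f y * - dkern r b (x - y) \<partial>lebesgue) = (\<integral>y. f y * - dkern r b (x - y) \<partial>lborel)"
    by (rule integral_completion) measurable
  moreover have "(\<integral>y. (F y \<bullet> b) * kern r (x - y) \<partial>lebesgue) = (\<integral>y. (F y \<bullet> b) * kern r (x - y) \<partial>lborel)"
    by (rule integral_completion) measurable
  ultimately have "(\<integral>y. dkern r b (x - y) * f y \<partial>lborel) = moll r F x \<bullet> b"
    using moll_inner[OF weak_gradient_loc(2)[OF w] m(2) r, of x b] by (simp add: mult.commute)
  then show ?thesis using moll_line_derivative[OF weak_gradient_loc(1)[OF w] m(1) r, of x b] by simp
qed

lemma moll_chain_weak_gradient: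
  fixes f :: "'a::euclidean_space \<Rightarrow> real"
  assumes w: "weak_gradient UNIV f F" and m: "f \<in> borel_measurable borel" "F \<in> borel_measurable borel"
    and r: "r > 0" and T: "\<And>t. (T has_real_derivative T' t) (at t)" "continuous_on UNIV T'"
  shows "weak_gradient UNIV (\<lambda>x. T (moll r f x)) (\<lambda>x. T' (moll r f x) *\<^sub>R moll r F x)"
proof (rule weak_gradient_classical)
  note l = weak_gradient_loc[OF w]
  have c: "continuous_on UNIV (moll r f)" "continuous_on UNIV (moll r F)"
    using moll_continuous l m r by blast+
  have "continuous_on UNIV T" using T(1) by (meson DERIV_isCont continuous_at_imp_continuous_on)
  then show "continuous_on UNIV (\<lambda>x. T (moll r f x))" using c by (auto intro: continuous_on_compose2)
  show "continuous_on UNIV (\<lambda>x. T' (moll r f x) *\<^sub>R moll r F x)"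
    using c T(2) by (intro continuous_intros continuous_on_compose2[OF T(2) c(1)]) auto
  show "((\<lambda>t. T (moll r f (x + t *\<^sub>R b))) has_real_derivative (T' (moll r f x) *\<^sub>R moll r F x) \<bullet> b) (at 0)"
    if "b \<in> Basis" for x b
    using DERIV_chain2[OF T(1) moll_derivative_weak[OF w m r that, of x]] by simp
qed auto

text \<open>For radii at most 1 the mollification on \<open>K\<close> depends only on the values of
  \<open>f\<close> on a ball whose radius is larger by 1. There \<open>f\<close> may be replaced by
  an integrable function, to which \<open>moll_L1\<close> applies.\<close>

lemma moll_L1_on:
  fixes f :: "'a::euclidean_space \<Rightarrow> 'b::euclidean_space"
  assumes f: "locally_integrable UNIV f" and [measurable]: "f \<in> borel_measurable borel" and K: "compact K"
    and r: "\<And>n. 0 < r n" "\<And>n. r n \<le> 1" "r \<longlonglongrightarrow> 0"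
  shows "L1_on K (\<lambda>n. moll (r n) f) f"
  unfolding L1_on_def
proof -
  obtain R where R: "\<And>x. x \<in> K \<Longrightarrow> norm x \<le> R" using K compact_imp_bounded bounded_iff by metis
  define g where "g x = indicator (cball 0 (R + 1)) x *\<^sub>R f x" for x
  have ig: "integrable lborel g"
    unfolding g_def by (rule locally_integrable_lborel[OF f]) auto
  have "ennreal (norm (moll (r n) f x - f x)) * indicator K x \<le> ennreal (norm (moll (r n) g x - g x))" for n x
  proof (cases "x \<in> K")
    case True
    have "y \<in> cball 0 (R + 1)" if "y \<in> ball x (r n)" for y
      using that R[OF True] r(2)[of n] norm_triangle_ineq[of x "y - x"] by (simp add: dist_norm norm_minus_commute)
    then have "moll (r n) f x = moll (r n) g x"
      by (intro moll_local[OF r(1)]) (auto simp: g_def)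
    moreover have "f x = g x" using R[OF True] by (simp add: g_def)
    ultimately show ?thesis using True by simp
  qed simp
  then have "(\<integral>\<^sup>+x. ennreal (norm (moll (r n) f x - f x)) * indicator K x \<partial>lebesgue) \<le> (\<integral>\<^sup>+x. norm (moll (r n) g x - g x) \<partial>lborel)" for n
    unfolding nn_integral_completion by (intro nn_integral_mono)
  then show "(\<lambda>n. \<integral>\<^sup>+x. ennreal (norm (moll (r n) f x - f x)) * indicator K x \<partial>lebesgue) \<longlonglongrightarrow> 0"
    by (rule ennreal_tendsto_0_le[OF moll_L1[OF ig r(1,3)]])
qed

section \<open>Uniqueness and the chain rule\<close>

lemma compact_neighbourhood:
  fixes K :: "'a::euclidean_space set"
  assumes K: "compact K" "K \<subseteq> \<Omega>" and "open \<Omega>"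
  obtains e K' where "0 < e" "e \<le> 1" "compact K'" "K' \<subseteq> \<Omega>" "\<And>x. x \<in> K \<Longrightarrow> cball x e \<subseteq> K'"
proof -
  obtain d where d: "d > 0" "(\<Union>x\<in>K. cball x d) \<subseteq> \<Omega>"
    using compact_subset_open_imp_cball_epsilon_subset[OF K(1) assms(3) K(2)] by blast
  define e where "e = min 1 d"
  define K' where "K' = (\<Union>x\<in>K. \<Union>y\<in>cball 0 e. {x + y})"
  show ?thesis
  proof (rule that[of e K'])
    show "0 < e" "e \<le> 1" using d by (auto simp: e_def)
    show "compact K'" unfolding K'_def by (intro compact_sums' K) auto
    show "K' \<subseteq> \<Omega>"
    proof
      fix y assume "y \<in> K'"
      then obtain x w where "x \<in> K" "w \<in> cball 0 e" "y = x + w" by (auto simp: K'_def)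
      then have "y \<in> cball x d" by (simp add: dist_norm e_def)
      then show "y \<in> \<Omega>" using d(2) \<open>x \<in> K\<close> by blast
    qed
    show "cball x e \<subseteq> K'" if "x \<in> K" for x
    proof
      fix y assume "y \<in> cball x e"
      then have "y - x \<in> cball 0 e" by (simp add: dist_norm norm_minus_commute)
      moreover have "y = x + (y - x)" by simp
      ultimately show "y \<in> K'" using that unfolding K'_def by blast
    qed
  qed
qed

text \<open>Kernels of small radius centred in \<open>K\<close> are test functions, so all
  mollifications of \<open>h\<close>, cut off to a neighbourhood of \<open>K\<close>, vanish on
  \<open>K\<close>; their L^1 limit there is \<open>h\<close>. Countably many closed boxes exhaust
  the open set.\<close>

lemma fundamental_lemma:
  fixes h :: "'a::euclidean_space \<Rightarrow> real"
  assumes "open \<Omega>" and l: "locally_integrable \<Omega> h"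
    and z: "\<And>\<phi>. \<phi> \<in> test_functions \<Omega> \<Longrightarrow> (\<integral>x. h x * \<phi> x \<partial>lebesgue) = 0"
  shows "AE x in lebesgue. x \<in> \<Omega> \<longrightarrow> h x = 0"
proof -
  have K: "AE x in lebesgue. x \<in> K \<longrightarrow> h x = 0" if K: "compact K" "K \<subseteq> \<Omega>" for K
  proof -
    obtain e K' where e: "e > 0" and cK': "compact K'" "K' \<subseteq> \<Omega>" and sub: "\<And>x. x \<in> K \<Longrightarrow> cball x e \<subseteq> K'"
      by (rule compact_neighbourhood[OF K assms(1)]) (rule that, assumption+)
    have i0: "integrable lebesgue (\<lambda>x. indicator K' x *\<^sub>R h x)"
      by (rule locally_integrableD[OF l cK'])
    then obtain g where [measurable]: "g \<in> borel_measurable borel" and g: "AE x in lebesgue. indicator K' x *\<^sub>R h x = g x"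
      using borel_version by (metis borel_measurable_integrable)
    have ig: "integrable lborel g"
      using integrable_lebesgue_AE[OF i0 g] integrable_completion[of g lborel] by simp
    define r where "r n = e / real (Suc n)" for n
    have r: "\<And>n. r n > 0" "\<And>n. r n \<le> e"
      using e by (auto simp: r_def field_simps)
    have r0: "r \<longlonglongrightarrow> 0"
      unfolding r_def using tendsto_mult_right_zero[OF LIMSEQ_Suc[OF lim_1_over_n], of e] by simp
    have zero: "moll (r n) g x = 0" if "x \<in> K" for n x
    proof -
      have tf: "(\<lambda>y. kern (r n) (x - y)) \<in> test_functions \<Omega>"
      proof (rule kern_test[OF r(1)])
        have "cball x (r n) \<subseteq> cball x e" by (rule subset_cball[OF r(2)])
        then show "cball x (r n) \<subseteq> \<Omega>" using sub[OF that] cK'(2) by blast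
      qed
      have "moll (r n) g x = (\<integral>y. kern (r n) (x - y) * g y \<partial>lborel)"
        by (simp add: moll_reflect)
      also have "\<dots> = (\<integral>y. kern (r n) (x - y) * g y \<partial>lebesgue)"
        by (rule integral_completion[symmetric]) measurable
      \<comment> \<open>The kernel lives in \<open>cball x e\<close>, a subset of \<open>K'\<close>,
        where the Borel version \<open>g\<close> agrees with \<open>h\<close> almost
        everywhere.\<close>
      also have "\<dots> = (\<integral>y. h y * kern (r n) (x - y) \<partial>lebesgue)"
      proof (rule integral_cong_AE)
        show "(\<lambda>y. kern (r n) (x - y) * g y) \<in> borel_measurable lebesgue"
          by (intro measurable_completion) measurable
        show "(\<lambda>y. h y * kern (r n) (x - y)) \<in> borel_measurable lebesgue"
          using test_pairing_integrable(1)[OF l tf] by auto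
        show "AE y in lebesgue. kern (r n) (x - y) * g y = h y * kern (r n) (x - y)"
          using g
        proof eventually_elim
          case (elim y)
          show ?case
          proof (cases "y \<in> cball x e")
            case True
            then have "y \<in> K'" using sub that by blast
            then show ?thesis using elim by simp
          next
            case False
            then have "norm (x - y) \<ge> r n" using r(2)[of n] by (simp add: dist_norm)
            then show ?thesis using kern_zero[OF r(1), of n "x - y"] by simp
          qed
        qed
      qed
      finally show ?thesis using z[OF tf] by simp
    qed
    have Kb: "K \<in> sets borel" using K by (simp add: compact_imp_closed)
    have "(\<integral>\<^sup>+x. ennreal (norm (g x)) * indicator K x \<partial>lborel) \<le> (\<integral>\<^sup>+x. norm (moll (r n) g x - g x) \<partial>lborel)" for n
      by (intro nn_integral_mono) (auto simp: zero indicator_def)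
    then have "(\<lambda>n. \<integral>\<^sup>+x. ennreal (norm (g x)) * indicator K x \<partial>lborel) \<longlonglongrightarrow> 0"
      using ennreal_tendsto_0_le[OF moll_L1[OF ig r(1) r0]] by simp
    then have "(\<integral>\<^sup>+x. ennreal (norm (g x)) * indicator K x \<partial>lborel) = 0"
      by (simp add: LIMSEQ_const_iff)
    then have "AE x in lborel. ennreal (norm (g x)) * indicator K x = 0"
      using Kb by (subst (asm) nn_integral_0_iff_AE) auto
    then have "AE x in lebesgue. ennreal (norm (g x)) * indicator K x = 0" by (rule AE_completion)
    with g show ?thesis
    proof eventually_elim
      case (elim x)
      show ?case
      proof
        assume "x \<in> K"
        moreover have "x \<in> K'" using sub[OF \<open>x \<in> K\<close>] e by auto
        ultimately show "h x = 0" using elim by auto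
      qed
    qed
  qed
  obtain D where D: "countable D" "D \<subseteq> Pow \<Omega>" "\<And>X. X \<in> D \<Longrightarrow> \<exists>a b. X = cbox a b" "\<Union>D = \<Omega>"
    using open_countable_Union_open_cbox[OF assms(1)] by metis
  have "AE x in lebesgue. \<forall>X\<in>D. x \<in> X \<longrightarrow> h x = 0"
  proof (intro AE_ball_countable' K D)
    fix X assume X: "X \<in> D"
    then show "compact X" using D(3)[OF X] by (auto intro: compact_cbox)
    show "X \<subseteq> \<Omega>" using D(2) X by blast
  qed
  then show ?thesis by eventually_elim (use D in blast)
qed

lemma weak_gradient_unique:
  fixes \<Omega> :: "'a::euclidean_space set"
  assumes "open \<Omega>" "weak_gradient \<Omega> u G" "weak_gradient \<Omega> u H"
  shows "AE x in lebesgue. x \<in> \<Omega> \<longrightarrow> G x = H x"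
proof -
  have "AE x in lebesgue. x \<in> \<Omega> \<longrightarrow> (G x - H x) \<bullet> b = 0" if b: "b \<in> Basis" for b
  proof (rule fundamental_lemma[OF assms(1)])
    have w: "weak_gradient \<Omega> (\<lambda>x. u x - u x) (\<lambda>x. G x - H x)"
      by (rule weak_gradient_diff[OF assms(2,3,1)])
    then show "locally_integrable \<Omega> (\<lambda>x. (G x - H x) \<bullet> b)"
      using weak_gradient_loc(2) locally_integrable_inner by blast
    fix \<phi> assume "\<phi> \<in> test_functions \<Omega>"
    then show "(\<integral>x. (G x - H x) \<bullet> b * \<phi> x \<partial>lebesgue) = 0"
      using weak_gradientD[OF w assms(1) _ b] by simp
  qed
  then have "AE x in lebesgue. \<forall>b\<in>Basis. x \<in> \<Omega> \<longrightarrow> (G x - H x) \<bullet> b = 0"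
    by (intro AE_finite_allI) auto
  then show ?thesis
  proof eventually_elim
    case (elim x)
    then show ?case by (auto simp: euclidean_eq_iff[where 'a='a] inner_diff_left)
  qed
qed

section \<open>Comparison lemmas and the chain rule\<close>

lemma locally_integrable_bound:
  fixes f :: "'a::euclidean_space \<Rightarrow> 'b::euclidean_space" and g :: "'a \<Rightarrow> 'c::euclidean_space"
  assumes f: "locally_integrable \<Omega> f" and [measurable]: "g \<in> borel_measurable lebesgue"
    and le: "\<And>x. norm (g x) \<le> a + c * norm (f x)"
  shows "locally_integrable \<Omega> g"
  unfolding locally_integrable_iff
proof (intro allI impI)
  fix K assume K: "compact K \<and> K \<subseteq> \<Omega>"
  then have [measurable]: "K \<in> sets lebesgue" by (simp add: sets_lebesgue_compact)
  have "integrable lebesgue (\<lambda>x. a * indicator K x + c * norm (indicator K x *\<^sub>R f x))"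
  proof (intro Bochner_Integration.integrable_add integrable_mult_right integrable_norm)
    have "emeasure lebesgue K < \<infinity>"
      using K emeasure_bounded_finite[of K] compact_imp_bounded[of K] by (simp add: compact_imp_closed)
    then show "integrable lebesgue (indicator K :: 'a \<Rightarrow> real)"
      by (intro integrable_real_indicator) auto
    show "integrable lebesgue (\<lambda>x. indicator K x *\<^sub>R f x)" using locally_integrableD[OF f] K by blast
  qed
  then show "integrable lebesgue (\<lambda>x. indicator K x *\<^sub>R g x)"
  proof (rule Bochner_Integration.integrable_bound)
    show "AE x in lebesgue. norm (indicator K x *\<^sub>R g x) \<le> norm (a * indicator K x + c * norm (indicator K x *\<^sub>R f x))"
    proof (rule AE_I2)
      fix x show "norm (indicator K x *\<^sub>R g x) \<le> norm (a * indicator K x + c * norm (indicator K x *\<^sub>R f x))"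
        using le[of x] by (cases "x \<in> K") auto
    qed
  qed measurable
qed

lemma L1_on_cmult:
  fixes f :: "nat \<Rightarrow> 'a::euclidean_space \<Rightarrow> 'b::euclidean_space" and f' :: "nat \<Rightarrow> 'a \<Rightarrow> 'c::euclidean_space"
  assumes conv: "L1_on K f g"
    and [measurable]: "\<And>n. f n \<in> borel_measurable lebesgue" "g \<in> borel_measurable lebesgue" "K \<in> sets lebesgue"
    and le: "\<And>n x. norm (f' n x - g' x) \<le> M * norm (f n x - g x)"
  shows "L1_on K f' g'"
  unfolding L1_on_def
proof (rule ennreal_tendsto_0_le)
  show "(\<lambda>n. ennreal \<bar>M\<bar> * (\<integral>\<^sup>+x. ennreal (norm (f n x - g x)) * indicator K x \<partial>lebesgue)) \<longlonglongrightarrow> 0"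
    using ennreal_tendsto_cmult[OF _ conv[unfolded L1_on_def], of "ennreal \<bar>M\<bar>"] by simp
  fix n
  have "(\<integral>\<^sup>+x. ennreal (norm (f' n x - g' x)) * indicator K x \<partial>lebesgue)
    \<le> (\<integral>\<^sup>+x. ennreal \<bar>M\<bar> * (ennreal (norm (f n x - g x)) * indicator K x) \<partial>lebesgue)"
  proof (rule nn_integral_mono)
    fix x
    have "norm (f' n x - g' x) \<le> \<bar>M\<bar> * norm (f n x - g x)"
      using le[of n x] mult_right_mono[OF abs_ge_self[of M], of "norm (f n x - g x)"] by simp
    then show "ennreal (norm (f' n x - g' x)) * indicator K x \<le> ennreal \<bar>M\<bar> * (ennreal (norm (f n x - g x)) * indicator K x)"
      by (cases "x \<in> K") (auto simp: ennreal_mult[symmetric] ennreal_leI)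
  qed
  also have "\<dots> = ennreal \<bar>M\<bar> * (\<integral>\<^sup>+x. ennreal (norm (f n x - g x)) * indicator K x \<partial>lebesgue)"
    by (rule nn_integral_cmult) measurable
  finally show "(\<integral>\<^sup>+x. ennreal (norm (f' n x - g' x)) * indicator K x \<partial>lebesgue)
    \<le> ennreal \<bar>M\<bar> * (\<integral>\<^sup>+x. ennreal (norm (f n x - g x)) * indicator K x \<partial>lebesgue)" .
qed

lemma L1_on_sum:
  fixes f :: "nat \<Rightarrow> 'a::euclidean_space \<Rightarrow> 'b::euclidean_space"
  assumes "L1_on K f1 g1" "L1_on K f2 g2"
    and [measurable]: "\<And>n. f1 n \<in> borel_measurable lebesgue" "g1 \<in> borel_measurable lebesgue"
      "\<And>n. f2 n \<in> borel_measurable lebesgue" "g2 \<in> borel_measurable lebesgue" "K \<in> sets lebesgue"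
    and le: "\<And>n x. norm (f n x - g x) \<le> norm (f1 n x - g1 x) + norm (f2 n x - g2 x)"
  shows "L1_on K f g"
  unfolding L1_on_def
proof (rule ennreal_tendsto_0_le)
  show "(\<lambda>n. (\<integral>\<^sup>+x. ennreal (norm (f1 n x - g1 x)) * indicator K x \<partial>lebesgue) +
      (\<integral>\<^sup>+x. ennreal (norm (f2 n x - g2 x)) * indicator K x \<partial>lebesgue)) \<longlonglongrightarrow> 0"
    using tendsto_add[OF assms(1,2)[unfolded L1_on_def]] by simp
  fix n
  have "(\<integral>\<^sup>+x. ennreal (norm (f n x - g x)) * indicator K x \<partial>lebesgue)
    \<le> (\<integral>\<^sup>+x. ennreal (norm (f1 n x - g1 x)) * indicator K x + ennreal (norm (f2 n x - g2 x)) * indicator K x \<partial>lebesgue)"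
  proof (rule nn_integral_mono)
    fix x
    show "ennreal (norm (f n x - g x)) * indicator K x \<le> ennreal (norm (f1 n x - g1 x)) * indicator K x + ennreal (norm (f2 n x - g2 x)) * indicator K x"
      using ennreal_leI[OF le[of n x]] by (cases "x \<in> K") auto
  qed
  also have "\<dots> = (\<integral>\<^sup>+x. ennreal (norm (f1 n x - g1 x)) * indicator K x \<partial>lebesgue) +
      (\<integral>\<^sup>+x. ennreal (norm (f2 n x - g2 x)) * indicator K x \<partial>lebesgue)"
    by (rule nn_integral_add) measurable
  finally show "(\<integral>\<^sup>+x. ennreal (norm (f n x - g x)) * indicator K x \<partial>lebesgue) \<le> (\<integral>\<^sup>+x. ennreal (norm (f1 n x - g1 x)) * indicator K x \<partial>lebesgue) +
      (\<integral>\<^sup>+x. ennreal (norm (f2 n x - g2 x)) * indicator K x \<partial>lebesgue)" .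
qed

lemma L1_on_dominated:
  fixes f :: "nat \<Rightarrow> 'a::euclidean_space \<Rightarrow> 'b::euclidean_space" and w :: "'a \<Rightarrow> real"
  assumes [measurable]: "\<And>n. f n \<in> borel_measurable lebesgue" "g \<in> borel_measurable lebesgue"
    and w: "locally_integrable \<Omega> w" and K: "compact K" "K \<subseteq> \<Omega>"
    and bd: "\<And>n. AE x in lebesgue. norm (f n x) \<le> w x" and conv: "AE x in lebesgue. x \<in> K \<longrightarrow> (\<lambda>n. f n x) \<longlonglongrightarrow> g x"
  shows "L1_on K f g"
proof -
  have [measurable]: "K \<in> sets lebesgue" using K by (simp add: sets_lebesgue_compact)
  have iw: "integrable lebesgue (\<lambda>x. indicator K x *\<^sub>R w x)" using locally_integrableD[OF w K] .
  have "(\<lambda>n. \<integral>\<^sup>+x. norm (indicator K x *\<^sub>R g x - indicator K x *\<^sub>R f n x) \<partial>lebesgue) \<longlonglongrightarrow> 0"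
  proof (rule nn_integral_dominated_convergence_norm[where w="\<lambda>x. norm (indicator K x *\<^sub>R w x)"])
    show "AE x in lebesgue. norm (indicator K x *\<^sub>R f j x) \<le> norm (indicator K x *\<^sub>R w x)" for j
      using bd[of j] by eventually_elim (auto simp: indicator_def)
    show "(\<integral>\<^sup>+x. ennreal (norm (indicator K x *\<^sub>R w x)) \<partial>lebesgue) < \<infinity>"
      using iw unfolding integrable_iff_bounded by simp
    show "AE x in lebesgue. (\<lambda>i. indicator K x *\<^sub>R f i x) \<longlonglongrightarrow> indicator K x *\<^sub>R g x"
      using conv by eventually_elim (auto simp: indicator_def)
    show "(\<lambda>x. norm (indicator K x *\<^sub>R w x)) \<in> borel_measurable lebesgue" using iw by auto
  qed measurable
  moreover have "ennreal (norm (indicator K x *\<^sub>R g x - indicator K x *\<^sub>R f n x)) = ennreal (norm (f n x - g x)) * indicator K x" for n x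
    by (cases "x \<in> K") (auto simp: norm_minus_commute)
  ultimately show ?thesis by (simp add: L1_on_def)
qed

lemma L1_on_subseq: "L1_on K f g \<Longrightarrow> strict_mono s \<Longrightarrow> L1_on K (\<lambda>n. f (s n)) g"
  unfolding L1_on_def using LIMSEQ_subseq_LIMSEQ by (fastforce simp: comp_def)

lemma L1_on_AE_subseq:
  fixes f :: "nat \<Rightarrow> 'a::euclidean_space \<Rightarrow> 'b::euclidean_space"
  assumes conv: "L1_on K f g" and loc: "\<And>n. locally_integrable \<Omega> (f n)" "locally_integrable \<Omega> g" and K: "compact K" "K \<subseteq> \<Omega>"
  shows "\<exists>s::nat \<Rightarrow> nat. strict_mono s \<and> (AE x in lebesgue. x \<in> K \<longrightarrow> (\<lambda>n. f (s n) x) \<longlonglongrightarrow> g x)"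
proof -
  define d where "d n x = indicator K x *\<^sub>R f n x - indicator K x *\<^sub>R g x" for n x
  have i: "integrable lebesgue (d n)" for n
    unfolding d_def using locally_integrableD[OF loc(1) K] locally_integrableD[OF loc(2) K] by auto
  have "(\<integral>\<^sup>+x. ennreal (norm (f n x - g x)) * indicator K x \<partial>lebesgue) = ennreal (\<integral>x. norm (d n x) \<partial>lebesgue)" for n
  proof -
    have "(\<integral>\<^sup>+x. ennreal (norm (f n x - g x)) * indicator K x \<partial>lebesgue) = (\<integral>\<^sup>+x. ennreal (norm (d n x)) \<partial>lebesgue)"
      by (intro nn_integral_cong) (auto simp: d_def indicator_def)
    also have "\<dots> = ennreal (\<integral>x. norm (d n x) \<partial>lebesgue)"
      using i by (intro nn_integral_eq_integral) auto
    finally show ?thesis .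
  qed
  then have "(\<lambda>n. ennreal (\<integral>x. norm (d n x) \<partial>lebesgue)) \<longlonglongrightarrow> 0"
    using conv by (simp add: L1_on_def)
  then have "(\<lambda>n. \<integral>x. norm (d n x) \<partial>lebesgue) \<longlonglongrightarrow> 0"
    by (subst (asm) ennreal_tendsto_0_iff) auto
  then obtain s :: "nat \<Rightarrow> nat" where s: "strict_mono s" "AE x in lebesgue. (\<lambda>n. d (s n) x) \<longlonglongrightarrow> 0"
    using tendsto_L1_AE_subseq[of lebesgue d, OF i] by blast
  from s(2) have "AE x in lebesgue. x \<in> K \<longrightarrow> (\<lambda>n. f (s n) x) \<longlonglongrightarrow> g x"
    by eventually_elim (auto simp: d_def LIM_zero_iff)
  with s(1) show ?thesis by blast
qed

lemma deriv_bound_lipschitz: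
  fixes T :: "real \<Rightarrow> real"
  assumes "\<And>t. (T has_real_derivative T' t) (at t)" "\<And>t. \<bar>T' t\<bar> \<le> M"
  shows "\<bar>T a - T b\<bar> \<le> M * \<bar>a - b\<bar>"
  using field_differentiable_bound[of UNIV T T' M a b] assms by auto

text \<open>After mollification the chain rule is classical. \<open>T\<close> passes to the limit by
  its Lipschitz bound, but \<open>T'\<close> is merely continuous and bounded. The error of the
  gradient is therefore split into a bounded factor times the error of the mollified gradient, and
  the fixed function \<open>G\<close> times a factor that converges almost everywhere; the latter
  product is dominated.\<close>

lemma weak_gradient_chain:
  fixes f :: "'a::euclidean_space \<Rightarrow> real"
  assumes w: "weak_gradient UNIV f F"
    and T: "\<And>t. (T has_real_derivative T' t) (at t)" "continuous_on UNIV T'" "\<And>t. \<bar>T' t\<bar> \<le> M"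
  shows "weak_gradient UNIV (\<lambda>x. T (f x)) (\<lambda>x. T' (f x) *\<^sub>R F x)"
proof -
  note lip = deriv_bound_lipschitz[OF T(1,3)]
  have "continuous_on UNIV T" using T(1) by (meson DERIV_isCont continuous_at_imp_continuous_on)
  then have [measurable]: "T \<in> borel_measurable borel" "T' \<in> borel_measurable borel"
    using T(2) by (auto intro: borel_measurable_continuous_onI)
  obtain g where gm [measurable]: "g \<in> borel_measurable borel" and g: "AE x in lebesgue. f x = g x"
    using borel_version[OF locally_integrable_measurable[OF weak_gradient_loc(1)[OF w]]] by blast
  obtain G where Gm [measurable]: "G \<in> borel_measurable borel" and G: "AE x in lebesgue. F x = G x"
    using borel_version[OF locally_integrable_measurable[OF weak_gradient_loc(2)[OF w]]] by blast
  have w': "weak_gradient UNIV g G"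
    by (rule weak_gradient_AE[OF w]) (use g G in auto)
  note loc = weak_gradient_loc[OF w']
  have meas [measurable]: "k \<in> borel_measurable borel \<Longrightarrow> k \<in> borel_measurable lebesgue" for k :: "'a \<Rightarrow> 'd::euclidean_space"
    by (simp add: measurable_completion)
  have "weak_gradient UNIV (\<lambda>x. T (g x)) (\<lambda>x. T' (g x) *\<^sub>R G x)"
  proof (rule weak_gradient_closed[OF open_UNIV])
    show "locally_integrable UNIV (\<lambda>x. T (g x))"
    proof (rule locally_integrable_bound[OF loc(1), where a="\<bar>T 0\<bar>" and c=M])
      show "(\<lambda>x. T (g x)) \<in> borel_measurable lebesgue" by (rule meas) measurable
      show "norm (T (g x)) \<le> \<bar>T 0\<bar> + M * norm (g x)" for x
        using lip[of "g x" 0] by simp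
    qed
    show lG: "locally_integrable UNIV (\<lambda>x. T' (g x) *\<^sub>R G x)"
    proof (rule locally_integrable_bound[OF loc(2), where a=0 and c=M])
      show "(\<lambda>x. T' (g x) *\<^sub>R G x) \<in> borel_measurable lebesgue" by (rule meas) measurable
      show "norm (T' (g x) *\<^sub>R G x) \<le> 0 + M * norm (G x)" for x
        using T(3)[of "g x"] by (simp add: mult_right_mono)
    qed
    fix K :: "'a set" assume K: "compact K" "K \<subseteq> UNIV"
    have Km [measurable]: "K \<in> sets lebesgue" using K by (simp add: sets_lebesgue_compact)
    define r where "r n = 1 / real (Suc n)" for n
    have r: "\<And>n. 0 < r n" "\<And>n. r n \<le> 1" "r \<longlonglongrightarrow> 0"
      using LIMSEQ_Suc[OF lim_1_over_n] by (auto simp: r_def[abs_def])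
    have c1: "L1_on K (\<lambda>n. moll (r n) g) g" and c2: "L1_on K (\<lambda>n. moll (r n) G) G"
      using moll_L1_on loc gm Gm K(1) r by blast+
    have "locally_integrable UNIV (moll (r n) g)" for n
      by (intro locally_integrable_continuous moll_continuous loc gm r)
    \<comment> \<open>The subsequence depends on \<open>K\<close>, as
      \<open>weak_gradient_closed\<close> permits.\<close>
    then obtain s :: "nat \<Rightarrow> nat" where s: "strict_mono s" "AE x in lebesgue. x \<in> K \<longrightarrow> (\<lambda>n. moll (r (s n)) g x) \<longlonglongrightarrow> g x"
      using L1_on_AE_subseq[OF c1 _ loc(1) K] by blast
    define v where "v n x = T (moll (r (s n)) g x)" for n x
    define H where "H n x = T' (moll (r (s n)) g x) *\<^sub>R moll (r (s n)) G x" for n x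
    have [measurable]: "moll q g \<in> borel_measurable lebesgue" "moll q G \<in> borel_measurable lebesgue"
      "g \<in> borel_measurable lebesgue" "G \<in> borel_measurable lebesgue" for q
      by (auto intro!: meas)
    have "L1_on K v (\<lambda>x. T (g x))"
      by (rule L1_on_cmult[OF L1_on_subseq[OF c1 s(1)], where M=M]) (use lip in \<open>auto simp: v_def\<close>)
    moreover have "L1_on K H (\<lambda>x. T' (g x) *\<^sub>R G x)"
    proof (rule L1_on_sum[where ?f1.0="\<lambda>n x. M *\<^sub>R moll (r (s n)) G x" and ?g1.0="\<lambda>x. M *\<^sub>R G x"
        and ?f2.0="\<lambda>n x. T' (moll (r (s n)) g x) *\<^sub>R G x" and ?g2.0="\<lambda>x. T' (g x) *\<^sub>R G x"])
      show "L1_on K (\<lambda>n x. M *\<^sub>R moll (r (s n)) G x) (\<lambda>x. M *\<^sub>R G x)"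
        by (rule L1_on_cmult[OF L1_on_subseq[OF c2 s(1)], where M="\<bar>M\<bar>"]) (auto simp: scaleR_diff_right[symmetric])
      show "L1_on K (\<lambda>n x. T' (moll (r (s n)) g x) *\<^sub>R G x) (\<lambda>x. T' (g x) *\<^sub>R G x)"
      proof (rule L1_on_dominated[where w="\<lambda>x. M * norm (G x)", OF _ _ _ K])
        show "locally_integrable UNIV (\<lambda>x. M * norm (G x))"
          by (rule locally_integrable_bound[OF loc(2), where a=0 and c="\<bar>M\<bar>"]) (auto simp: abs_mult)
        show "AE x in lebesgue. norm (T' (moll (r (s n)) g x) *\<^sub>R G x) \<le> M * norm (G x)" for n
          using T(3) by (auto simp: mult_right_mono)
        show "AE x in lebesgue. x \<in> K \<longrightarrow> (\<lambda>n. T' (moll (r (s n)) g x) *\<^sub>R G x) \<longlonglongrightarrow> T' (g x) *\<^sub>R G x"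
          using s(2)
        proof eventually_elim
          case (elim x)
          have "isCont T' (g x)" using T(2) by (simp add: continuous_on_eq_continuous_at)
          then show ?case using elim by (auto intro!: tendsto_intros isCont_tendsto_compose[of _ T'])
        qed
      qed measurable
      show "norm (H n x - T' (g x) *\<^sub>R G x) \<le> norm (M *\<^sub>R moll (r (s n)) G x - M *\<^sub>R G x) +
           norm (T' (moll (r (s n)) g x) *\<^sub>R G x - T' (g x) *\<^sub>R G x)" for n x
      proof -
        let ?t = "T' (moll (r (s n)) g x)"
        have "H n x - T' (g x) *\<^sub>R G x = ?t *\<^sub>R (moll (r (s n)) G x - G x) + (?t *\<^sub>R G x - T' (g x) *\<^sub>R G x)"
          by (simp add: H_def algebra_simps)
        also have "norm \<dots> \<le> norm (?t *\<^sub>R (moll (r (s n)) G x - G x)) + norm (?t *\<^sub>R G x - T' (g x) *\<^sub>R G x)"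
          by (rule norm_triangle_ineq)
        also have "norm (?t *\<^sub>R (moll (r (s n)) G x - G x)) \<le> norm (M *\<^sub>R moll (r (s n)) G x - M *\<^sub>R G x)"
          unfolding scaleR_diff_right[symmetric] norm_scaleR
          using T(3)[of "moll (r (s n)) g x"] by (intro mult_right_mono) auto
        finally show ?thesis by simp
      qed
    qed measurable
    moreover have "weak_gradient UNIV (v n) (H n)" for n
      unfolding v_def[abs_def] H_def[abs_def] by (rule moll_chain_weak_gradient[OF w' gm Gm r(1) T(1,2)])
    ultimately show "\<exists>v H. (\<forall>n::nat. weak_gradient UNIV (v n) (H n)) \<and> L1_on K v (\<lambda>x. T (g x)) \<and> L1_on K H (\<lambda>x. T' (g x) *\<^sub>R G x)"
      by blast
  qed
  then show ?thesis
  proof (rule weak_gradient_AE[OF _ open_UNIV])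
    show "AE x in lebesgue. x \<in> UNIV \<longrightarrow> T (g x) = T (f x)" using g by eventually_elim auto
    show "AE x in lebesgue. x \<in> UNIV \<longrightarrow> T' (g x) *\<^sub>R G x = T' (f x) *\<^sub>R F x"
      using g G by eventually_elim auto
  qed
qed

section \<open>C^1 functions built from squared positive parts, products and truncations\<close>

lemma DERIV_pos_part_square:
  "((\<lambda>t. (max 0 t)\<^sup>2) has_real_derivative 2 * max 0 (t::real)) (at t)"
proof -
  consider "t > 0" | "t < 0" | "t = 0" by linarith
  then show ?thesis
  proof cases
    case 1
    have ev: "\<forall>\<^sub>F s in nhds t. (max 0 s)\<^sup>2 = s\<^sup>2"
      using eventually_nhds_in_open[of "{0<..}" t] 1 by (auto elim!: eventually_mono)
    have "((\<lambda>t. t\<^sup>2) has_real_derivative 2 * max 0 t) (at t)"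
      using 1 by (auto intro!: derivative_eq_intros)
    then show ?thesis by (simp add: DERIV_cong_ev[OF refl ev refl])
  next
    case 2
    have ev: "\<forall>\<^sub>F s in nhds t. (max 0 s)\<^sup>2 = 0"
      using eventually_nhds_in_open[of "{..<0}" t] 2 by (auto elim!: eventually_mono)
    have "((\<lambda>t. 0) has_real_derivative 2 * max 0 t) (at t)"
      using 2 by simp
    then show ?thesis by (simp add: DERIV_cong_ev[OF refl ev refl])
  next
    case 3
    have "((\<lambda>h::real. (max 0 h)\<^sup>2 / h) \<longlongrightarrow> 0) (at 0)"
    proof (rule Lim_null_comparison)
      show "\<forall>\<^sub>F h::real in at 0. norm ((max 0 h)\<^sup>2 / h) \<le> \<bar>h\<bar>"
        by (rule always_eventually) (auto simp: max_def power2_eq_square)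
      show "((\<lambda>h::real. \<bar>h\<bar>) \<longlongrightarrow> 0) (at 0)" by (auto intro!: tendsto_eq_intros)
    qed
    then show ?thesis using 3 by (simp add: DERIV_def)
  qed
qed

text \<open>Squaring has an unbounded derivative. \<open>T\<close> subtracts the squared excess
  beyond \<open>M\<close> on either side and so continues t^2 affinely outside [-M, M]; its
  derivative is bounded by 2 M, and on the range of \<open>f\<close> nothing changes.\<close>

lemma weak_gradient_square:
  fixes f :: "'a::euclidean_space \<Rightarrow> real"
  assumes w: "weak_gradient UNIV f F" and bd: "\<And>x. \<bar>f x\<bar> \<le> M"
  shows "weak_gradient UNIV (\<lambda>x. (f x)\<^sup>2) (\<lambda>x. (2 * f x) *\<^sub>R F x)"
proof -
  define T where "T t = t\<^sup>2 - (max 0 (t - M))\<^sup>2 - (max 0 (- t - M))\<^sup>2" for t :: real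
  define T' where "T' t = 2 * t - 2 * max 0 (t - M) + 2 * max 0 (- t - M)" for t :: real
  have M0: "M \<ge> 0" using bd[of undefined] by (meson abs_ge_zero order_trans)
  have "(T has_real_derivative T' t) (at t)" for t
  proof -
    have 1: "((\<lambda>t. (max 0 (t - M))\<^sup>2) has_real_derivative 2 * max 0 (t - M) * 1) (at t)"
      by (rule DERIV_chain2[OF DERIV_pos_part_square]) (auto intro!: derivative_eq_intros)
    have 2: "((\<lambda>t. (max 0 (- t - M))\<^sup>2) has_real_derivative 2 * max 0 (- t - M) * (- 1)) (at t)"
      by (rule DERIV_chain2[OF DERIV_pos_part_square]) (auto intro!: derivative_eq_intros)
    have 3: "((\<lambda>t. t\<^sup>2) has_real_derivative 2 * t) (at t)" by (auto intro!: derivative_eq_intros)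
    from DERIV_diff[OF DERIV_diff[OF 3 1] 2] show ?thesis
      unfolding T_def[abs_def] T'_def by simp
  qed
  moreover have "continuous_on UNIV T'" unfolding T'_def by (intro continuous_intros)
  moreover have "\<bar>T' t\<bar> \<le> 2 * M" for t using M0 by (auto simp: T'_def max_def)
  ultimately have "weak_gradient UNIV (\<lambda>x. T (f x)) (\<lambda>x. T' (f x) *\<^sub>R F x)"
    by (rule weak_gradient_chain[OF w])
  moreover have "T (f x) = (f x)\<^sup>2" "T' (f x) = 2 * f x" for x
    using bd[of x] by (auto simp: T_def T'_def max_def abs_le_iff)
  ultimately show ?thesis by simp
qed

text \<open>By polarisation.\<close>

lemma weak_gradient_product:
  fixes f g :: "'a::euclidean_space \<Rightarrow> real"
  assumes f: "weak_gradient UNIV f F" and g: "weak_gradient UNIV g G"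
    and bd: "\<And>x. \<bar>f x\<bar> \<le> M" "\<And>x. \<bar>g x\<bar> \<le> N"
  shows "weak_gradient UNIV (\<lambda>x. f x * g x) (\<lambda>x. f x *\<^sub>R G x + g x *\<^sub>R F x)"
proof -
  have "weak_gradient UNIV (\<lambda>x. (f x + g x)\<^sup>2) (\<lambda>x. (2 * (f x + g x)) *\<^sub>R (F x + G x))"
    by (rule weak_gradient_square[OF weak_gradient_add[OF f g open_UNIV], where M="M + N"])
       (use bd in \<open>meson abs_triangle_ineq add_mono order_trans\<close>)
  moreover have "weak_gradient UNIV (\<lambda>x. (f x - g x)\<^sup>2) (\<lambda>x. (2 * (f x - g x)) *\<^sub>R (F x - G x))"
    by (rule weak_gradient_square[OF weak_gradient_diff[OF f g open_UNIV], where M="M + N"])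
       (use bd in \<open>meson abs_triangle_ineq4 add_mono order_trans\<close>)
  ultimately have "weak_gradient UNIV (\<lambda>x. (1/4) * ((f x + g x)\<^sup>2 - (f x - g x)\<^sup>2))
    (\<lambda>x. (1/4) *\<^sub>R ((2 * (f x + g x)) *\<^sub>R (F x + G x) - (2 * (f x - g x)) *\<^sub>R (F x - G x)))"
    by (intro weak_gradient_scale weak_gradient_diff open_UNIV)
  moreover have "(1/4) * ((f x + g x)\<^sup>2 - (f x - g x)\<^sup>2) = f x * g x" for x
    by (simp add: power2_eq_square algebra_simps)
  moreover have "(1/4) *\<^sub>R ((2 * (f x + g x)) *\<^sub>R (F x + G x) - (2 * (f x - g x)) *\<^sub>R (F x - G x)) = f x *\<^sub>R G x + g x *\<^sub>R F x" for x
  proof -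
    have "(2 * (f x + g x)) *\<^sub>R (F x + G x) - (2 * (f x - g x)) *\<^sub>R (F x - G x) = 4 *\<^sub>R (f x *\<^sub>R G x + g x *\<^sub>R F x)"
      by (simp add: algebra_simps scaleR_2[symmetric])
    then show ?thesis by simp
  qed
  ultimately show ?thesis by simp
qed

text \<open>Applied to a function admissible for the capacity of a set, it vanishes wherever that
  function is at least 1, and it tends to 1 wherever a sequence of such functions tends to
  0.\<close>

definition dome :: "real \<Rightarrow> real" where "dome t = (max 0 (1 - t\<^sup>2))\<^sup>2"
definition dome' :: "real \<Rightarrow> real" where "dome' t = - 4 * t * max 0 (1 - t\<^sup>2)"

lemma dome_DERIV: "(dome has_real_derivative dome' t) (at t)"
proof -
  have "((\<lambda>t. (max 0 (1 - t\<^sup>2))\<^sup>2) has_real_derivative 2 * max 0 (1 - t\<^sup>2) * (- (2 * t))) (at t)"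
    by (rule DERIV_chain2[OF DERIV_pos_part_square]) (auto intro!: derivative_eq_intros)
  then show ?thesis by (simp add: dome_def[abs_def] dome'_def mult_ac)
qed

lemma dome_facts:
  "continuous_on UNIV dome'" "\<bar>dome' t\<bar> \<le> 4" "0 \<le> dome t" "dome t \<le> 1" "\<bar>t\<bar> \<ge> 1 \<Longrightarrow> dome t = 0" "dome 0 = 1" "dome' 0 = 0"
proof -
  show "continuous_on UNIV dome'" unfolding dome'_def by (intro continuous_intros)
  show "\<bar>dome' t\<bar> \<le> 4"
  proof (cases "\<bar>t\<bar> \<le> 1")
    case True
    then have "t\<^sup>2 \<le> 1" by (simp add: abs_square_le_1)
    then have "max 0 (1 - t\<^sup>2) \<le> 1" "0 \<le> max 0 (1 - t\<^sup>2)" by auto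
    then have "\<bar>t\<bar> * \<bar>max 0 (1 - t\<^sup>2)\<bar> \<le> 1 * 1" using True by (intro mult_mono) auto
    then show ?thesis by (simp add: dome'_def abs_mult)
  next
    case False
    then have "t\<^sup>2 > 1" by (metis abs_square_le_1 not_le)
    then show ?thesis by (simp add: dome'_def max_def)
  qed
  show "0 \<le> dome t" by (simp add: dome_def)
  have "max 0 (1 - t\<^sup>2) \<le> 1" by simp
  then show "dome t \<le> 1" unfolding dome_def by (intro power_le_one) auto
  show "\<bar>t\<bar> \<ge> 1 \<Longrightarrow> dome t = 0"
    using one_le_power[of "\<bar>t\<bar>" 2] by (simp add: dome_def max_def)
  show "dome 0 = 1" "dome' 0 = 0" by (auto simp: dome_def dome'_def)
qed

text \<open>
  \<open>gap\<close> vanishes on \<open>[-1, 1]\<close> and \<open>gap'\<close> tends to \<open>1\<close> at infinity, so \<open>gap (k * t) / k\<close> tends to the identity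
  with bounded derivatives; the denominator \<open>1 + (t / k)\<^sup>2\<close> makes the truncations bounded.
\<close>

definition gap :: "real \<Rightarrow> real" where
  "gap t = t * ((max 0 (t\<^sup>2 - 1))\<^sup>2 / (1 + (max 0 (t\<^sup>2 - 1))\<^sup>2))"
definition gap' :: "real \<Rightarrow> real" where
  "gap' t = (max 0 (t\<^sup>2 - 1))\<^sup>2 / (1 + (max 0 (t\<^sup>2 - 1))\<^sup>2) + 4 * t\<^sup>2 * max 0 (t\<^sup>2 - 1) / (1 + (max 0 (t\<^sup>2 - 1))\<^sup>2)\<^sup>2"

lemma gap_DERIV: "(gap has_real_derivative gap' t) (at t)"
proof -
  define P where "P = (\<lambda>t::real. (max 0 (t\<^sup>2 - 1))\<^sup>2)"
  have P0: "1 + P t > 0" for t by (simp add: P_def add_pos_nonneg)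
  have dP: "(P has_real_derivative 2 * max 0 (t\<^sup>2 - 1) * (2 * t)) (at t)"
    unfolding P_def by (rule DERIV_chain2[OF DERIV_pos_part_square]) (auto intro!: derivative_eq_intros)
  have d1: "((\<lambda>t. 1 + P t) has_real_derivative 2 * max 0 (t\<^sup>2 - 1) * (2 * t)) (at t)"
    using DERIV_add[OF DERIV_const dP] by simp
  have "((\<lambda>t. P t / (1 + P t)) has_real_derivative (2 * max 0 (t\<^sup>2 - 1) * (2 * t)) / (1 + P t)\<^sup>2) (at t)"
    using DERIV_quotient[OF dP d1] P0[of t] by (simp add: algebra_simps power2_eq_square)
  from DERIV_mult[OF DERIV_ident this]
  have "((\<lambda>t. t * (P t / (1 + P t))) has_real_derivative
     P t / (1 + P t) + 4 * t\<^sup>2 * max 0 (t\<^sup>2 - 1) / (1 + P t)\<^sup>2) (at t)"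
    by (simp add: power2_eq_square mult_ac)
  then show ?thesis by (simp add: gap_def[abs_def] gap'_def P_def)
qed

lemma gap_cont: "continuous_on UNIV gap'"
proof -
  have "1 + (max 0 (t\<^sup>2 - 1))\<^sup>2 \<noteq> 0" for t :: real
    by (metis add_pos_nonneg less_irrefl zero_le_power2 zero_less_one)
  then show ?thesis unfolding gap'_def by (intro continuous_intros) auto
qed

lemma gap_zero:
  assumes "\<bar>t\<bar> \<le> 1"
  shows "gap t = 0"
proof -
  have "max 0 (t\<^sup>2 - 1) = 0" using assms abs_square_le_1[of t] by simp
  then show ?thesis unfolding gap_def by simp
qed

lemma gap_bound: "\<bar>gap t\<bar> \<le> \<bar>t\<bar>"
proof -
  let ?P = "(max 0 (t\<^sup>2 - 1))\<^sup>2"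
  have "0 \<le> ?P / (1 + ?P)" "?P / (1 + ?P) \<le> 1"
    by (auto intro!: divide_nonneg_pos add_pos_nonneg simp: divide_le_eq_1 add_nonneg_eq_0_iff)
  then have "\<bar>t\<bar> * \<bar>?P / (1 + ?P)\<bar> \<le> \<bar>t\<bar> * 1" by (intro mult_left_mono) auto
  then show ?thesis unfolding gap_def abs_mult by simp
qed

text \<open>With s the positive part of t^2 - 1, the first summand of \<open>gap'\<close> differs
  from 1 by 1/(1 + s^2). In the second, t^2 s = (1 + s) s \<le> 2 (1 + s^2), which contributes at
  most 8/(1 + s^2); together 9.\<close>

lemma gap'_remainder: "0 \<le> gap' t" "\<bar>gap' t - 1\<bar> \<le> 9 / (1 + (max 0 (t\<^sup>2 - 1))\<^sup>2)"
proof -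
  define s where "s = max 0 (t\<^sup>2 - 1)"
  have s: "s \<ge> 0" by (simp add: s_def)
  have D: "1 + s\<^sup>2 > 0" by (simp add: add_pos_nonneg)
  have eq: "gap' t = s\<^sup>2 / (1 + s\<^sup>2) + 4 * t\<^sup>2 * s / (1 + s\<^sup>2)\<^sup>2" by (simp add: gap'_def s_def)
  show "0 \<le> gap' t" unfolding eq using s D by simp
  have e1: "t\<^sup>2 * s = (1 + s) * s" by (auto simp: s_def max_def)
  have "s \<le> 1 + s\<^sup>2" using zero_le_power2[of "s - 1"] s by (simp add: power2_eq_square algebra_simps)
  then have "(1 + s) * s \<le> 2 * (1 + s\<^sup>2)" by (simp add: power2_eq_square algebra_simps)
  moreover have "4 * t\<^sup>2 * s = 4 * ((1 + s) * s)" by (simp only: mult.assoc e1)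
  ultimately have "4 * t\<^sup>2 * s \<le> 8 * (1 + s\<^sup>2)" by linarith
  then have "4 * t\<^sup>2 * s / (1 + s\<^sup>2)\<^sup>2 \<le> 8 * (1 + s\<^sup>2) / (1 + s\<^sup>2)\<^sup>2"
    by (rule divide_right_mono) simp
  also have "8 * d / d\<^sup>2 = 8 / d" if "d > 0" for d :: real
    using that by (simp add: power2_eq_square)
  note this[OF D]
  finally have 1: "4 * t\<^sup>2 * s / (1 + s\<^sup>2)\<^sup>2 \<le> 8 / (1 + s\<^sup>2)" .
  have 2: "0 \<le> 4 * t\<^sup>2 * s / (1 + s\<^sup>2)\<^sup>2" using s by simp
  have 3: "s\<^sup>2 / (1 + s\<^sup>2) - 1 = - (1 / (1 + s\<^sup>2))" using D by (simp add: field_simps)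
  have 4: "9 / (1 + s\<^sup>2) = 8 / (1 + s\<^sup>2) + 1 / (1 + s\<^sup>2)" by (simp add: add_divide_distrib[symmetric])
  have 5: "1 / (1 + s\<^sup>2) > 0" using D by simp
  have "\<lbrakk>b \<le> d; 0 \<le> b; a - 1 = - c; e = d + c; 0 < c\<rbrakk> \<Longrightarrow> \<bar>a + b - 1\<bar> \<le> e" for a b c d e :: real
    by linarith
  from this[OF 1 2 3 4 5] have "\<bar>gap' t - 1\<bar> \<le> 9 / (1 + s\<^sup>2)"
    unfolding eq .
  then show "\<bar>gap' t - 1\<bar> \<le> 9 / (1 + (max 0 (t\<^sup>2 - 1))\<^sup>2)" by (simp add: s_def)
qed

lemma gap_remainder: "\<bar>gap t - t\<bar> = \<bar>t\<bar> / (1 + (max 0 (t\<^sup>2 - 1))\<^sup>2)"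
proof -
  let ?D = "1 + (max 0 (t\<^sup>2 - 1))\<^sup>2"
  have D: "?D > 0" by (simp add: add_pos_nonneg)
  then have "gap t - t = - (t / ?D)" unfolding gap_def by (simp add: field_simps)
  then show ?thesis using D by simp
qed

definition trunc :: "nat \<Rightarrow> real \<Rightarrow> real" where
  "trunc n t = gap (real (Suc n) * t) / real (Suc n) / (1 + (t / real (Suc n))\<^sup>2)"
definition trunc' :: "nat \<Rightarrow> real \<Rightarrow> real" where
  "trunc' n t = gap' (real (Suc n) * t) / (1 + (t / real (Suc n))\<^sup>2)
     - gap (real (Suc n) * t) / real (Suc n) * (2 * t / (real (Suc n))\<^sup>2) / (1 + (t / real (Suc n))\<^sup>2)\<^sup>2"

lemma trunc_denominator: "1 + (t / real (Suc n))\<^sup>2 > (0::real)"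
  by (simp add: add_pos_nonneg del: of_nat_Suc)

lemma trunc_DERIV: "(trunc n has_real_derivative trunc' n t) (at t)"
proof -
  let ?k = "real (Suc n)"
  have k: "?k > 0" by simp
  have g: "((\<lambda>t. gap (?k * t)) has_real_derivative gap' (?k * t) * ?k) (at t)"
    by (rule DERIV_chain2[OF gap_DERIV]) (auto intro!: derivative_eq_intros)
  have g2: "((\<lambda>t. gap (?k * t) / ?k) has_real_derivative gap' (?k * t)) (at t)"
    using DERIV_cdivide[OF g, of ?k] k by (simp del: of_nat_Suc)
  have d: "((\<lambda>t. 1 + (t / ?k)\<^sup>2) has_real_derivative 2 * t / ?k\<^sup>2) (at t)"
    using k by (auto intro!: derivative_eq_intros simp: power2_eq_square field_simps simp del: of_nat_Suc)
  from DERIV_quotient[OF g2 d] trunc_denominator[of t n]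
  have "((\<lambda>t. gap (?k * t) / ?k / (1 + (t / ?k)\<^sup>2)) has_real_derivative
    (gap' (?k * t) * (1 + (t / ?k)\<^sup>2) - (2 * t / ?k\<^sup>2) * (gap (?k * t) / ?k)) / (1 + (t / ?k)\<^sup>2)^2) (at t)"
    by (simp add: power2_eq_square del: of_nat_Suc)
  moreover have "(gap' (?k * t) * (1 + (t / ?k)\<^sup>2) - (2 * t / ?k\<^sup>2) * (gap (?k * t) / ?k)) / (1 + (t / ?k)\<^sup>2)^2 = trunc' n t"
    using trunc_denominator[of t n] unfolding trunc'_def diff_divide_distrib
    by (simp add: power2_eq_square mult.commute del: of_nat_Suc)
  ultimately show ?thesis by (simp add: trunc_def[abs_def])
qed

lemma trunc_continuous: "continuous_on UNIV (trunc n)"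
  using trunc_DERIV by (meson DERIV_isCont continuous_at_imp_continuous_on)

lemma trunc_cont: "continuous_on UNIV (trunc' n)"
proof -
  have gc: "continuous_on UNIV gap"
    using gap_DERIV by (meson DERIV_isCont continuous_at_imp_continuous_on)
  show ?thesis
    unfolding trunc'_def[abs_def] using trunc_denominator[of _ n]
    by (intro continuous_intros continuous_on_compose2[OF gap_cont] continuous_on_compose2[OF gc])
       (auto simp del: of_nat_Suc simp: less_imp_neq[THEN not_sym])
qed

lemma gap_scaled_bound: "\<bar>gap (real (Suc n) * t) / real (Suc n)\<bar> \<le> \<bar>t\<bar>"
  using gap_bound[of "real (Suc n) * t"] by (simp add: abs_mult divide_le_eq mult.commute del: of_nat_Suc)

lemma trunc_abs_le: "\<bar>trunc n t\<bar> \<le> \<bar>t\<bar> / (1 + (t / real (Suc n))\<^sup>2)"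
proof -
  have "\<bar>trunc n t\<bar> = \<bar>gap (real (Suc n) * t) / real (Suc n)\<bar> / (1 + (t / real (Suc n))\<^sup>2)"
    unfolding trunc_def abs_divide[of _ "1 + _"] by (simp only: abs_of_pos[OF trunc_denominator])
  then show ?thesis
    using divide_right_mono[OF gap_scaled_bound less_imp_le[OF trunc_denominator]] by metis
qed

lemma trunc_le: "\<bar>trunc n t\<bar> \<le> \<bar>t\<bar>"
proof -
  have "\<bar>trunc n t\<bar> \<le> \<bar>t\<bar> / (1 + (t / real (Suc n))\<^sup>2)"
    by (rule trunc_abs_le)
  also have "\<dots> \<le> \<bar>t\<bar> / 1" by (intro divide_left_mono) (auto simp: add_pos_nonneg)
  finally show ?thesis by simp
qed

text \<open>With x = t/(n + 1), the first ratio bounds the second summand of \<open>trunc'\<close>,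
  and the second ratio gives the height n + 1 of \<open>trunc n\<close>.\<close>

lemma quadratic_ratio: "2 * (x\<^sup>2) / (1 + x\<^sup>2)\<^sup>2 \<le> (1::real)" "\<bar>x\<bar> / (1 + x\<^sup>2) \<le> (1::real)"
proof -
  have D: "1 + x\<^sup>2 > 0" by (simp add: add_pos_nonneg)
  have "(1 + x\<^sup>2)\<^sup>2 = 1 + 2 * x\<^sup>2 + (x\<^sup>2)\<^sup>2" by (simp add: power2_eq_square algebra_simps)
  then have "2 * x\<^sup>2 \<le> (1 + x\<^sup>2)\<^sup>2" using zero_le_power2[of "x\<^sup>2"] by linarith
  then show "2 * (x\<^sup>2) / (1 + x\<^sup>2)\<^sup>2 \<le> 1" using D by (subst divide_le_eq_1_pos) auto
  have "\<bar>x\<bar> \<le> 1 + \<bar>x\<bar>\<^sup>2" using zero_le_power2[of "\<bar>x\<bar> - 1"] abs_ge_zero[of x] 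
    by (simp only: power2_diff) simp
  then show "\<bar>x\<bar> / (1 + x\<^sup>2) \<le> 1" using D by (simp add: divide_le_eq_1)
qed

lemma trunc_bounded: "\<bar>trunc n t\<bar> \<le> real (Suc n)"
proof -
  let ?k = "real (Suc n)"
  have "\<bar>trunc n t\<bar> \<le> \<bar>t\<bar> / (1 + (t / ?k)\<^sup>2)"
    by (rule trunc_abs_le)
  also have "\<dots> = ?k * (\<bar>t / ?k\<bar> / (1 + (t / ?k)\<^sup>2))" by (simp add: abs_divide del: of_nat_Suc)
  also have "\<dots> \<le> ?k * 1" by (intro mult_left_mono quadratic_ratio) auto
  finally show ?thesis by simp
qed

lemma trunc_zero: "\<bar>t\<bar> \<le> 1 / real (Suc n) \<Longrightarrow> trunc n t = 0"
  unfolding trunc_def using gap_zero[of "real (Suc n) * t"] by (simp add: abs_mult field_simps del: of_nat_Suc)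

text \<open>11 = 10 + 1: ten bounds \<open>gap'\<close>, whose distance to 1 is at most 9, and one
  bounds the term coming from the denominator. Independence of \<open>n\<close> is the point; it
  provides the majorant for gradients.\<close>

lemma trunc'_bounded: "\<bar>trunc' n t\<bar> \<le> 11"
proof -
  let ?k = "real (Suc n)" and ?D = "1 + (t / real (Suc n))\<^sup>2"
  have D: "?D > 0" "?D \<ge> 1" using trunc_denominator by auto
  have "\<bar>gap' (?k * t) - 1\<bar> \<le> 9 / (1 + (max 0 ((?k * t)\<^sup>2 - 1))\<^sup>2)" by (rule gap'_remainder)
  also have "\<dots> \<le> 9 / 1" by (intro divide_left_mono) (auto simp: add_pos_nonneg)
  finally have g: "\<bar>gap' (?k * t)\<bar> \<le> 10" by linarith
  then have "\<bar>gap' (?k * t)\<bar> / ?D \<le> 10 / 1" using D by (intro frac_le) auto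
  then have 1: "\<bar>gap' (?k * t) / ?D\<bar> \<le> 10" using D by simp
  have "\<bar>gap (?k * t) / ?k * (2 * t / ?k\<^sup>2) / ?D\<^sup>2\<bar> = \<bar>gap (?k * t) / ?k\<bar> * (\<bar>2 * t / ?k\<^sup>2\<bar> / ?D\<^sup>2)"
    by (simp add: abs_mult abs_divide del: of_nat_Suc)
  also have "\<dots> \<le> \<bar>t\<bar> * (\<bar>2 * t / ?k\<^sup>2\<bar> / ?D\<^sup>2)"
    by (intro mult_right_mono gap_scaled_bound) auto
  also have "\<dots> = 2 * (t / ?k)\<^sup>2 / ?D\<^sup>2" by (simp add: power2_eq_square abs_mult del: of_nat_Suc)
  also have "\<dots> \<le> 1" by (rule quadratic_ratio)
  finally show ?thesis using 1 unfolding trunc'_def by linarith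
qed

text \<open>The errors of \<open>gap\<close> and of \<open>gap'\<close> carry the same denominator,
  so one limit serves both.\<close>

lemma scaled_remainder_tendsto:
  assumes "t \<noteq> 0"
  shows "(\<lambda>n. C / (1 + (max 0 ((real (Suc n) * t)\<^sup>2 - 1))\<^sup>2)) \<longlonglongrightarrow> 0"
proof -
  have k: "filterlim (\<lambda>n. real (Suc n)) at_top sequentially"
    by (rule filterlim_compose[OF filterlim_real_sequentially filterlim_Suc])
  have "filterlim (\<lambda>n. (t\<^sup>2) * (real (Suc n))\<^sup>2) at_top sequentially"
    using assms by (intro filterlim_tendsto_pos_mult_at_top[OF tendsto_const] filterlim_pow_at_top k) auto
  then have "filterlim (\<lambda>n. - 1 + (t\<^sup>2) * (real (Suc n))\<^sup>2) at_top sequentially"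
    by (rule filterlim_tendsto_add_at_top[OF tendsto_const])
  then have "filterlim (\<lambda>n. max 0 ((real (Suc n) * t)\<^sup>2 - 1)) at_top sequentially"
    by (rule filterlim_at_top_mono) (auto simp: power_mult_distrib mult.commute)
  then have "filterlim (\<lambda>n. 1 + (max 0 ((real (Suc n) * t)\<^sup>2 - 1))\<^sup>2) at_top sequentially"
    by (intro filterlim_tendsto_add_at_top[OF tendsto_const] filterlim_pow_at_top) auto
  then show ?thesis
    by (intro tendsto_divide_0[OF tendsto_const] filterlim_at_top_imp_at_infinity)
qed

lemma gap_scaled_tendsto: "(\<lambda>n. gap (real (Suc n) * t) / real (Suc n)) \<longlonglongrightarrow> t"
proof (cases "t = 0")
  case False
  have "(\<lambda>n. gap (real (Suc n) * t) / real (Suc n) - t) \<longlonglongrightarrow> 0"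
  proof (rule Lim_null_comparison[OF always_eventually scaled_remainder_tendsto[OF False, of "\<bar>t\<bar>"]], rule allI)
    fix n
    let ?k = "real (Suc n)"
    have "gap (?k * t) / ?k - t = (gap (?k * t) - ?k * t) / ?k"
      by (simp add: diff_divide_distrib del: of_nat_Suc)
    then have "norm (gap (?k * t) / ?k - t) = \<bar>gap (?k * t) - ?k * t\<bar> / ?k"
      by (simp add: abs_divide del: of_nat_Suc)
    also have "\<dots> = \<bar>t\<bar> / (1 + (max 0 ((?k * t)\<^sup>2 - 1))\<^sup>2)"
      unfolding gap_remainder by (simp add: abs_mult del: of_nat_Suc)
    finally show "norm (gap (?k * t) / ?k - t) \<le> \<bar>t\<bar> / (1 + (max 0 ((?k * t)\<^sup>2 - 1))\<^sup>2)" by simp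
  qed
  then show ?thesis by (simp only: LIM_zero_iff)
qed (simp add: gap_def)

lemma trunc_denominator_tendsto: "(\<lambda>n. 1 + (t / real (Suc n))\<^sup>2) \<longlonglongrightarrow> (1::real)"
proof -
  have "(\<lambda>n. 1 + (t * (1 / real (Suc n)))\<^sup>2) \<longlonglongrightarrow> 1 + (t * 0)\<^sup>2"
    using LIMSEQ_Suc[OF lim_1_over_n] by (intro tendsto_intros)
  then show ?thesis by simp
qed

lemma trunc_tendsto: "(\<lambda>n. trunc n t) \<longlonglongrightarrow> t"
  using tendsto_divide[OF gap_scaled_tendsto[of t] trunc_denominator_tendsto[of t]] by (simp add: trunc_def)

lemma trunc'_tendsto:
  assumes "t \<noteq> 0"
  shows "(\<lambda>n. trunc' n t) \<longlonglongrightarrow> 1"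
proof -
  have "(\<lambda>n. gap' (real (Suc n) * t) - 1) \<longlonglongrightarrow> 0"
    by (rule Lim_null_comparison[OF always_eventually scaled_remainder_tendsto[OF assms, of 9]])
       (use gap'_remainder(2) in auto)
  then have 1: "(\<lambda>n. gap' (real (Suc n) * t)) \<longlonglongrightarrow> 1" by (simp only: LIM_zero_iff)
  have "(\<lambda>n. 2 * t * (1 / real (Suc n))\<^sup>2) \<longlonglongrightarrow> 2 * t * 0\<^sup>2"
    using LIMSEQ_Suc[OF lim_1_over_n] by (intro tendsto_intros)
  then have 2: "(\<lambda>n. 2 * t / (real (Suc n))\<^sup>2) \<longlonglongrightarrow> 0" by (simp add: power_divide del: of_nat_Suc)
  have "(\<lambda>n. trunc' n t) \<longlonglongrightarrow> 1 / 1 - t * 0 / 1\<^sup>2"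
    unfolding trunc'_def
    by (intro tendsto_diff tendsto_divide tendsto_mult tendsto_power 1 2 gap_scaled_tendsto trunc_denominator_tendsto) auto
  then show ?thesis by simp
qed

text \<open>\<open>trunc n\<close> has slope 0 at 0 for every \<open>n\<close>, while its slope
  tends to 1 elsewhere. In the limit \<open>u\<close> has a weak gradient that equals
  \<open>G\<close> where \<open>u\<close> is nonzero and 0 where \<open>u\<close> is 0; uniqueness
  identifies it with \<open>G\<close>.\<close>

lemma weak_gradient_zero_set:
  fixes u :: "'a::euclidean_space \<Rightarrow> real"
  assumes w: "weak_gradient UNIV u G"
  shows "AE x in lebesgue. u x = 0 \<longrightarrow> G x = 0"
proof -
  note loc = weak_gradient_loc[OF w]
  have [measurable]: "u \<in> borel_measurable lebesgue" "G \<in> borel_measurable lebesgue"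
    by (rule locally_integrable_measurable[OF loc(1)], rule locally_integrable_measurable[OF loc(2)])
  have [measurable]: "trunc n \<in> borel_measurable borel" "trunc' n \<in> borel_measurable borel" for n
    by (rule borel_measurable_continuous_onI[OF trunc_continuous], rule borel_measurable_continuous_onI[OF trunc_cont])
  define H where "H x = (if u x = 0 then 0 else G x)" for x
  have Hm [measurable]: "H \<in> borel_measurable lebesgue" unfolding H_def by measurable
  have lH: "locally_integrable UNIV H"
    by (rule locally_integrable_bound[OF loc(2) Hm, where a=0 and c=1]) (simp add: H_def)
  have wn: "weak_gradient UNIV (\<lambda>x. trunc n (u x)) (\<lambda>x. trunc' n (u x) *\<^sub>R G x)" for n
    by (rule weak_gradient_chain[OF w trunc_DERIV trunc_cont trunc'_bounded])
  have z: "trunc' n 0 = 0" for n by (simp add: trunc'_def gap'_def)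
  have "weak_gradient UNIV u H"
  proof (rule weak_gradient_closed[OF open_UNIV loc(1) lH])
    fix K :: "'a set" assume K: "compact K" "K \<subseteq> UNIV"
    have "L1_on K (\<lambda>n x. trunc n (u x)) u"
    proof (rule L1_on_dominated[where w="\<lambda>x. \<bar>u x\<bar>", OF _ _ _ K])
      show "locally_integrable UNIV (\<lambda>x. \<bar>u x\<bar>)"
        by (rule locally_integrable_bound[OF loc(1), where a=0 and c=1]) auto
    qed (use trunc_le trunc_tendsto in auto)
    moreover have "L1_on K (\<lambda>n x. trunc' n (u x) *\<^sub>R G x) H"
    proof (rule L1_on_dominated[where w="\<lambda>x. 11 * norm (G x)", OF _ _ _ K])
      show "locally_integrable UNIV (\<lambda>x. 11 * norm (G x))"
        by (rule locally_integrable_bound[OF loc(2), where a=0 and c=11]) auto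
      show "AE x in lebesgue. norm (trunc' n (u x) *\<^sub>R G x) \<le> 11 * norm (G x)" for n
        by (intro AE_I2) (simp add: mult_right_mono[OF trunc'_bounded])
      show "AE x in lebesgue. x \<in> K \<longrightarrow> (\<lambda>n. trunc' n (u x) *\<^sub>R G x) \<longlonglongrightarrow> H x"
      proof (rule AE_I2, rule impI)
        fix x
        show "(\<lambda>n. trunc' n (u x) *\<^sub>R G x) \<longlonglongrightarrow> H x"
          using tendsto_scaleR[OF trunc'_tendsto[of "u x"] tendsto_const[of "G x"]]
          by (cases "u x = 0") (auto simp: z H_def)
      qed
    qed measurable
    ultimately show "\<exists>v H'. (\<forall>n::nat. weak_gradient UNIV (v n) (H' n)) \<and> L1_on K v u \<and> L1_on K H' H"
      using wn by (intro exI[of _ "\<lambda>n x. trunc n (u x)"] exI[of _ "\<lambda>n x. trunc' n (u x) *\<^sub>R G x"]) simp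
  qed
  from weak_gradient_unique[OF open_UNIV this w] show ?thesis
    by eventually_elim (auto simp: H_def)
qed

section \<open>Modulars\<close>

lemma modular_UNIV: "modular p UNIV f = (\<integral>\<^sup>+x. ennreal (norm (f x) powr p x) \<partial>lebesgue)"
  by (simp add: modular_def lebesgue_on_UNIV)

lemma modular_extend:
  assumes "\<Omega> \<in> sets lebesgue"
  shows "modular p \<Omega> f = modular p UNIV (\<lambda>x. if x \<in> \<Omega> then f x else 0)"
proof -
  have "modular p \<Omega> f = (\<integral>\<^sup>+x. ennreal (norm (f x) powr p x) * indicator \<Omega> x \<partial>lebesgue)"
    unfolding modular_def using assms by (subst nn_integral_restrict_space) auto
  also have "\<dots> = modular p UNIV (\<lambda>x. if x \<in> \<Omega> then f x else 0)"
    unfolding modular_UNIV by (intro nn_integral_cong) (auto simp: indicator_def)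
  finally show ?thesis .
qed

lemma AE_lebesgue_on:
  "\<Omega> \<in> sets lebesgue \<Longrightarrow> (AE x in lebesgue_on \<Omega>. Q x) \<longleftrightarrow> (AE x in lebesgue. x \<in> \<Omega> \<longrightarrow> Q x)"
  by (subst AE_restrict_space_iff) auto

lemma measurable_lebesgue_on_extend:
  fixes f :: "'a::euclidean_space \<Rightarrow> 'b::euclidean_space"
  assumes "\<Omega> \<in> sets lebesgue"
  shows "f \<in> borel_measurable (lebesgue_on \<Omega>) \<longleftrightarrow> (\<lambda>x. if x \<in> \<Omega> then f x else 0) \<in> borel_measurable lebesgue"
proof -
  have "(\<lambda>x. indicator \<Omega> x *\<^sub>R f x) = (\<lambda>x. if x \<in> \<Omega> then f x else 0)"
    by (simp add: fun_eq_iff)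
  then show ?thesis using assms by (subst borel_measurable_restrict_space_iff) auto
qed

lemma powr_tendsto_zero:
  fixes q :: real
  assumes "a \<longlonglongrightarrow> 0" "\<And>n::nat. a n \<ge> 0" "q \<ge> 1"
  shows "(\<lambda>n. a n powr q) \<longlonglongrightarrow> 0"
proof (rule Lim_null_comparison[OF _ assms(1)])
  have "\<forall>\<^sub>F n in sequentially. a n < 1" using order_tendstoD(2)[OF assms(1), of 1] by simp
  then show "\<forall>\<^sub>F n in sequentially. norm (a n powr q) \<le> a n"
  proof eventually_elim
    case (elim n)
    have "a n powr q \<le> a n powr 1"
      by (rule powr_mono') (use elim assms(2)[of n] assms(3) in auto)
    then show ?case using assms(2)[of n] by simp
  qed
qed

text \<open>The bounds hold at every point, so that powers can be compared pointwise. The essential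
  upper bound of the theorem is brought into this form by continuity of the exponent.\<close>

locale bounded_exponent =
  fixes p :: "'a::euclidean_space \<Rightarrow> real" and P :: real
  assumes p_measurable [measurable]: "p \<in> borel_measurable lebesgue"
    and p_ge: "\<And>x. 1 \<le> p x" and p_le: "\<And>x. p x \<le> P"
begin

lemma P_ge: "1 \<le> P"
  using p_ge p_le order_trans by blast

lemma p_pos: "0 < p x" using p_ge[of x] by linarith

lemma powr_scale_le: "1 \<le> C \<Longrightarrow> 0 \<le> t \<Longrightarrow> 0 \<le> s \<Longrightarrow> s \<le> C * t \<Longrightarrow> s powr p x \<le> C powr P * t powr p x"
proof -
  assume C: "1 \<le> C" "0 \<le> t" "0 \<le> s" "s \<le> C * t"
  have "s powr p x \<le> (C * t) powr p x" using C p_pos[of x] by (intro powr_mono2) auto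
  also have "\<dots> = C powr p x * t powr p x" using C by (simp add: powr_mult)
  also have "\<dots> \<le> C powr P * t powr p x" using C p_le by (intro mult_right_mono powr_mono) auto
  finally show ?thesis .
qed

text \<open>The sum is at most twice the larger number. The resulting constant 2^P is the same at
  every point and is the price of each triangle inequality for modulars.\<close>

lemma powr_sum_le:
  assumes "0 \<le> a" "0 \<le> b" "0 \<le> s" "s \<le> a + b"
  shows "s powr p x \<le> 2 powr P * (a powr p x + b powr p x)"
proof -
  have "s powr p x \<le> 2 powr P * (max a b) powr p x"
    using assms by (intro powr_scale_le) auto
  also have "\<dots> \<le> 2 powr P * (a powr p x + b powr p x)"
    by (intro mult_left_mono) (auto simp: max_def)
  finally show ?thesis .
qed

lemma modular_integrand_measurable [measurable]:
  fixes f :: "'a \<Rightarrow> 'b::euclidean_space"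
  assumes [measurable]: "f \<in> borel_measurable lebesgue"
  shows "(\<lambda>x. norm (f x) powr p x) \<in> borel_measurable lebesgue"
proof -
  note [measurable] = p_measurable
  show ?thesis by measurable
qed

lemma modular_cong_AE: "AE x in lebesgue. f x = g x \<Longrightarrow> modular p UNIV f = modular p UNIV g"
  unfolding modular_UNIV by (intro nn_integral_cong_AE) (auto elim: eventually_mono)

lemma modular_mono:
  assumes "AE x in lebesgue. norm (f x) \<le> norm (g x)"
  shows "modular p UNIV f \<le> modular p UNIV g"
  unfolding modular_UNIV
proof (rule nn_integral_mono_AE)
  show "AE x in lebesgue. ennreal (norm (f x) powr p x) \<le> ennreal (norm (g x) powr p x)"
    using assms
  proof eventually_elim
    case (elim x)
    then show ?case using p_pos[of x] by (intro ennreal_leI powr_mono2) auto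
  qed
qed

lemma modular_scale:
  fixes f :: "'a \<Rightarrow> 'b::euclidean_space" and g :: "'a \<Rightarrow> 'c::euclidean_space"
  assumes [measurable]: "f \<in> borel_measurable lebesgue" and "1 \<le> C" and le: "AE x in lebesgue. norm (g x) \<le> C * norm (f x)"
  shows "modular p UNIV g \<le> ennreal (C powr P) * modular p UNIV f"
proof -
  have "modular p UNIV g \<le> (\<integral>\<^sup>+x. ennreal (C powr P) * ennreal (norm (f x) powr p x) \<partial>lebesgue)"
    unfolding modular_UNIV
  proof (rule nn_integral_mono_AE)
    show "AE x in lebesgue. ennreal (norm (g x) powr p x) \<le> ennreal (C powr P) * ennreal (norm (f x) powr p x)"
      using le
    proof eventually_elim
      case (elim x)
      then show ?case using assms(2) by (auto simp: ennreal_mult[symmetric] intro!: ennreal_leI powr_scale_le)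
    qed
  qed
  also have "\<dots> = ennreal (C powr P) * modular p UNIV f"
    unfolding modular_UNIV by (rule nn_integral_cmult) measurable
  finally show ?thesis .
qed

lemma modular_sum:
  fixes f :: "'a \<Rightarrow> 'b::euclidean_space" and g :: "'a \<Rightarrow> 'c::euclidean_space" and h :: "'a \<Rightarrow> 'd::euclidean_space"
  assumes [measurable]: "f \<in> borel_measurable lebesgue" "g \<in> borel_measurable lebesgue"
    and le: "AE x in lebesgue. norm (h x) \<le> norm (f x) + norm (g x)"
  shows "modular p UNIV h \<le> ennreal (2 powr P) * (modular p UNIV f + modular p UNIV g)"
proof -
  have "modular p UNIV h \<le> (\<integral>\<^sup>+x. ennreal (2 powr P) * (ennreal (norm (f x) powr p x) + ennreal (norm (g x) powr p x)) \<partial>lebesgue)"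
    unfolding modular_UNIV
  proof (rule nn_integral_mono_AE)
    show "AE x in lebesgue. ennreal (norm (h x) powr p x) \<le> ennreal (2 powr P) * (ennreal (norm (f x) powr p x) + ennreal (norm (g x) powr p x))"
      using le
    proof eventually_elim
      case (elim x)
      then have "norm (h x) powr p x \<le> 2 powr P * (norm (f x) powr p x + norm (g x) powr p x)"
        by (intro powr_sum_le) auto
      from ennreal_leI[OF this] show ?case
        by (simp add: ennreal_mult)
    qed
  qed
  also have "\<dots> = ennreal (2 powr P) * (modular p UNIV f + modular p UNIV g)"
  proof -
    have "(\<integral>\<^sup>+x. ennreal (norm (f x) powr p x) + ennreal (norm (g x) powr p x) \<partial>lebesgue)
      = modular p UNIV f + modular p UNIV g"
      unfolding modular_UNIV by (rule nn_integral_add) measurable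
    then show ?thesis by (subst nn_integral_cmult) simp_all
  qed
  finally show ?thesis .
qed

lemma modular_finite_scale:
  fixes f :: "'a \<Rightarrow> 'b::euclidean_space" and g :: "'a \<Rightarrow> 'c::euclidean_space"
  assumes "f \<in> borel_measurable lebesgue" "modular p UNIV f < \<infinity>" "AE x in lebesgue. norm (g x) \<le> C * norm (f x)"
  shows "modular p UNIV g < \<infinity>"
proof -
  have "AE x in lebesgue. norm (g x) \<le> max 1 C * norm (f x)"
    using assms(3)
  proof eventually_elim
    case (elim x)
    also have "C * norm (f x) \<le> max 1 C * norm (f x)" by (intro mult_right_mono) auto
    finally show ?case .
  qed
  from modular_scale[OF assms(1) _ this] show ?thesis
    using assms(2) by (auto simp: less_top[symmetric] ennreal_mult_eq_top_iff top_unique)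
qed

lemma modular_finite_sum:
  fixes f :: "'a \<Rightarrow> 'b::euclidean_space" and g :: "'a \<Rightarrow> 'c::euclidean_space" and h :: "'a \<Rightarrow> 'd::euclidean_space"
  assumes "f \<in> borel_measurable lebesgue" "g \<in> borel_measurable lebesgue" "modular p UNIV f < \<infinity>" "modular p UNIV g < \<infinity>"
    "AE x in lebesgue. norm (h x) \<le> norm (f x) + norm (g x)"
  shows "modular p UNIV h < \<infinity>"
  using modular_sum[OF assms(1,2,5)] assms(3,4)
  by (auto simp: less_top[symmetric] ennreal_mult_eq_top_iff top_unique)

text \<open>For p \<ge> 1 a nonnegative number t is at most 1 + t^p, and constants are locally
  integrable.\<close>

lemma modular_locally_integrable:
  fixes f :: "'a \<Rightarrow> 'b::euclidean_space"
  assumes [measurable]: "f \<in> borel_measurable lebesgue" and fin: "modular p UNIV f < \<infinity>"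
  shows "locally_integrable \<Omega> f"
proof -
  have "integrable lebesgue (\<lambda>x. norm (f x) powr p x)"
    unfolding integrable_iff_bounded using fin by (simp add: modular_UNIV)
  then have "locally_integrable \<Omega> (\<lambda>x. norm (f x) powr p x)"
    unfolding locally_integrable_iff by (intro allI impI integrable_mult_indicator) (auto simp: sets_lebesgue_compact)
  then show ?thesis
  proof (rule locally_integrable_bound[where a=1 and c=1])
    fix x
    have "norm (f x) \<le> 1 + norm (f x) powr p x"
    proof (cases "norm (f x) \<le> 1")
      case False
      then have "norm (f x) powr 1 \<le> norm (f x) powr p x" using p_ge by (intro powr_mono) auto
      then show ?thesis using False by simp
    qed (use powr_ge_zero[of "norm (f x)" "p x"] in linarith)
    then show "norm (f x) \<le> 1 + 1 * norm (norm (f x) powr p x)" by simp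
  qed measurable
qed

text \<open>For 0 < d \<le> 1 one has t \<le> d + d^(1-P) t^p: either t \<le> d, or t/d exceeds 1
  and is at most its p-th power. On a set of finite measure the first term is made small by the
  choice of d, and then the second by the modular.\<close>

lemma modular_tendsto_L1_on:
  fixes f :: "nat \<Rightarrow> 'a \<Rightarrow> 'b::euclidean_space"
  assumes [measurable]: "\<And>n. f n \<in> borel_measurable lebesgue" "g \<in> borel_measurable lebesgue"
    and conv: "(\<lambda>n. modular p UNIV (\<lambda>x. f n x - g x)) \<longlonglongrightarrow> 0" and K: "compact K"
  shows "L1_on K f g"
  unfolding L1_on_def
proof (rule ennreal_tendsto_0I)
  fix e :: real assume e: "e > 0"
  have [measurable]: "K \<in> sets lebesgue" using K by (simp add: sets_lebesgue_compact)
  have fK: "emeasure lebesgue K < \<infinity>"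
    using K emeasure_bounded_finite[of K] compact_imp_bounded[of K] by (simp add: compact_imp_closed)
  define m where "m = measure lebesgue K"
  have m: "emeasure lebesgue K = ennreal m" "m \<ge> 0"
    using fK by (auto simp: m_def emeasure_eq_ennreal_measure)
  \<comment> \<open>Values below \<open>d\<close> contribute at most d m \<le> e/2; using m + 1
    excludes division by 0.\<close>
  define d where "d = min 1 (e / (2 * (m + 1)))"
  have d: "0 < d" "d \<le> 1" using e m by (auto simp: d_def)
  have "d * m \<le> e / (2 * (m + 1)) * (m + 1)"
    using d m e by (intro mult_mono) (auto simp: d_def)
  also have "\<dots> = e / 2" using m(2) by (simp add: field_simps add_nonneg_eq_0_iff)
  finally have dm: "d * m \<le> e / 2" .
  define c where "c = d powr (1 - P)"
  have c: "c > 0" using d by (simp add: c_def)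
  have le: "t \<le> d + c * t powr p x" if "t \<ge> 0" for t x
  proof (cases "t \<le> d")
    case True
    then show ?thesis using c by (simp add: add_increasing2)
  next
    case False
    have "(t / d) powr 1 \<le> (t / d) powr p x" using False d p_ge by (intro powr_mono) (auto simp: field_simps)
    then have "t / d \<le> t powr p x / d powr p x" using False d that by (simp add: powr_divide)
    then have "t \<le> d * (t powr p x / d powr p x)" using d by (simp add: field_simps)
    also have "\<dots> = d powr (1 - p x) * t powr p x" using d by (simp add: powr_diff)
    also have "\<dots> \<le> c * t powr p x" unfolding c_def using d p_le by (intro mult_right_mono powr_mono') auto
    finally show ?thesis using d by simp
  qed
  have "\<forall>\<^sub>F n in sequentially. modular p UNIV (\<lambda>x. f n x - g x) < ennreal (e / 2 / c)"
    using ennreal_tendsto_0D[OF conv, of "e / 2 / c"] e c by simp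
  then show "\<forall>\<^sub>F n in sequentially. (\<integral>\<^sup>+x. ennreal (norm (f n x - g x)) * indicator K x \<partial>lebesgue) \<le> ennreal e"
  proof eventually_elim
    case (elim n)
    have "(\<integral>\<^sup>+x. ennreal (norm (f n x - g x)) * indicator K x \<partial>lebesgue)
      \<le> (\<integral>\<^sup>+x. ennreal d * indicator K x + ennreal c * ennreal (norm (f n x - g x) powr p x) \<partial>lebesgue)"
    proof (rule nn_integral_mono)
      fix x
      have "ennreal (norm (f n x - g x)) \<le> ennreal (d + c * norm (f n x - g x) powr p x)"
        by (intro ennreal_leI le) auto
      then show "ennreal (norm (f n x - g x)) * indicator K x \<le> ennreal d * indicator K x + ennreal c * ennreal (norm (f n x - g x) powr p x)"
        using d c by (cases "x \<in> K") (auto simp: ennreal_mult)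
    qed
    also have "\<dots> = ennreal d * emeasure lebesgue K + ennreal c * modular p UNIV (\<lambda>x. f n x - g x)"
    proof -
      have "(\<integral>\<^sup>+x. ennreal c * ennreal (norm (f n x - g x) powr p x) \<partial>lebesgue) = ennreal c * modular p UNIV (\<lambda>x. f n x - g x)"
        unfolding modular_UNIV by (rule nn_integral_cmult) measurable
      moreover have "(\<integral>\<^sup>+x. ennreal d * indicator K x \<partial>lebesgue) = ennreal d * emeasure lebesgue K"
        by (rule nn_integral_cmult_indicator) measurable
      ultimately show ?thesis by (subst nn_integral_add) simp_all
    qed
    also have "\<dots> \<le> ennreal d * ennreal m + ennreal c * ennreal (e / 2 / c)"
      using elim m by (intro add_mono mult_left_mono) auto
    also have "\<dots> = ennreal (d * m + e / 2)" using d c m e by (simp add: ennreal_mult[symmetric] ennreal_plus[symmetric] del: ennreal_plus)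
    also have "\<dots> \<le> ennreal e" using dm by (intro ennreal_leI) auto
    finally show ?case .
  qed
qed

lemma modular_dominated:
  fixes f :: "nat \<Rightarrow> 'a \<Rightarrow> 'b::euclidean_space" and w :: "'a \<Rightarrow> 'c::euclidean_space"
  assumes [measurable]: "\<And>n. f n \<in> borel_measurable lebesgue" "g \<in> borel_measurable lebesgue" "w \<in> borel_measurable lebesgue"
    and bd: "\<And>n. AE x in lebesgue. norm (f n x - g x) \<le> norm (w x)" and fin: "modular p UNIV w < \<infinity>"
    and conv: "AE x in lebesgue. (\<lambda>n. f n x) \<longlonglongrightarrow> g x"
  shows "(\<lambda>n. modular p UNIV (\<lambda>x. f n x - g x)) \<longlonglongrightarrow> 0"
proof -
  have "(\<lambda>n. \<integral>\<^sup>+x. ennreal (norm (f n x - g x) powr p x) \<partial>lebesgue) \<longlonglongrightarrow> (\<integral>\<^sup>+(x::'a). 0 \<partial>lebesgue)"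
  proof (rule nn_integral_dominated_convergence[where w="\<lambda>x. ennreal (norm (w x) powr p x)"])
    show "AE x in lebesgue. ennreal (norm (f n x - g x) powr p x) \<le> ennreal (norm (w x) powr p x)" for n
      using bd[of n]
    proof eventually_elim
      case (elim x)
      then show ?case using p_pos[of x] by (intro ennreal_leI powr_mono2) auto
    qed
    show "(\<integral>\<^sup>+x. ennreal (norm (w x) powr p x) \<partial>lebesgue) < \<infinity>" using fin by (simp add: modular_UNIV)
    show "AE x in lebesgue. (\<lambda>n. ennreal (norm (f n x - g x) powr p x)) \<longlonglongrightarrow> 0"
      using conv
    proof eventually_elim
      case (elim x)
      have "(\<lambda>n. norm (f n x - g x)) \<longlonglongrightarrow> 0" using elim by (simp add: LIM_zero tendsto_norm_zero)
      then have "(\<lambda>n. norm (f n x - g x) powr p x) \<longlonglongrightarrow> 0" by (rule powr_tendsto_zero) (use p_ge in auto)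
      then show ?case by (subst ennreal_tendsto_0_iff) auto
    qed
  qed measurable
  then show ?thesis by (simp add: modular_UNIV)
qed

text \<open>Weights \<open>2\<^sup>-\<^sup>k\<close> replace convexity: an average is at most the supremum of its entries.\<close>

lemma modular_series:
  fixes a :: "nat \<Rightarrow> 'a \<Rightarrow> real"
  assumes [measurable]: "\<And>k. a k \<in> borel_measurable lebesgue" and nn: "\<And>k x. a k x \<ge> 0"
    and fin: "(\<Sum>k. ennreal (2 powr (real (Suc k) * P)) * modular p UNIV (a k)) < \<infinity>"
  shows "AE x in lebesgue. summable (\<lambda>k. a k x)"
    "modular p UNIV (\<lambda>x. \<Sum>k. a k x) \<le> (\<Sum>k. ennreal (2 powr (real (Suc k) * P)) * modular p UNIV (a k))"
proof -
  define s where "s x = (\<Sum>k. ennreal (2 powr (real (Suc k) * P)) * ennreal (a k x powr p x))" for x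
  have sm [measurable]: "s \<in> borel_measurable lebesgue" unfolding s_def by measurable
  have int: "(\<integral>\<^sup>+x. s x \<partial>lebesgue) = (\<Sum>k. ennreal (2 powr (real (Suc k) * P)) * modular p UNIV (a k))"
  proof -
    have "(\<integral>\<^sup>+x. s x \<partial>lebesgue) = (\<Sum>k. \<integral>\<^sup>+x. ennreal (2 powr (real (Suc k) * P)) * ennreal (a k x powr p x) \<partial>lebesgue)"
      unfolding s_def by (rule nn_integral_suminf) measurable
    also have "\<dots> = (\<Sum>k. ennreal (2 powr (real (Suc k) * P)) * modular p UNIV (a k))"
      unfolding modular_UNIV using nn
      by (intro arg_cong[where f=suminf] ext) (subst nn_integral_cmult; simp)
    finally show ?thesis .
  qed
  have "AE x in lebesgue. s x \<noteq> \<infinity>"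
    by (rule nn_integral_PInf_AE) (use fin int in auto)
  then have key: "AE x in lebesgue. summable (\<lambda>k. a k x) \<and> ennreal (norm (\<Sum>k. a k x) powr p x) \<le> s x"
  proof eventually_elim
    case (elim x)
    define q where "q = enn2real (s x)"
    have sq: "s x = ennreal q" "q \<ge> 0" using elim by (auto simp: q_def less_top[symmetric])
    \<comment> \<open>Every single term of the series \<open>s x\<close> is at most
      \<open>q\<close>. As p x \<le> P, the factor 2^((k+1) P) may be lowered to 2^((k+1) p x), and
      taking the p-th root gives a geometric majorant.\<close>
    have bound: "a k x \<le> (1/2) ^ Suc k * q powr (1 / p x)" for k
    proof -
      have "ennreal (2 powr (real (Suc k) * P)) * ennreal (a k x powr p x) \<le> s x"
        unfolding s_def
        using sum_le_suminf[of "\<lambda>k. ennreal (2 powr (real (Suc k) * P)) * ennreal (a k x powr p x)" "{k}"] by simp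
      then have "2 powr (real (Suc k) * P) * a k x powr p x \<le> q"
        unfolding sq using sq(2) by (simp add: ennreal_mult[symmetric])
      moreover have "2 powr (real (Suc k) * p x) \<le> 2 powr (real (Suc k) * P)"
        using p_le by (intro powr_mono mult_left_mono) auto
      ultimately have "2 powr (real (Suc k) * p x) * a k x powr p x \<le> q"
        by (meson mult_right_mono order_trans powr_ge_zero)
      moreover have "2 powr (real (Suc k) * p x) * a k x powr p x = (2 ^ Suc k * a k x) powr p x"
        using nn[of k x] by (simp add: powr_mult powr_powr[symmetric] powr_realpow del: power_Suc of_nat_Suc)
      ultimately have "(2 ^ Suc k * a k x) powr p x \<le> q" by simp
      then have "((2 ^ Suc k * a k x) powr p x) powr (1 / p x) \<le> q powr (1 / p x)"
        using p_pos[of x] by (intro powr_mono2) auto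
      then have "2 ^ Suc k * a k x \<le> q powr (1 / p x)"
        using p_pos[of x] nn[of k x] by (simp add: powr_powr)
      then show ?thesis by (simp add: field_simps)
    qed
    have geo: "(\<lambda>k. (1/2) ^ Suc k * q powr (1 / p x)) sums (1 * q powr (1 / p x))"
      by (intro sums_mult2 power_half_series)
    have summ: "summable (\<lambda>k. a k x)"
      by (rule summable_comparison_test'[OF sums_summable[OF geo], of 0]) (use bound nn in auto)
    have "(\<Sum>k. a k x) \<le> q powr (1 / p x)"
      using suminf_le[OF bound summ sums_summable[OF geo]] sums_unique[OF geo] by simp
    moreover have "(\<Sum>k. a k x) \<ge> 0" using nn summ by (intro suminf_nonneg) auto
    ultimately have "norm (\<Sum>k. a k x) powr p x \<le> (q powr (1 / p x)) powr p x"
      using p_pos[of x] by (intro powr_mono2) auto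
    also have "\<dots> = q" using p_pos[of x] sq(2) by (simp add: powr_powr)
    finally show ?case using summ sq by (simp add: ennreal_leI)
  qed
  then show "AE x in lebesgue. summable (\<lambda>k. a k x)" by (auto elim: eventually_mono)
  have "modular p UNIV (\<lambda>x. \<Sum>k. a k x) \<le> (\<integral>\<^sup>+x. s x \<partial>lebesgue)"
    unfolding modular_UNIV using key by (intro nn_integral_mono_AE) (auto elim: eventually_mono)
  then show "modular p UNIV (\<lambda>x. \<Sum>k. a k x) \<le> (\<Sum>k. ennreal (2 powr (real (Suc k) * P)) * modular p UNIV (a k))"
    by (simp add: int)
qed

text \<open>The sum of the integrands has finite integral, hence is finite almost everywhere, and
  its terms tend to 0. Summability spares the passage to a subsequence.\<close>

lemma modular_summable_tendsto:
  fixes a :: "nat \<Rightarrow> 'a \<Rightarrow> 'b::euclidean_space"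
  assumes [measurable]: "\<And>k. a k \<in> borel_measurable lebesgue"
    and fin: "(\<Sum>k. modular p UNIV (a k)) < \<infinity>"
  shows "AE x in lebesgue. (\<lambda>k. a k x) \<longlonglongrightarrow> 0"
proof -
  have "(\<integral>\<^sup>+x. (\<Sum>k. ennreal (norm (a k x) powr p x)) \<partial>lebesgue) = (\<Sum>k. modular p UNIV (a k))"
    unfolding modular_UNIV by (rule nn_integral_suminf) measurable
  then have "AE x in lebesgue. (\<Sum>k. ennreal (norm (a k x) powr p x)) \<noteq> \<infinity>"
    by (intro nn_integral_PInf_AE) (use fin in auto)
  then show ?thesis
  proof eventually_elim
    case (elim x)
    then have "summable (\<lambda>k. norm (a k x) powr p x)"
      by (intro summable_suminf_not_top) auto
    then have "(\<lambda>k. norm (a k x) powr p x) \<longlonglongrightarrow> 0" by (rule summable_LIMSEQ_zero)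
    then have "(\<lambda>k. (norm (a k x) powr p x) powr (1 / p x)) \<longlonglongrightarrow> 0 powr (1 / p x)"
      using p_pos[of x] by (intro tendsto_powr2) auto
    then have "(\<lambda>k. norm (a k x)) \<longlonglongrightarrow> 0" using p_pos[of x] by (simp add: powr_powr)
    then show ?case by (rule tendsto_norm_zero_cancel)
  qed
qed

end

section \<open>Norms compared with modulars, and Sobolev functions with explicit gradients\<close>

context bounded_exponent
begin

lemma Lp_norm_extend:
  assumes "\<Omega> \<in> sets lebesgue"
  shows "Lp_norm p \<Omega> f = Lp_norm p UNIV (\<lambda>x. if x \<in> \<Omega> then f x else 0)"
proof -
  have "modular p \<Omega> (\<lambda>x. f x /\<^sub>R c) = modular p UNIV (\<lambda>x. (if x \<in> \<Omega> then f x else 0) /\<^sub>R c)" for c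
    unfolding modular_extend[OF assms] by (intro arg_cong[where f="modular p UNIV"]) auto
  then show ?thesis by (simp add: Lp_norm_def)
qed

text \<open>Some admissible d lies below c \<le> 1, and d^p \<le> d for p \<ge> 1; pulling
  \<open>d\<close> out of the modular bounds it by \<open>d\<close>.\<close>

lemma Lp_norm_less_imp_modular:
  fixes f :: "'a \<Rightarrow> 'b::euclidean_space"
  assumes [measurable]: "f \<in> borel_measurable lebesgue" and "c \<le> 1" "Lp_norm p UNIV f < ennreal c"
  shows "modular p UNIV f \<le> ennreal c"
proof -
  obtain d where d: "d > 0" "modular p UNIV (\<lambda>x. f x /\<^sub>R d) \<le> 1" "ennreal d < ennreal c"
    using assms(3) unfolding Lp_norm_def by (auto simp: INF_less_iff)
  have dc: "d < c" using d(1,3) by (simp add: ennreal_less_iff)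
  have "modular p UNIV f \<le> (\<integral>\<^sup>+x. ennreal d * ennreal (norm (f x /\<^sub>R d) powr p x) \<partial>lebesgue)"
    unfolding modular_UNIV
  proof (rule nn_integral_mono)
    fix x
    have "norm (f x) powr p x = (d * norm (f x /\<^sub>R d)) powr p x"
      using d(1) by (simp add: mult.assoc[symmetric])
    also have "\<dots> = d powr p x * norm (f x /\<^sub>R d) powr p x" by (rule powr_mult)
    also have "\<dots> \<le> d powr 1 * norm (f x /\<^sub>R d) powr p x"
      using d(1) dc assms(2) p_ge[of x] by (intro mult_right_mono powr_mono') auto
    finally have "norm (f x) powr p x \<le> d * norm (f x /\<^sub>R d) powr p x" using d(1) by simp
    then show "ennreal (norm (f x) powr p x) \<le> ennreal d * ennreal (norm (f x /\<^sub>R d) powr p x)"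
      using d(1) by (simp add: ennreal_mult[symmetric] ennreal_leI)
  qed
  also have "\<dots> = ennreal d * modular p UNIV (\<lambda>x. f x /\<^sub>R d)"
    unfolding modular_UNIV by (rule nn_integral_cmult) measurable
  also have "\<dots> \<le> ennreal d * 1" using d(2) by (intro mult_left_mono) auto
  also have "\<dots> \<le> ennreal c" using dc by (simp add: ennreal_leI)
  finally show ?thesis .
qed

text \<open>Dividing the function by e \<le> 1 enlarges the modular at most by the factor e^(-P),
  which the assumption cancels.\<close>

lemma modular_imp_Lp_norm_le:
  fixes f :: "'a \<Rightarrow> 'b::euclidean_space"
  assumes [measurable]: "f \<in> borel_measurable lebesgue" and e: "0 < e" "e \<le> 1" and le: "modular p UNIV f \<le> ennreal (e powr P)"
  shows "Lp_norm p UNIV f \<le> ennreal e"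
proof -
  have "modular p UNIV (\<lambda>x. f x /\<^sub>R e) \<le> ennreal ((1 / e) powr P) * modular p UNIV f"
    using e by (intro modular_scale) (auto simp: field_simps)
  also have "\<dots> \<le> ennreal ((1 / e) powr P) * ennreal (e powr P)"
    using le by (intro mult_left_mono) auto
  also have "\<dots> = 1" using e by (simp add: ennreal_mult[symmetric] powr_divide)
  finally have "modular p UNIV (\<lambda>x. f x /\<^sub>R e) \<le> 1" .
  then show ?thesis unfolding Lp_norm_def using e(1) by (intro INF_lower) auto
qed

lemma Lp_norm_finite_iff:
  fixes f :: "'a \<Rightarrow> 'b::euclidean_space"
  assumes [measurable]: "f \<in> borel_measurable lebesgue"
  shows "Lp_norm p UNIV f < \<infinity> \<longleftrightarrow> modular p UNIV f < \<infinity>"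
proof
  assume "Lp_norm p UNIV f < \<infinity>"
  then obtain d where d: "d > 0" "modular p UNIV (\<lambda>x. f x /\<^sub>R d) \<le> 1"
    unfolding Lp_norm_def by (auto simp: INF_less_iff)
  show "modular p UNIV f < \<infinity>"
  proof (rule modular_finite_scale[of "\<lambda>x. f x /\<^sub>R d"])
    show "modular p UNIV (\<lambda>x. f x /\<^sub>R d) < \<infinity>" using d(2) by (simp add: le_less_trans)
    show "AE x in lebesgue. norm (f x) \<le> d * norm (f x /\<^sub>R d)"
      using d(1) by (simp add: mult.assoc[symmetric])
  qed measurable
next
  assume "modular p UNIV f < \<infinity>"
  then obtain m where m: "modular p UNIV f = ennreal m" "m \<ge> 0" by (cases "modular p UNIV f") auto
  \<comment> \<open>Since p \<ge> 1, dividing by c \<ge> 1 multiplies the modular by at most 1/c,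
    and m/(m + 1) \<le> 1 makes \<open>c\<close> admissible in the norm.\<close>
  define c where "c = m + 1"
  have c: "c \<ge> 1" using m by (simp add: c_def)
  have "modular p UNIV (\<lambda>x. f x /\<^sub>R c) \<le> (\<integral>\<^sup>+x. ennreal (1 / c) * ennreal (norm (f x) powr p x) \<partial>lebesgue)"
    unfolding modular_UNIV
  proof (rule nn_integral_mono)
    fix x
    have "norm (f x /\<^sub>R c) powr p x = ((1 / c) * norm (f x)) powr p x" using c by (simp add: divide_inverse)
    also have "\<dots> = (1 / c) powr p x * norm (f x) powr p x" by (rule powr_mult)
    also have "\<dots> \<le> (1 / c) powr 1 * norm (f x) powr p x"
      using c p_ge[of x] by (intro mult_right_mono powr_mono') auto
    finally have "norm (f x /\<^sub>R c) powr p x \<le> (1 / c) * norm (f x) powr p x" using c by simp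
    then show "ennreal (norm (f x /\<^sub>R c) powr p x) \<le> ennreal (1 / c) * ennreal (norm (f x) powr p x)"
      using c by (simp only: ennreal_mult[symmetric] ennreal_leI powr_ge_zero zero_le_divide_1_iff order_trans[OF zero_le_one])
  qed
  also have "\<dots> = ennreal (1 / c) * modular p UNIV f"
    unfolding modular_UNIV by (rule nn_integral_cmult) measurable
  also have "\<dots> = ennreal (m / c)" using m c by (simp add: ennreal_mult[symmetric])
  also have "\<dots> \<le> 1" using m c by (simp add: c_def)
  finally have "Lp_norm p UNIV f \<le> ennreal c" unfolding Lp_norm_def using c by (intro INF_lower) auto
  then show "Lp_norm p UNIV f < \<infinity>" by (simp add: le_less_trans)
qed

lemma Lp_space_iff:
  fixes f :: "'a \<Rightarrow> 'b::euclidean_space"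
  assumes "\<Omega> \<in> sets lebesgue"
  shows "f \<in> Lp_space p \<Omega> \<longleftrightarrow> (\<lambda>x. if x \<in> \<Omega> then f x else 0) \<in> borel_measurable lebesgue \<and>
    modular p UNIV (\<lambda>x. if x \<in> \<Omega> then f x else 0) < \<infinity>"
  unfolding Lp_space_def mem_Collect_eq measurable_lebesgue_on_extend[OF assms] Lp_norm_extend[OF assms]
  using Lp_norm_finite_iff by blast

text \<open>A Sobolev function on the whole space together with a chosen gradient. Naming the
  gradient keeps the arbitrary choice in \<open>wgrad\<close> out of the estimates; the two are
  reconciled almost everywhere by \<open>wgrad_AE\<close>.\<close>

definition sob :: "('a \<Rightarrow> real) \<Rightarrow> ('a \<Rightarrow> 'a) \<Rightarrow> bool" where
  "sob f F \<longleftrightarrow> f \<in> borel_measurable lebesgue \<and> F \<in> borel_measurable lebesgue \<and>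
     modular p UNIV f < \<infinity> \<and> modular p UNIV F < \<infinity> \<and> weak_gradient UNIV f F"

lemma sobD:
  assumes "sob f F"
  shows "f \<in> borel_measurable lebesgue" "F \<in> borel_measurable lebesgue" "modular p UNIV f < \<infinity>" "modular p UNIV F < \<infinity>"
    "weak_gradient UNIV f F"
  using assms by (auto simp: sob_def)

lemma W1p_UNIV_iff: "f \<in> W1p p UNIV \<longleftrightarrow> (\<exists>F. sob f F)"
  unfolding W1p_def sob_def using Lp_space_iff[of UNIV f] Lp_space_iff[of UNIV]
  by auto

lemma wgrad_AE:
  assumes "open \<Omega>" "weak_gradient \<Omega> f F"
  shows "AE x in lebesgue. x \<in> \<Omega> \<longrightarrow> wgrad \<Omega> f x = F x"
proof -
  have "weak_gradient \<Omega> f (wgrad \<Omega> f)"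
    unfolding wgrad_def using someI_ex[of "weak_gradient \<Omega> f"] assms(2) by blast
  from weak_gradient_unique[OF assms(1) this assms(2)] show ?thesis .
qed

lemma sob_cong_AE:
  assumes "sob f F" "AE x in lebesgue. f x = g x" "AE x in lebesgue. F x = G x"
  shows "sob g G"
proof -
  note s = sobD[OF assms(1)]
  have "weak_gradient UNIV g G"
    by (rule weak_gradient_AE[OF s(5) open_UNIV]) (use assms(2,3) in auto)
  then show ?thesis
    using s borel_measurable_AE[OF s(1) assms(2)] borel_measurable_AE[OF s(2) assms(3)]
      modular_cong_AE[OF assms(2)] modular_cong_AE[OF assms(3)]
    by (simp add: sob_def)
qed

lemma sob_diff:
  assumes "sob f F" "sob g G"
  shows "sob (\<lambda>x. f x - g x) (\<lambda>x. F x - G x)"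
proof -
  note s = sobD[OF assms(1)] and t = sobD[OF assms(2)]
  note [measurable] = s(1,2) t(1,2)
  have "modular p UNIV (\<lambda>x. f x - g x) < \<infinity>"
    by (rule modular_finite_sum[OF s(1) t(1) s(3) t(3)]) (intro AE_I2 norm_triangle_ineq4)
  moreover have "modular p UNIV (\<lambda>x. F x - G x) < \<infinity>"
    by (rule modular_finite_sum[OF s(2) t(2) s(4) t(4)]) (intro AE_I2 norm_triangle_ineq4)
  ultimately show ?thesis
    unfolding sob_def using weak_gradient_diff[OF s(5) t(5) open_UNIV] by simp
qed

end

section \<open>Log-Hoelder exponents\<close>

lemma log_Hoelder_continuous:
  fixes p :: "'a::euclidean_space \<Rightarrow> real"
  assumes "log_Hoelder p"
  shows "continuous_on UNIV p"
proof -
  obtain L where L: "L > 0" "\<And>x y. \<bar>p x - p y\<bar> \<le> L / ln (exp 1 + 1 / dist x y)"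
    using assms unfolding log_Hoelder_def by blast
  show ?thesis
    unfolding continuous_on_iff
  proof (intro ballI allI impI)
    fix x :: 'a and e :: real assume "e > 0"
    \<comment> \<open>At distances below \<open>d\<close> the logarithm is at least 2 L/e, so the
      oscillation is at most e/2.\<close>
    define d where "d = exp (- (2 * L / e))"
    have "d > 0" by (simp add: d_def)
    moreover have "dist (p y) (p x) < e" if "dist y x < d" for y
    proof (cases "y = x")
      case False
      then have D: "dist y x > 0" by simp
      have "1 / d \<le> 1 / dist y x" using that D \<open>d > 0\<close> by (intro divide_left_mono) auto
      then have "exp (2 * L / e) \<le> exp 1 + 1 / dist y x"
        by (simp add: d_def exp_minus divide_inverse add_increasing)
      then have "ln (exp (2 * L / e)) \<le> ln (exp 1 + 1 / dist y x)"
        using D by (intro ln_mono) (auto simp: add_pos_pos)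
      then have "L / ln (exp 1 + 1 / dist y x) \<le> L / (2 * L / e)"
        using L(1) \<open>e > 0\<close> by (intro divide_left_mono) (auto intro!: mult_pos_pos divide_pos_pos elim: less_le_trans[rotated])
      also have "\<dots> < e" using L(1) \<open>e > 0\<close> by simp
      finally show ?thesis using L(2)[of y x] by (simp add: dist_real_def)
    qed (use \<open>e > 0\<close> in simp)
    ultimately show "\<exists>d>0. \<forall>y\<in>UNIV. dist y x < d \<longrightarrow> dist (p y) (p x) < e" by blast
  qed
qed

locale log_exponent = bounded_exponent +
  assumes log_Hoelder: "log_Hoelder p"
begin

lemma log_Hoelder_constant:
  obtains L where "L > 0" "\<And>x y. \<bar>p x - p y\<bar> \<le> L / ln (exp 1 + 1 / dist x y)"
  using log_Hoelder unfolding log_Hoelder_def by blast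

lemma p_continuous: "continuous_on UNIV p"
  by (rule log_Hoelder_continuous[OF log_Hoelder])

lemma p_borel [measurable]: "p \<in> borel_measurable borel"
  by (rule borel_measurable_continuous_onI[OF p_continuous])

text \<open>With \<open>l\<close> the logarithm in the log-Hoelder condition, the difference of
  exponents is at most L/l, while ln t \<le> ln B + n ln(1/r) \<le> (ln B + n) l because |x - y| < r
  and l \<ge> 1. The factor \<open>l\<close> cancels.\<close>

lemma oscillation_bound:
  assumes L: "L > 0" "\<And>x y. \<bar>p x - p y\<bar> \<le> L / ln (exp 1 + 1 / dist x y)"
    and r: "0 < r" "r \<le> 1" "dist x y < r" and B: "1 \<le> B" and t: "1 \<le> t" "t \<le> B / r ^ n"
  shows "t powr (p x - p y) \<le> exp (L * (ln B + real n))"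
proof (cases "x = y")
  case True
  have "0 \<le> L * (ln B + real n)" using L B by (intro mult_nonneg_nonneg add_nonneg_nonneg) auto
  then show ?thesis using True t by simp
next
  case False
  define l where "l = ln (exp 1 + 1 / dist x y)"
  have D: "dist x y > 0" using False by simp
  have l1: "l \<ge> 1"
  proof -
    have "ln (exp 1) \<le> l" unfolding l_def using D by (intro ln_mono) (auto simp: add_pos_pos)
    then show ?thesis by simp
  qed
  have lr: "ln (1 / r) \<le> l"
  proof -
    have "1 / r \<le> 1 / dist x y" using D r by (intro divide_left_mono) auto
    then have "1 / r \<le> exp 1 + 1 / dist x y" by (simp add: add_increasing)
    then show ?thesis unfolding l_def using r by (intro ln_mono) (auto simp: add_pos_pos D)
  qed
  have "ln t \<le> ln (B / r ^ n)" using t r B by (intro ln_mono) auto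
  also have "\<dots> = ln B + real n * ln (1 / r)"
    using r B by (simp add: ln_div ln_realpow)
  also have "\<dots> \<le> ln B * l + real n * l"
    using lr l1 B by (intro add_mono mult_left_mono) (auto simp: mult_le_cancel_left1)
  finally have lt: "ln t \<le> (ln B + real n) * l" by (simp add: algebra_simps)
  have "t powr (p x - p y) \<le> t powr (L / l)"
    using t L(2)[of x y] by (intro powr_mono) (auto simp: l_def)
  also have "\<dots> = exp (L / l * ln t)" using t by (simp add: powr_def)
  also have "\<dots> \<le> exp (L / l * ((ln B + real n) * l))"
    using lt L l1 by (intro exp_le_cancel_iff[THEN iffD2] mult_left_mono) auto
  also have "\<dots> = exp (L * (ln B + real n))" using l1 by simp
  finally show ?thesis .
qed

text \<open>
  With \<open>t\<close> half the mollified value of \<open>\<bar>f\<bar>\<close> at \<open>x\<close>, the pointwise bound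
  \<open>\<bar>f y\<bar> \<le> t + \<bar>f y\<bar> powr p y * t powr (1 - p y)\<close> lets the first summand be absorbed, and log-Hoelder continuity allows
  to replace \<open>p y\<close> by \<open>p x\<close>, since \<open>t\<close> is at most a power of \<open>1 / r\<close>.
\<close>

lemma moll_powr_le:
  fixes f :: "'a \<Rightarrow> 'b::euclidean_space"
  assumes f: "integrable lborel f" and g: "integrable lborel (\<lambda>x. norm (f x) powr p x)"
  obtains C where "C \<ge> 1"
    "\<And>r x. 0 < r \<Longrightarrow> r \<le> 1 \<Longrightarrow> norm (moll r f x) powr p x \<le> C * (1 + moll r (\<lambda>x. norm (f x) powr p x) x)"
proof -
  obtain L where L: "L > 0" "\<And>x y. \<bar>p x - p y\<bar> \<le> L / ln (exp 1 + 1 / dist x y)"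
    by (rule log_Hoelder_constant) (rule that, assumption+)
  obtain Ck where Ck: "Ck > 0" "\<And>r (z::'a). r > 0 \<Longrightarrow> kern r z \<le> Ck / r ^ DIM('a)"
    using kern_bound by blast
  have [measurable]: "f \<in> borel_measurable borel" using f by auto
  define N where "N = (\<integral>x. norm (f x) \<partial>lborel)"
  have N: "N \<ge> 0" by (simp add: N_def)
  \<comment> \<open>The kernel bound times the L^1 norm of \<open>f\<close> bounds every mollified
    value of |f| by B/r^n; the maximum with 1 makes ln B nonnegative.\<close>
  define B where "B = max 1 (Ck * N)"
  define C1 where "C1 = exp (L * (ln B + real DIM('a)))"
  have B: "B \<ge> 1" by (simp add: B_def)
  have C1: "C1 \<ge> 1" unfolding C1_def one_le_exp_iff using L B by (intro mult_nonneg_nonneg add_nonneg_nonneg) auto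
  have P2: "2 powr P \<ge> 1" using P_ge by (simp add: ge_one_powr_ge_zero)
  define C where "C = 2 powr P * C1"
  have C: "C \<ge> 1" "C \<ge> 2 powr P" unfolding C_def using P2 C1 mult_mono[OF P2 C1] by (auto simp: mult_le_cancel_left1)
  show ?thesis
  proof (rule that[OF C(1)])
    fix r :: real and x :: 'a
    assume r: "0 < r" "r \<le> 1"
    let ?g = "\<lambda>x. norm (f x) powr p x"
    have nf: "integrable lborel (\<lambda>x. norm (f x))" using f by simp
    have ik: "integrable lborel (\<lambda>z. kern r z *\<^sub>R norm (f (x - z)))"
      by (rule moll_integrable[OF r(1) nf])
    have ig: "integrable lborel (\<lambda>z. kern r z *\<^sub>R ?g (x - z))"
      by (rule moll_integrable[OF r(1) g])
    define s where "s = (\<integral>z. kern r z * norm (f (x - z)) \<partial>lborel)"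
    have s0: "s \<ge> 0" unfolding s_def by (intro Bochner_Integration.integral_nonneg) (simp add: kern_nonneg)
    have mg0: "moll r ?g x \<ge> 0"
      unfolding moll_def by (intro Bochner_Integration.integral_nonneg) (simp add: kern_nonneg)
    have ms: "norm (moll r f x) \<le> s"
    proof -
      have "norm (moll r f x) \<le> (\<integral>z. norm (kern r z *\<^sub>R f (x - z)) \<partial>lborel)"
        unfolding moll_def by (rule integral_norm_bound)
      also have "\<dots> = s" unfolding s_def by (intro Bochner_Integration.integral_cong) (auto simp: kern_nonneg)
      finally show ?thesis .
    qed
    have sB: "s \<le> B / r ^ DIM('a)"
    proof -
      have i: "integrable lborel (\<lambda>z. norm (f (x - z)))" "(\<integral>z. norm (f (x - z)) \<partial>lborel) = N"
        using integral_lborel_reflect[of "\<lambda>y. norm (f y)" x] nf by (auto simp: N_def)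
      have "s \<le> (\<integral>z. Ck / r ^ DIM('a) * norm (f (x - z)) \<partial>lborel)"
        unfolding s_def
      proof (rule integral_mono)
        show "kern r z * norm (f (x - z)) \<le> Ck / r ^ DIM('a) * norm (f (x - z))" for z
          by (rule mult_right_mono[OF Ck(2)[OF r(1)]]) simp
        show "integrable lborel (\<lambda>z. Ck / r ^ DIM('a) * norm (f (x - z)))"
          by (rule integrable_mult_right[OF i(1)])
      qed (use ik in simp)
      also have "\<dots> = Ck * N / r ^ DIM('a)" using i by simp
      also have "\<dots> \<le> B / r ^ DIM('a)" using r by (intro divide_right_mono) (auto simp: B_def)
      finally show ?thesis .
    qed
    show "norm (moll r f x) powr p x \<le> C * (1 + moll r ?g x)"
    \<comment> \<open>Small averages are bounded by a constant outright; they account for the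
      summand 1 in the estimate.\<close>
    proof (cases "s / 2 < 1")
      case True
      then have "norm (moll r f x) powr p x \<le> 2 powr p x"
        using ms p_pos[of x] by (intro powr_mono2) auto
      also have "\<dots> \<le> 2 powr P" using p_le by (intro powr_mono) auto
      also have "\<dots> \<le> C * 1" using C by simp
      also have "\<dots> \<le> C * (1 + moll r ?g x)" using mg0 C by (intro mult_left_mono) auto
      finally show ?thesis .
    next
      case False
      define t where "t = s / 2"
      have "t \<le> s" using s0 by (simp add: t_def)
      then have t: "t \<ge> 1" "t \<le> B / r ^ DIM('a)" using False sB by (simp add: t_def, linarith)
      have pw: "kern r z * norm (f (x - z)) \<le> t * kern r z + t powr (1 - p x) * C1 * (kern r z *\<^sub>R ?g (x - z))" for z
      proof (cases "norm z < r")
        case True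
        let ?y = "x - z" and ?v = "norm (f (x - z))"
        have "?v \<le> t + t powr (1 - p x) * C1 * ?v powr p ?y"
        proof (cases "?v \<le> t")
          case True
          then show ?thesis using C1 by (simp add: add_increasing2)
        next
          case False
          have "?v = ?v powr p ?y * ?v powr (1 - p ?y)" using False t by (simp add: powr_add[symmetric])
          \<comment> \<open>The exponent 1 - p is at most 0, so the base may be lowered from |f| to
            \<open>t\<close>.\<close>
          also have "\<dots> \<le> ?v powr p ?y * t powr (1 - p ?y)"
            using False t p_ge[of ?y] by (intro mult_left_mono powr_mono2') auto
          also have "t powr (1 - p ?y) = t powr (1 - p x) * t powr (p x - p ?y)"
            by (simp add: powr_add[symmetric])
          also have "?v powr p ?y * (t powr (1 - p x) * t powr (p x - p ?y)) \<le> ?v powr p ?y * (t powr (1 - p x) * C1)"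
          proof -
            have "dist x ?y < r" using True by (simp add: dist_norm)
            from oscillation_bound[OF L r this B t] show ?thesis
              unfolding C1_def by (intro mult_left_mono) auto
          qed
          finally show ?thesis using t by (simp add: mult_ac)
        qed
        then have "kern r z * ?v \<le> kern r z * (t + t powr (1 - p x) * C1 * ?v powr p ?y)"
          by (intro mult_left_mono kern_nonneg)
        then show ?thesis by (simp add: algebra_simps)
      next
        case False
        then show ?thesis using kern_zero[OF r(1), of z] by simp
      qed
      have "s \<le> (\<integral>z. t * kern r z + t powr (1 - p x) * C1 * (kern r z *\<^sub>R ?g (x - z)) \<partial>lborel)"
        unfolding s_def
        using ik ig kern_integrable[OF r(1), where 'a='a]
        by (intro integral_mono pw) auto
      also have "\<dots> = t * 1 + t powr (1 - p x) * C1 * moll r ?g x"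
      proof -
        have "(\<integral>z. t * kern r z + t powr (1 - p x) * C1 * (kern r z *\<^sub>R ?g (x - z)) \<partial>lborel)
          = (\<integral>z. t * kern r z \<partial>(lborel::'a measure)) + (\<integral>z. t powr (1 - p x) * C1 * (kern r z *\<^sub>R ?g (x - z)) \<partial>lborel)"
          by (intro Bochner_Integration.integral_add integrable_mult_right ig kern_integrable r)
        then show ?thesis
          unfolding moll_def using kern_integral[OF r(1), where 'a='a] by (simp only: integral_mult_right_zero)
      qed
      finally have "t \<le> t powr (1 - p x) * C1 * moll r ?g x" by (simp add: t_def)
      then have "t powr (p x - 1) * t \<le> t powr (p x - 1) * (t powr (1 - p x) * (C1 * moll r ?g x))"
        by (intro mult_left_mono) (auto simp: mult.assoc)
      moreover have "t powr (p x - 1) * t = t powr p x"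
        using t powr_add[of t "p x - 1" 1] by simp
      moreover have "t powr (p x - 1) * (t powr (1 - p x) * (C1 * moll r ?g x)) = C1 * moll r ?g x"
        using t by (simp add: mult.assoc[symmetric] powr_add[symmetric])
      ultimately have tp: "t powr p x \<le> C1 * moll r ?g x" by simp
      have "norm (moll r f x) powr p x \<le> 2 powr P * t powr p x"
        using ms t by (intro powr_scale_le) (auto simp: t_def)
      also have "\<dots> \<le> 2 powr P * (C1 * moll r ?g x)" using tp by (intro mult_left_mono) auto
      also have "\<dots> = C * moll r ?g x" by (simp add: C_def)
      also have "\<dots> \<le> C * (1 + moll r ?g x)" using C by (intro mult_left_mono) auto
      finally show ?thesis .
    qed
  qed
qed

end

section \<open>Mollification converges in the modular\<close>

context log_exponent
begin

text \<open>\<open>moll_powr_le\<close> bounds the error |f_r - f|^p by \<open>w\<close> plus a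
  multiple of |g_r - g|, where g = |f|^p. The majorant thus moves with r, but its excess over
  \<open>w\<close> tends to 0 in L^1, and the minimum of the error and \<open>w\<close> is treated
  by dominated convergence. Bounded support makes the constant in \<open>w\<close>
  integrable.\<close>

lemma moll_modular_tendsto:
  fixes f :: "'a \<Rightarrow> 'b::euclidean_space"
  assumes fm [measurable]: "f \<in> borel_measurable borel" and fin: "modular p UNIV f < \<infinity>"
    and supp: "\<And>x. norm x > R \<Longrightarrow> f x = 0"
    and r: "\<And>n::nat. 0 < r n" "\<And>n. r n \<le> 1" "r \<longlonglongrightarrow> 0"
  shows "\<exists>s::nat \<Rightarrow> nat. strict_mono s \<and> (\<lambda>n. modular p UNIV (\<lambda>x. moll (r (s n)) f x - f x)) \<longlonglongrightarrow> 0"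
proof -
  define g where "g x = norm (f x) powr p x" for x
  have [measurable]: "g \<in> borel_measurable borel" unfolding g_def by measurable
  have g0: "g x \<ge> 0" for x by (simp add: g_def)
  have fl: "f \<in> borel_measurable lebesgue" using fm by (intro measurable_completion) simp
  have ig: "integrable lborel g"
    unfolding integrable_iff_bounded using fin by (simp add: modular_UNIV g_def nn_integral_completion)
  have "locally_integrable UNIV f" by (rule modular_locally_integrable[OF fl fin])
  then have "integrable lborel (\<lambda>x. indicator (cball 0 R) x *\<^sub>R f x)"
    by (rule locally_integrable_lborel[OF _ fm]) simp
  moreover have "(\<lambda>x. indicator (cball 0 R) x *\<^sub>R f x) = f"
    using supp by (auto simp: fun_eq_iff indicator_def)
  ultimately have if': "integrable lborel f" by simp
  obtain C where C: "C \<ge> 1" "\<And>r x. 0 < r \<Longrightarrow> r \<le> 1 \<Longrightarrow> norm (moll r f x) powr p x \<le> C * (1 + moll r g x)"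
    using moll_powr_le[OF if' ig[unfolded g_def[abs_def]]] unfolding g_def[abs_def] by blast
  define D where "D = 2 powr P * C"
  have P2: "2 powr P \<ge> 1" using P_ge by (simp add: ge_one_powr_ge_zero)
  have D: "D \<ge> 1" "D \<ge> 2 powr P"
    unfolding D_def using P2 C(1) mult_mono[OF P2 C(1)] by (auto simp: mult_le_cancel_left1)
  \<comment> \<open>One copy of \<open>g\<close> comes from |f|^p, the other from writing the
    mollified \<open>g\<close> as \<open>g\<close> plus its error. The ball is larger by 1 because
    the radii are at most 1.\<close>
  define w where "w x = D * (indicator (cball 0 (R + 1)) x + 2 * g x)" for x
  have w0: "w x \<ge> 0" for x using D g0[of x] unfolding w_def by (intro mult_nonneg_nonneg add_nonneg_nonneg) auto
  define h where "h n x = norm (moll (r n) f x - f x) powr p x" for n x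
  have [measurable]: "cball (0::'a) (R + 1) \<in> sets borel" by simp
  have [measurable]: "w \<in> borel_measurable borel" "h n \<in> borel_measurable borel" for n
    unfolding w_def h_def by measurable
  have hz: "h n x = 0" if "norm x > R + 1" for n x
  proof -
    have "f y = 0" if "y \<in> ball x (r n)" for y
    proof -
      have "norm x \<le> norm y + norm (x - y)" using norm_triangle_ineq[of y "x - y"] by simp
      then have "norm y > R" using that r(2)[of n] \<open>norm x > R + 1\<close> by (simp add: dist_norm)
      then show ?thesis by (rule supp)
    qed
    then have "moll (r n) f x = moll (r n) (\<lambda>_. 0) x" by (intro moll_local r(1)) auto
    moreover have "f x = 0" using that by (intro supp) auto
    ultimately show "h n x = 0" by (simp add: h_def moll_def)
  qed
  have h_le: "h n x \<le> w x + D * \<bar>moll (r n) g x - g x\<bar>" for n x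
  proof (cases "norm x \<le> R + 1")
    case True
    have "h n x \<le> 2 powr P * (norm (moll (r n) f x) powr p x + norm (f x) powr p x)"
      unfolding h_def by (intro powr_sum_le norm_triangle_ineq4) auto
    also have "\<dots> \<le> 2 powr P * (C * (1 + moll (r n) g x) + C * g x)"
      using C(2)[OF r(1,2)] mult_right_mono[OF C(1) g0[of x]] by (intro mult_left_mono add_mono) (auto simp: g_def)
    also have "\<dots> = D * (1 + 2 * g x) + D * (moll (r n) g x - g x)" by (simp add: D_def algebra_simps)
    also have "\<dots> \<le> w x + D * \<bar>moll (r n) g x - g x\<bar>"
      using True D by (auto simp: w_def intro!: mult_left_mono)
    finally show ?thesis .
  next
    case False
    then have "h n x = 0" by (intro hz) simp
    then show ?thesis using w0[of x] D by simp
  qed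
  have cg: "(\<lambda>n. \<integral>\<^sup>+x. norm (moll (r n) g x - g x) \<partial>lborel) \<longlonglongrightarrow> 0"
    by (rule moll_L1[OF ig r(1,3)])
  have lf: "locally_integrable UNIV f" by fact
  have c1: "L1_on (cball 0 (R + 1)) (\<lambda>n. moll (r n) f) f"
    by (rule moll_L1_on[OF lf fm _ r]) auto
  have lm: "locally_integrable UNIV (moll (r n) f)" for n
    by (intro locally_integrable_continuous moll_continuous lf fm r)
  obtain s :: "nat \<Rightarrow> nat" where s: "strict_mono s"
    "AE x in lebesgue. x \<in> cball 0 (R + 1) \<longrightarrow> (\<lambda>n. moll (r (s n)) f x) \<longlonglongrightarrow> f x"
    using L1_on_AE_subseq[OF c1 lm lf compact_cball subset_UNIV] by blast
  have hs: "AE x in lebesgue. (\<lambda>n. h (s n) x) \<longlonglongrightarrow> 0"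
    using s(2)
  proof eventually_elim
    case (elim x)
    show ?case
    proof (cases "norm x \<le> R + 1")
      case True
      then have "(\<lambda>n. norm (moll (r (s n)) f x - f x)) \<longlonglongrightarrow> 0"
        using elim by (simp add: LIM_zero tendsto_norm_zero)
      then show ?thesis unfolding h_def by (rule powr_tendsto_zero) (use p_ge in auto)
    qed (simp add: hz)
  qed
  have "(\<lambda>n. \<integral>\<^sup>+x. ennreal (min (h (s n) x) (w x)) \<partial>lebesgue) \<longlonglongrightarrow> (\<integral>\<^sup>+(x::'a). 0 \<partial>lebesgue)"
  proof (rule nn_integral_dominated_convergence[where w="\<lambda>x. ennreal (w x)"])
    have "integrable lborel w"
      unfolding w_def using ig emeasure_bounded_finite[of "cball (0::'a) (R + 1)"]
      by (intro integrable_mult_right Bochner_Integration.integrable_add integrable_real_indicator) auto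
    then have "(\<integral>\<^sup>+x. ennreal (w x) \<partial>lborel) < \<infinity>"
      using w0 unfolding integrable_iff_bounded by simp
    then show "(\<integral>\<^sup>+x. ennreal (w x) \<partial>lebesgue) < \<infinity>" by (simp add: nn_integral_completion)
    show "AE x in lebesgue. (\<lambda>n. ennreal (min (h (s n) x) (w x))) \<longlonglongrightarrow> 0"
      using hs
    proof eventually_elim
      case (elim x)
      have "(\<lambda>n. min (h (s n) x) (w x)) \<longlonglongrightarrow> min 0 (w x)" by (intro tendsto_intros elim)
      then show ?case using w0[of x] by (subst ennreal_tendsto_0_iff) (auto simp: h_def)
    qed
    show "AE x in lebesgue. ennreal (min (h (s n) x) (w x)) \<le> ennreal (w x)" for n
      by (intro AE_I2 ennreal_leI) simp
    show "(\<lambda>x. ennreal (min (h (s n) x) (w x))) \<in> borel_measurable lebesgue" for n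
      by (intro measurable_completion) measurable
    show "(\<lambda>x. ennreal (w x)) \<in> borel_measurable lebesgue"
      by (intro measurable_completion) measurable
  qed simp
  moreover have "(\<lambda>n. ennreal D * (\<integral>\<^sup>+x. norm (moll (r (s n)) g x - g x) \<partial>lborel)) \<longlonglongrightarrow> ennreal D * 0"
    using LIMSEQ_subseq_LIMSEQ[OF cg s(1)] by (intro ennreal_tendsto_cmult) (auto simp: comp_def)
  ultimately have lim: "(\<lambda>n. (\<integral>\<^sup>+x. ennreal (min (h (s n) x) (w x)) \<partial>lebesgue) +
      ennreal D * (\<integral>\<^sup>+x. norm (moll (r (s n)) g x - g x) \<partial>lborel)) \<longlonglongrightarrow> 0"
    using tendsto_add by fastforce
  have "(\<lambda>n. modular p UNIV (\<lambda>x. moll (r (s n)) f x - f x)) \<longlonglongrightarrow> 0"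
  proof (rule ennreal_tendsto_0_le[OF lim])
    fix n
    have "modular p UNIV (\<lambda>x. moll (r (s n)) f x - f x) \<le>
      (\<integral>\<^sup>+x. ennreal (min (h (s n) x) (w x)) + ennreal D * norm (moll (r (s n)) g x - g x) \<partial>lborel)"
      unfolding modular_UNIV nn_integral_completion
    proof (rule nn_integral_mono)
      fix x
      have "h (s n) x \<le> min (h (s n) x) (w x) + D * \<bar>moll (r (s n)) g x - g x\<bar>"
        using h_le[of "s n" x] D by (auto simp: min_def)
      from ennreal_leI[OF this]
      show "ennreal (norm (moll (r (s n)) f x - f x) powr p x) \<le> ennreal (min (h (s n) x) (w x)) + ennreal D * norm (moll (r (s n)) g x - g x)"
        using D w0[of x] by (simp add: h_def ennreal_mult)
    qed
    also have "\<dots> = (\<integral>\<^sup>+x. ennreal (min (h (s n) x) (w x)) \<partial>lborel) + ennreal D * (\<integral>\<^sup>+x. norm (moll (r (s n)) g x - g x) \<partial>lborel)"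
    proof -
      have "(\<integral>\<^sup>+x. ennreal D * norm (moll (r (s n)) g x - g x) \<partial>lborel) = ennreal D * (\<integral>\<^sup>+x. norm (moll (r (s n)) g x - g x) \<partial>lborel)"
        by (rule nn_integral_cmult) measurable
      then show ?thesis by (subst nn_integral_add) auto
    qed
    finally show "modular p UNIV (\<lambda>x. moll (r (s n)) f x - f x) \<le> (\<integral>\<^sup>+x. ennreal (min (h (s n) x) (w x)) \<partial>lebesgue) +
      ennreal D * (\<integral>\<^sup>+x. norm (moll (r (s n)) g x - g x) \<partial>lborel)"
      by (simp add: nn_integral_completion)
  qed
  with s(1) show ?thesis by blast
qed

end

lemma weak_gradient_zero: "open \<Omega> \<Longrightarrow> weak_gradient \<Omega> (\<lambda>_. 0) (\<lambda>_. 0)"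
  by (simp add: weak_gradient_iff locally_integrable_def)

text \<open>On the open complement of \<open>K\<close> the zero function is a weak gradient as well,
  and uniqueness applies there.\<close>

lemma weak_gradient_vanish:
  assumes "weak_gradient UNIV v V" "closed K" "\<And>x. x \<notin> K \<Longrightarrow> v x = 0"
  shows "AE x in lebesgue. x \<notin> K \<longrightarrow> V x = 0"
proof -
  have o: "open (- K)" using assms(2) by (simp add: open_Compl)
  have 1: "weak_gradient (- K) v V" by (rule weak_gradient_restrict[OF assms(1) open_UNIV o]) simp
  have 2: "weak_gradient (- K) v (\<lambda>_. 0)"
    by (rule weak_gradient_AE[OF weak_gradient_zero[OF o] o]) (use assms(3) in auto)
  from weak_gradient_unique[OF o 1 2] show ?thesis by eventually_elim simp
qed

context bounded_exponent
begin

text \<open>Finiteness is inherited from a single member at modular distance below 1. For the weak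
  gradient, modular convergence implies L^1 convergence on compact sets.\<close>

lemma sob_closed:
  assumes s: "\<And>n::nat. sob (f n) (F n)" and [measurable]: "g \<in> borel_measurable lebesgue" "G \<in> borel_measurable lebesgue"
    and conv: "(\<lambda>n. modular p UNIV (\<lambda>x. f n x - g x)) \<longlonglongrightarrow> 0" "(\<lambda>n. modular p UNIV (\<lambda>x. F n x - G x)) \<longlonglongrightarrow> 0"
  shows "sob g G"
proof -
  note sD = sobD[OF s]
  have [measurable]: "f n \<in> borel_measurable lebesgue" "F n \<in> borel_measurable lebesgue" for n
    using sD by auto
  obtain n where n: "modular p UNIV (\<lambda>x. f n x - g x) < ennreal 1"
    using ennreal_tendsto_0D[OF conv(1), of 1] by (auto simp: eventually_sequentially)
  have g: "modular p UNIV g < \<infinity>"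
  proof (rule modular_finite_sum[of "f n" "\<lambda>x. f n x - g x"])
    show "modular p UNIV (\<lambda>x. f n x - g x) < \<infinity>" by (rule less_trans[OF n]) simp
    show "AE x in lebesgue. norm (g x) \<le> norm (f n x) + norm (f n x - g x)"
      using norm_triangle_ineq4[of "f n _" "f n _ - g _"] by (intro AE_I2) simp
  qed (use sD in auto)
  obtain m where m: "modular p UNIV (\<lambda>x. F m x - G x) < ennreal 1"
    using ennreal_tendsto_0D[OF conv(2), of 1] by (auto simp: eventually_sequentially)
  have G: "modular p UNIV G < \<infinity>"
  proof (rule modular_finite_sum[of "F m" "\<lambda>x. F m x - G x"])
    show "modular p UNIV (\<lambda>x. F m x - G x) < \<infinity>" by (rule less_trans[OF m]) simp
    show "AE x in lebesgue. norm (G x) \<le> norm (F m x) + norm (F m x - G x)"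
      by (intro AE_I2) (metis add_diff_cancel_left' diff_add_cancel norm_minus_commute norm_triangle_sub)
  qed (use sD in auto)
  have "weak_gradient UNIV g G"
  proof (rule weak_gradient_closed[OF open_UNIV])
    show "locally_integrable UNIV g" "locally_integrable UNIV G"
      by (rule modular_locally_integrable[OF assms(2) g], rule modular_locally_integrable[OF assms(3) G])
    show "\<exists>v H. (\<forall>n::nat. weak_gradient UNIV (v n) (H n)) \<and> L1_on K v g \<and> L1_on K H G" if "compact K" for K
      using modular_tendsto_L1_on[OF _ _ conv(1) that] modular_tendsto_L1_on[OF _ _ conv(2) that] sD(5)
      by (intro exI[of _ f] exI[of _ F]) auto
  qed
  with g G show ?thesis by (simp add: sob_def)
qed

end

context log_exponent
begin

text \<open>The radius stays below the amount by which \<open>K\<close> can be enlarged within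
  \<Omega>, so the mollification vanishes outside the compact set \<open>K'\<close>. Convergence is
  obtained along a subsequence for the function and along a further one for its gradient.\<close>

lemma sob_approx:
  assumes s: "sob v V" and K: "compact K" "K \<subseteq> \<Omega>" "open \<Omega>" and v0: "\<And>x. x \<notin> K \<Longrightarrow> v x = 0" and e: "e > 0"
  shows "\<exists>f F K'. continuous_on UNIV f \<and> sob f F \<and> compact K' \<and> K' \<subseteq> \<Omega> \<and> (\<forall>x. x \<notin> K' \<longrightarrow> f x = 0) \<and>
    modular p UNIV (\<lambda>x. f x - v x) < ennreal e \<and> modular p UNIV (\<lambda>x. F x - V x) < ennreal e"
proof -
  note sD = sobD[OF s]
  have Kb [measurable]: "K \<in> sets borel" using K by (simp add: compact_imp_closed)
  obtain a where a [measurable]: "a \<in> borel_measurable borel" "AE x in lebesgue. v x = a x"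
    using borel_version[OF sD(1)] by blast
  obtain A where A [measurable]: "A \<in> borel_measurable borel" "AE x in lebesgue. V x = A x"
    using borel_version[OF sD(2)] by blast
  \<comment> \<open>The indicator makes both Borel versions vanish off \<open>K\<close> at every
    point, as the support condition of \<open>moll_modular_tendsto\<close> demands. For the gradient
    the change is on a null set by \<open>weak_gradient_vanish\<close>.\<close>
  define b where "b x = indicator K x *\<^sub>R a x" for x
  define B where "B x = indicator K x *\<^sub>R A x" for x
  have bm [measurable]: "b \<in> borel_measurable borel" "B \<in> borel_measurable borel"
    unfolding b_def B_def by measurable
  have bv: "AE x in lebesgue. v x = b x"
    using a(2) by eventually_elim (auto simp: b_def indicator_def v0)
  have "AE x in lebesgue. x \<notin> K \<longrightarrow> V x = 0"
    by (rule weak_gradient_vanish[OF sD(5) compact_imp_closed[OF K(1)]]) (rule v0)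
  with A(2) have BV: "AE x in lebesgue. V x = B x"
    by eventually_elim (auto simp: B_def indicator_def)
  have sb: "sob b B" by (rule sob_cong_AE[OF s bv BV])
  note bD = sobD[OF sb]
  obtain R where R: "\<And>x. x \<in> K \<Longrightarrow> norm x \<le> R" using K(1) compact_imp_bounded bounded_iff by metis
  have bz: "b x = 0" "B x = 0" if "x \<notin> K" for x using that by (auto simp: b_def B_def)
  have bR: "b x = 0" "B x = 0" if "norm x > R" for x using that bz R by (meson not_le)+
  obtain d K' where d: "0 < d" "d \<le> 1" and cK': "compact K'" and subK': "K' \<subseteq> \<Omega>"
    and K'I: "\<And>y. y \<in> K \<Longrightarrow> cball y d \<subseteq> K'"
    by (rule compact_neighbourhood[OF K]) (rule that, assumption+)
  define r where "r n = d / real (Suc n)" for n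
  have r: "\<And>n. 0 < r n" "\<And>n. r n \<le> d" using d(1) by (auto simp: r_def field_simps)
  have r1: "r n \<le> 1" for n using r(2)[of n] d(2) by linarith
  have r0: "r \<longlonglongrightarrow> 0"
    unfolding r_def using tendsto_mult_right_zero[OF LIMSEQ_Suc[OF lim_1_over_n], of d] by simp
  obtain s1 :: "nat \<Rightarrow> nat" where s1: "strict_mono s1" "(\<lambda>n. modular p UNIV (\<lambda>x. moll (r (s1 n)) b x - b x)) \<longlonglongrightarrow> 0"
    using moll_modular_tendsto[of b R r] bm(1) bD(3) bR(1) r(1) r1 r0 by blast
  have r0': "(\<lambda>n. r (s1 n)) \<longlonglongrightarrow> 0" using LIMSEQ_subseq_LIMSEQ[OF r0 s1(1)] by (simp add: comp_def)
  obtain s2 :: "nat \<Rightarrow> nat" where s2: "strict_mono s2" "(\<lambda>n. modular p UNIV (\<lambda>x. moll (r (s1 (s2 n))) B x - B x)) \<longlonglongrightarrow> 0"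
    using moll_modular_tendsto[of B R "\<lambda>n. r (s1 n)"] bm(2) bD(4) bR(2) r(1) r1 r0' by blast
  have "(\<lambda>n. modular p UNIV (\<lambda>x. moll (r (s1 (s2 n))) b x - b x)) \<longlonglongrightarrow> 0"
    using LIMSEQ_subseq_LIMSEQ[OF s1(2) s2(1)] by (simp add: comp_def)
  from eventually_conj[OF ennreal_tendsto_0D[OF this e] ennreal_tendsto_0D[OF s2(2) e]]
  obtain n where n: "modular p UNIV (\<lambda>x. moll (r (s1 (s2 n))) b x - b x) < ennreal e"
    "modular p UNIV (\<lambda>x. moll (r (s1 (s2 n))) B x - B x) < ennreal e"
    by (auto simp: eventually_sequentially)
  define q where "q = r (s1 (s2 n))"
  have q: "0 < q" "q \<le> d" "q \<le> 1" using r r1 by (auto simp: q_def)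
  have lb: "locally_integrable UNIV b" "locally_integrable UNIV B" using weak_gradient_loc[OF bD(5)] .
  have c: "continuous_on UNIV (moll q b)" "continuous_on UNIV (moll q B)"
    using moll_continuous[OF lb(1) bm(1) q(1)] moll_continuous[OF lb(2) bm(2) q(1)] .
  have [measurable]: "moll q b \<in> borel_measurable lebesgue" "moll q B \<in> borel_measurable lebesgue"
    using continuous_lebesgue_measurable c by auto
  note [measurable] = bD(1,2)
  have w: "weak_gradient UNIV (moll q b) (moll q B)"
    using moll_chain_weak_gradient[OF bD(5) bm q(1), of "\<lambda>t. t" "\<lambda>_. 1"] by simp
  have m1: "modular p UNIV (moll q b) < \<infinity>"
  proof (rule modular_finite_sum[of b "\<lambda>x. moll q b x - b x"])
    show "modular p UNIV (\<lambda>x. moll q b x - b x) < \<infinity>"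
      unfolding q_def by (rule less_trans[OF n(1)]) simp
    show "AE x in lebesgue. norm (moll q b x) \<le> norm (b x) + norm (moll q b x - b x)"
      by (intro AE_I2) (rule norm_triangle_sub)
  qed (use bD in auto)
  have m2: "modular p UNIV (moll q B) < \<infinity>"
  proof (rule modular_finite_sum[of B "\<lambda>x. moll q B x - B x"])
    show "modular p UNIV (\<lambda>x. moll q B x - B x) < \<infinity>"
      unfolding q_def by (rule less_trans[OF n(2)]) simp
    show "AE x in lebesgue. norm (moll q B x) \<le> norm (B x) + norm (moll q B x - B x)"
      by (intro AE_I2) (rule norm_triangle_sub)
  qed (use bD in auto)
  have vanish: "moll q b x = 0" if "x \<notin> K'" for x
  proof -
    have "b y = 0" if "y \<in> ball x q" for y
        proof (rule bz(1), rule notI)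
      assume "y \<in> K"
      moreover have "x \<in> cball y d" using that q(2) by (simp add: dist_commute)
      ultimately show False using K'I \<open>x \<notin> K'\<close> by blast
    qed
    then have "moll q b x = moll q (\<lambda>_. 0) x" by (intro moll_local q(1)) auto
    then show ?thesis by (simp add: moll_def)
  qed
  have "modular p UNIV (\<lambda>x. moll q b x - v x) = modular p UNIV (\<lambda>x. moll q b x - b x)"
    using bv by (intro modular_cong_AE) (auto elim: eventually_mono)
  moreover have "modular p UNIV (\<lambda>x. moll q B x - V x) = modular p UNIV (\<lambda>x. moll q B x - B x)"
    using BV by (intro modular_cong_AE) (auto elim: eventually_mono)
  ultimately show ?thesis
    using n[folded q_def] c(1) cK' subK' vanish w m1 m2
    by (intro exI[of _ "moll q b"] exI[of _ "moll q B"] exI[of _ K']) (auto simp: sob_def)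
qed

end

section \<open>Capacity\<close>

text \<open>A bounded smooth even substitute for the absolute value.\<close>

definition hump :: "real \<Rightarrow> real" where "hump t = 2 - 2 / (1 + t\<^sup>2)"
definition hump' :: "real \<Rightarrow> real" where "hump' t = 4 * t / (1 + t\<^sup>2)\<^sup>2"

lemma hump_facts:
  "(hump has_real_derivative hump' t) (at t)" "continuous_on UNIV hump'" "\<bar>hump' t\<bar> \<le> 4"
  "hump t \<ge> 0" "\<bar>hump t\<bar> \<le> 2 * \<bar>t\<bar>" "\<bar>t\<bar> \<ge> 1 \<Longrightarrow> hump t \<ge> 1"
proof -
  have D: "1 + s\<^sup>2 > 0" for s :: real by (simp add: add_pos_nonneg)
  have d: "((\<lambda>t. 1 + t\<^sup>2) has_real_derivative 2 * t) (at t)" by (auto intro!: derivative_eq_intros)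
  have "((\<lambda>t. 2 / (1 + t\<^sup>2)) has_real_derivative (0 * (1 + t\<^sup>2) - 2 * t * 2) / (1 + t\<^sup>2)^2) (at t)"
    using DERIV_quotient[OF DERIV_const d, of 2] D[of t] by (simp add: power2_eq_square)
  from DERIV_diff[OF DERIV_const this, of 2]
  show "(hump has_real_derivative hump' t) (at t)"
    by (simp add: hump_def[abs_def] hump'_def)
  show "continuous_on UNIV hump'"
    unfolding hump'_def[abs_def] using D by (intro continuous_intros) (auto simp: less_imp_neq[THEN not_sym])
  have eq: "hump t = 2 * t\<^sup>2 / (1 + t\<^sup>2)" using D[of t] by (simp add: hump_def field_simps)
  show "hump t \<ge> 0" unfolding eq using D[of t] by simp
  have r: "\<bar>t\<bar> / (1 + t\<^sup>2) \<le> 1" by (rule quadratic_ratio)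
  have r0: "0 \<le> \<bar>t\<bar> / (1 + t\<^sup>2)" using D[of t] by simp
  have "\<bar>hump t\<bar> = 2 * \<bar>t\<bar> * (\<bar>t\<bar> / (1 + t\<^sup>2))"
    unfolding eq using D[of t] by (simp add: power2_eq_square abs_mult)
  also have "\<dots> \<le> 2 * \<bar>t\<bar> * 1" using r by (intro mult_left_mono) auto
  finally show "\<bar>hump t\<bar> \<le> 2 * \<bar>t\<bar>" by simp
  have "\<bar>hump' t\<bar> = 4 * (\<bar>t\<bar> / (1 + t\<^sup>2)) * (1 / (1 + t\<^sup>2))"
    unfolding hump'_def using D[of t] by (simp add: abs_mult power2_eq_square)
  also have "\<dots> \<le> 4 * 1 * 1" using r r0 D[of t] by (intro mult_mono) auto
  finally show "\<bar>hump' t\<bar> \<le> 4" by simp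
  show "hump t \<ge> 1" if "\<bar>t\<bar> \<ge> 1"
  proof -
    have "t\<^sup>2 \<ge> 1" using one_le_power[OF that, of 2] by simp
    then show ?thesis unfolding hump_def by (simp add: divide_le_eq add_pos_nonneg)
  qed
qed

section \<open>Series of Sobolev functions and capacities of countable unions\<close>

lemma weak_gradient_sum:
  assumes "\<And>k::nat. weak_gradient \<Omega> (f k) (F k)" "open \<Omega>"
  shows "weak_gradient \<Omega> (\<lambda>x. \<Sum>k<n. f k x) (\<lambda>x. \<Sum>k<n. F k x)"
proof (induction n)
  case 0
  then show ?case using weak_gradient_zero[OF assms(2)] by simp
next
  case (Suc n)
  then show ?case using weak_gradient_add[OF Suc assms(1) assms(2)] by simp
qed

context bounded_exponent
begin

lemma sob_chain:
  assumes s: "sob f F" and T: "\<And>t. (T has_real_derivative T' t) (at t)" "continuous_on UNIV T'" "\<And>t. \<bar>T' t\<bar> \<le> M"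
    and le: "\<And>t. \<bar>T t\<bar> \<le> C * \<bar>t\<bar>"
  shows "sob (\<lambda>x. T (f x)) (\<lambda>x. T' (f x) *\<^sub>R F x)"
proof -
  note sD = sobD[OF s]
  note [measurable] = sD(1,2)
  have [measurable]: "T \<in> borel_measurable borel" "T' \<in> borel_measurable borel"
    using T(1,2) by (auto intro!: borel_measurable_continuous_onI continuous_at_imp_continuous_on DERIV_isCont)
  have w: "weak_gradient UNIV (\<lambda>x. T (f x)) (\<lambda>x. T' (f x) *\<^sub>R F x)"
    by (rule weak_gradient_chain[OF sD(5) T])
  have "modular p UNIV (\<lambda>x. T (f x)) < \<infinity>"
    by (rule modular_finite_scale[OF sD(1,3), where C=C]) (use le in auto)
  moreover have "modular p UNIV (\<lambda>x. T' (f x) *\<^sub>R F x) < \<infinity>"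
    by (rule modular_finite_scale[OF sD(2,4), where C=M]) (use T(3) in \<open>simp add: mult_right_mono\<close>)
  moreover have "(\<lambda>x. T (f x)) \<in> borel_measurable lebesgue" "(\<lambda>x. T' (f x) *\<^sub>R F x) \<in> borel_measurable lebesgue"
    by measurable
  ultimately show ?thesis using w by (simp add: sob_def)
qed

lemma sob_hump:
  assumes s: "sob f F"
  shows "sob (\<lambda>x. hump (f x)) (\<lambda>x. hump' (f x) *\<^sub>R F x)"
    "modular p UNIV (\<lambda>x. hump (f x)) \<le> ennreal (4 powr P) * modular p UNIV f"
    "modular p UNIV (\<lambda>x. hump' (f x) *\<^sub>R F x) \<le> ennreal (4 powr P) * modular p UNIV F"
proof -
  note sD = sobD[OF s]
  show "sob (\<lambda>x. hump (f x)) (\<lambda>x. hump' (f x) *\<^sub>R F x)"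
    by (rule sob_chain[OF s hump_facts(1,2,3,5)])
  show "modular p UNIV (\<lambda>x. hump (f x)) \<le> ennreal (4 powr P) * modular p UNIV f"
  proof (rule modular_scale[OF sD(1)], simp, rule AE_I2)
    fix x show "norm (hump (f x)) \<le> 4 * norm (f x)"
      using hump_facts(5)[of "f x"] by simp
  qed
  show "modular p UNIV (\<lambda>x. hump' (f x) *\<^sub>R F x) \<le> ennreal (4 powr P) * modular p UNIV F"
    by (rule modular_scale[OF sD(2)]) (use hump_facts(3) in \<open>auto simp: mult_right_mono\<close>)
qed

text \<open>For the gradients, the weighted estimate is applied to their norms, whose sum is the
  majorant of all partial sums; the weak gradient of the series then comes from
  \<open>weak_gradient_closed\<close>.\<close>

lemma sob_series:
  fixes h :: "nat \<Rightarrow> 'a \<Rightarrow> real"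
  assumes s: "\<And>k. sob (h k) (H k)" and nn: "\<And>k x. h k x \<ge> 0"
    and fin: "(\<Sum>k. ennreal (2 powr (real (Suc k) * P)) * modular p UNIV (h k)) < \<infinity>"
      "(\<Sum>k. ennreal (2 powr (real (Suc k) * P)) * modular p UNIV (H k)) < \<infinity>"
  shows "AE x in lebesgue. summable (\<lambda>k. h k x)"
    "sob (\<lambda>x. \<Sum>k. h k x) (\<lambda>x. \<Sum>k. H k x)"
    "modular p UNIV (\<lambda>x. \<Sum>k. h k x) \<le> (\<Sum>k. ennreal (2 powr (real (Suc k) * P)) * modular p UNIV (h k))"
    "modular p UNIV (\<lambda>x. \<Sum>k. H k x) \<le> (\<Sum>k. ennreal (2 powr (real (Suc k) * P)) * modular p UNIV (H k))"
proof -
  note sD = sobD[OF s]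
  have hm [measurable]: "h k \<in> borel_measurable lebesgue" for k using sD(1) .
  have Hm [measurable]: "H k \<in> borel_measurable lebesgue" for k using sD(2) .
  have sm [measurable]: "(\<lambda>x. \<Sum>k. h k x) \<in> borel_measurable lebesgue" "(\<lambda>x. \<Sum>k. H k x) \<in> borel_measurable lebesgue"
    "(\<lambda>x. \<Sum>k. norm (H k x)) \<in> borel_measurable lebesgue"
    by (intro borel_measurable_suminf hm, intro borel_measurable_suminf Hm, intro borel_measurable_suminf, measurable)
  have eqn: "modular p UNIV (\<lambda>x. norm (H k x)) = modular p UNIV (H k)" for k
    by (simp add: modular_UNIV)
  note h1 = modular_series[of h, OF hm nn fin(1)]
  have nH: "(\<Sum>k. ennreal (2 powr (real (Suc k) * P)) * modular p UNIV (\<lambda>x. norm (H k x))) < \<infinity>"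
    using fin(2) by (simp only: eqn)
  have nHm: "(\<lambda>x. norm (H k x)) \<in> borel_measurable lebesgue" for k by measurable
  note H1 = modular_series[of "\<lambda>k x. norm (H k x)", OF nHm norm_ge_zero nH]
  show summ: "AE x in lebesgue. summable (\<lambda>k. h k x)" by (rule h1(1))
  show hle: "modular p UNIV (\<lambda>x. \<Sum>k. h k x) \<le> (\<Sum>k. ennreal (2 powr (real (Suc k) * P)) * modular p UNIV (h k))"
    by (rule h1(2))
  have "modular p UNIV (\<lambda>x. \<Sum>k. H k x) \<le> modular p UNIV (\<lambda>x. \<Sum>k. norm (H k x))"
  proof (rule modular_mono)
    show "AE x in lebesgue. norm (\<Sum>k. H k x) \<le> norm (\<Sum>k. norm (H k x))"
      using H1(1)
    proof eventually_elim
      case (elim x)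
      have "norm (\<Sum>k. H k x) \<le> (\<Sum>k. norm (H k x))" by (rule summable_norm[OF elim])
      then show ?case by simp
    qed
  qed
  also have "\<dots> \<le> (\<Sum>k. ennreal (2 powr (real (Suc k) * P)) * modular p UNIV (H k))"
    using H1(2) by (simp only: eqn)
  finally show Hle: "modular p UNIV (\<lambda>x. \<Sum>k. H k x) \<le> (\<Sum>k. ennreal (2 powr (real (Suc k) * P)) * modular p UNIV (H k))" .
  have fh: "modular p UNIV (\<lambda>x. \<Sum>k. h k x) < \<infinity>" by (rule le_less_trans[OF hle fin(1)])
  have fH: "modular p UNIV (\<lambda>x. \<Sum>k. H k x) < \<infinity>" by (rule le_less_trans[OF Hle fin(2)])
  have fnH: "modular p UNIV (\<lambda>x. \<Sum>k. norm (H k x)) < \<infinity>" by (rule le_less_trans[OF H1(2) nH])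
  have lh: "locally_integrable UNIV (\<lambda>x. \<Sum>k. h k x)" by (rule modular_locally_integrable[OF sm(1) fh])
  have lH: "locally_integrable UNIV (\<lambda>x. \<Sum>k. H k x)" by (rule modular_locally_integrable[OF sm(2) fH])
  have lnH: "locally_integrable UNIV (\<lambda>x. \<Sum>k. norm (H k x))" by (rule modular_locally_integrable[OF sm(3) fnH])
  have "weak_gradient UNIV (\<lambda>x. \<Sum>k. h k x) (\<lambda>x. \<Sum>k. H k x)"
  proof (rule weak_gradient_closed[OF open_UNIV lh lH])
    fix K :: "'a set" assume K: "compact K" "K \<subseteq> UNIV"
    have "L1_on K (\<lambda>n x. \<Sum>k<n. h k x) (\<lambda>x. \<Sum>k. h k x)"
    proof (rule L1_on_dominated[OF _ _ lh K])
      show "AE x in lebesgue. norm (\<Sum>k<n. h k x) \<le> (\<Sum>k. h k x)" for n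
        using summ
      proof eventually_elim
        case (elim x)
        have "(\<Sum>k<n. h k x) \<le> (\<Sum>k. h k x)" using elim nn by (intro sum_le_suminf) auto
        moreover have "(\<Sum>k<n. h k x) \<ge> 0" using nn by (intro sum_nonneg) auto
        ultimately show ?case by simp
      qed
      show "AE x in lebesgue. x \<in> K \<longrightarrow> (\<lambda>n. \<Sum>k<n. h k x) \<longlonglongrightarrow> (\<Sum>k. h k x)"
        using summ by eventually_elim (simp add: summable_LIMSEQ)
    qed measurable
    moreover have "L1_on K (\<lambda>n x. \<Sum>k<n. H k x) (\<lambda>x. \<Sum>k. H k x)"
    proof (rule L1_on_dominated[OF _ _ lnH K])
      show "AE x in lebesgue. norm (\<Sum>k<n. H k x) \<le> (\<Sum>k. norm (H k x))" for n
        using H1(1)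
      proof eventually_elim
        case (elim x)
        have "norm (\<Sum>k<n. H k x) \<le> (\<Sum>k<n. norm (H k x))" by (rule norm_sum)
        also have "\<dots> \<le> (\<Sum>k. norm (H k x))" using elim by (intro sum_le_suminf) auto
        finally show ?case .
      qed
      show "AE x in lebesgue. x \<in> K \<longrightarrow> (\<lambda>n. \<Sum>k<n. H k x) \<longlonglongrightarrow> (\<Sum>k. H k x)"
        using H1(1) by eventually_elim (simp add: summable_LIMSEQ summable_norm_cancel)
    qed measurable
    ultimately show "\<exists>v G. (\<forall>n::nat. weak_gradient UNIV (v n) (G n)) \<and> L1_on K v (\<lambda>x. \<Sum>k. h k x) \<and> L1_on K G (\<lambda>x. \<Sum>k. H k x)"
      using weak_gradient_sum[of UNIV h H] sD(5)
      by (intro exI[of _ "\<lambda>n x. \<Sum>k<n. h k x"] exI[of _ "\<lambda>n x. \<Sum>k<n. H k x"]) simp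
  qed
  then show "sob (\<lambda>x. \<Sum>k. h k x) (\<lambda>x. \<Sum>k. H k x)"
    using sm(1,2) fh fH by (simp add: sob_def)
qed

lemma energy_eq:
  assumes "sob f F"
  shows "(\<integral>\<^sup>+x. ennreal (\<bar>f x\<bar> powr p x + norm (wgrad UNIV f x) powr p x) \<partial>lebesgue) = modular p UNIV f + modular p UNIV F"
proof -
  note sD = sobD[OF assms]
  note [measurable] = sD(1,2)
  have "(\<integral>\<^sup>+x. ennreal (\<bar>f x\<bar> powr p x + norm (wgrad UNIV f x) powr p x) \<partial>lebesgue)
    = (\<integral>\<^sup>+x. ennreal (norm (f x) powr p x) + ennreal (norm (F x) powr p x) \<partial>lebesgue)"
  proof (rule nn_integral_cong_AE)
    show "AE x in lebesgue. ennreal (\<bar>f x\<bar> powr p x + norm (wgrad UNIV f x) powr p x) = ennreal (norm (f x) powr p x) + ennreal (norm (F x) powr p x)"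
      using wgrad_AE[OF open_UNIV sD(5)] by eventually_elim simp
  qed
  also have "\<dots> = modular p UNIV f + modular p UNIV F"
    unfolding modular_UNIV by (rule nn_integral_add) measurable
  finally show ?thesis .
qed

lemma capacity_le:
  assumes "sob f F" "open V" "E \<subseteq> V" "\<And>x. x \<in> V \<Longrightarrow> f x \<ge> 1"
  shows "capacity p E \<le> modular p UNIV f + modular p UNIV F"
proof -
  have "f \<in> W1p p UNIV" using assms(1) W1p_UNIV_iff by blast
  then show ?thesis
    unfolding capacity_def energy_eq[OF assms(1), symmetric]
    using assms(2,3,4) by (intro INF_lower) blast
qed

lemma capacity_lessE:
  assumes "capacity p E < a"
  obtains f F V where "sob f F" "open V" "E \<subseteq> V" "\<And>x. x \<in> V \<Longrightarrow> f x \<ge> 1" "modular p UNIV f + modular p UNIV F < a"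
proof -
  obtain f V where f: "f \<in> W1p p UNIV" "open V" "E \<subseteq> V" "\<And>x. x \<in> V \<Longrightarrow> f x \<ge> 1"
    "(\<integral>\<^sup>+x. ennreal (\<bar>f x\<bar> powr p x + norm (wgrad UNIV f x) powr p x) \<partial>lebesgue) < a"
    using assms unfolding capacity_def INF_less_iff by blast
  obtain F where F: "sob f F" using f(1) W1p_UNIV_iff by blast
  show ?thesis by (rule that[OF F f(2-4)]) (use f(5) energy_eq[OF F] in auto)
qed

text \<open>Kilpelainen's observation; the admissible function is altered on the null set \<open>V - G\<close>.\<close>

lemma capacity_null_diff:
  assumes "open V" "AE x in lebesgue. x \<in> V \<longrightarrow> x \<in> G"
  shows "capacity p V \<le> capacity p G"
proof (rule dense_ge)
  fix a assume "capacity p G < a"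
  then obtain f F W where f: "sob f F" "open W" "G \<subseteq> W" "\<And>x. x \<in> W \<Longrightarrow> f x \<ge> 1" "modular p UNIV f + modular p UNIV F < a"
    by (rule capacity_lessE) (rule that, assumption+)
  \<comment> \<open>\<open>V\<close> is open and serves as its own neighbourhood. On the part of
    \<open>V\<close> inside \<open>G\<close> the function \<open>f\<close> is at least 1 already, so
    nothing changes there.\<close>
  define g where "g x = (if x \<in> V then max 1 (f x) else f x)" for x
  have fg: "AE x in lebesgue. f x = g x"
    using assms(2) by eventually_elim (use f(3,4) in \<open>force simp: g_def\<close>)
  have "sob g F" by (rule sob_cong_AE[OF f(1) fg]) simp
  then have "capacity p V \<le> modular p UNIV g + modular p UNIV F"
    by (rule capacity_le[OF _ assms(1) order_refl]) (simp add: g_def)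
  also have "\<dots> = modular p UNIV f + modular p UNIV F" using modular_cong_AE[OF fg] by simp
  finally show "capacity p V \<le> a" using f(5) by simp
qed

text \<open>\<open>hump (f k)\<close> is nonnegative and at least 1 on \<open>V k\<close>, so the
  sum of the humps is admissible for the union. The factor 4^P comes from the bounds in
  \<open>sob_hump\<close>, the power of 2 from \<open>sob_series\<close>. The condition is on |f k|,
  so that differences of either sign can be inserted.\<close>

lemma capacity_union:
  assumes s: "\<And>k::nat. sob (f k) (F k)" and V: "\<And>k. open (V k)" "\<And>k x. x \<in> V k \<Longrightarrow> \<bar>f k x\<bar> \<ge> 1"
    and fin: "(\<Sum>k. ennreal (2 powr (real (Suc k) * P) * 4 powr P) * (modular p UNIV (f k) + modular p UNIV (F k))) \<le> c" "c < \<infinity>"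
  shows "capacity p (\<Union>k. V k) \<le> c"
proof -
  define h where "h k x = hump (f k x)" for k x
  define H where "H k x = hump' (f k x) *\<^sub>R F k x" for k x
  have sh: "sob (h k) (H k)" and mh: "modular p UNIV (h k) \<le> ennreal (4 powr P) * modular p UNIV (f k)"
    and mH: "modular p UNIV (H k) \<le> ennreal (4 powr P) * modular p UNIV (F k)" for k
    using sob_hump[OF s] unfolding h_def[abs_def] H_def[abs_def] by blast+
  let ?w = "\<lambda>k. ennreal (2 powr (real (Suc k) * P))"
  have le: "(\<Sum>k. ?w k * modular p UNIV (h k)) + (\<Sum>k. ?w k * modular p UNIV (H k)) \<le> c"
  proof -
    have "(\<Sum>k. ?w k * modular p UNIV (h k)) + (\<Sum>k. ?w k * modular p UNIV (H k)) = (\<Sum>k. ?w k * modular p UNIV (h k) + ?w k * modular p UNIV (H k))"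
      by (rule suminf_add) auto
    also have "\<dots> \<le> (\<Sum>k. ennreal (2 powr (real (Suc k) * P) * 4 powr P) * (modular p UNIV (f k) + modular p UNIV (F k)))"
    proof (intro suminf_le allI)
      fix k
      have "?w k * modular p UNIV (h k) + ?w k * modular p UNIV (H k) = ?w k * (modular p UNIV (h k) + modular p UNIV (H k))"
        by (simp add: distrib_left)
      also have "\<dots> \<le> ?w k * (ennreal (4 powr P) * modular p UNIV (f k) + ennreal (4 powr P) * modular p UNIV (F k))"
        by (intro mult_left_mono add_mono mh mH) auto
      also have "\<dots> = ennreal (2 powr (real (Suc k) * P) * 4 powr P) * (modular p UNIV (f k) + modular p UNIV (F k))"
        by (simp add: ennreal_mult distrib_left mult.assoc)
      finally show "?w k * modular p UNIV (h k) + ?w k * modular p UNIV (H k) \<le> ennreal (2 powr (real (Suc k) * P) * 4 powr P) * (modular p UNIV (f k) + modular p UNIV (F k))" .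
    qed auto
    also have "\<dots> \<le> c" by (rule fin(1))
    finally show ?thesis .
  qed
  then have f1: "(\<Sum>k. ?w k * modular p UNIV (h k)) < \<infinity>" "(\<Sum>k. ?w k * modular p UNIV (H k)) < \<infinity>"
    using fin(2) by (auto simp: less_top[symmetric] top_unique)
  have h0: "h k x \<ge> 0" for k x by (simp add: h_def hump_facts)
  note ser = sob_series[of h H, OF sh h0 f1]
  \<comment> \<open>Where the series diverges its sum is unspecified; the value 1 keeps
    \<open>g\<close> admissible at every point of the union.\<close>
  define g where "g x = (if summable (\<lambda>k. h k x) then \<Sum>k. h k x else 1)" for x
  have sg: "AE x in lebesgue. (\<Sum>k. h k x) = g x"
    using ser(1) by eventually_elim (simp add: g_def)
  have "sob g (\<lambda>x. \<Sum>k. H k x)" by (rule sob_cong_AE[OF ser(2) sg]) simp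
  then have "capacity p (\<Union>k. V k) \<le> modular p UNIV g + modular p UNIV (\<lambda>x. \<Sum>k. H k x)"
  proof (rule capacity_le[OF _ _ order_refl])
    show "open (\<Union>k. V k)" using V by blast
    fix x assume "x \<in> (\<Union>k. V k)"
    then obtain k where k: "x \<in> V k" by blast
    show "g x \<ge> 1"
    proof (cases "summable (\<lambda>k. h k x)")
      case True
      have "1 \<le> h k x" unfolding h_def by (rule hump_facts(6)[OF V(2)[OF k]])
      also have "\<dots> \<le> (\<Sum>k. h k x)" using sum_le_suminf[OF True, of "{k}"] h0 by simp
      finally show ?thesis using True by (simp add: g_def)
    qed (simp add: g_def)
  qed
  also have "modular p UNIV g = modular p UNIV (\<lambda>x. \<Sum>k. h k x)"
    using modular_cong_AE[OF sg] by simp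
  also have "\<dots> + modular p UNIV (\<lambda>x. \<Sum>k. H k x) \<le> (\<Sum>k. ?w k * modular p UNIV (h k)) + (\<Sum>k. ?w k * modular p UNIV (H k))"
    by (intro add_mono ser)
  also note le
  finally show ?thesis .
qed

end

section \<open>Zero extensions\<close>

text \<open>This is \<open>dome\<close> at |x|/(n + 1). Its gradient is of size at most 4/(n + 1),
  so it disappears in the limit when multiplied by a fixed function.\<close>

definition radial :: "nat \<Rightarrow> 'a::euclidean_space \<Rightarrow> real" where
  "radial n x = (max 0 (1 - (x \<bullet> x) / (real (Suc n))\<^sup>2))\<^sup>2"
definition radial_grad :: "nat \<Rightarrow> 'a::euclidean_space \<Rightarrow> 'a" where
  "radial_grad n x = (- (4 / (real (Suc n))\<^sup>2) * max 0 (1 - (x \<bullet> x) / (real (Suc n))\<^sup>2)) *\<^sub>R x"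

lemma radial_continuous: "continuous_on UNIV (radial n)" "continuous_on UNIV (radial_grad n)"
  unfolding radial_def[abs_def] radial_grad_def[abs_def] divide_inverse
  by (intro continuous_intros)+

lemma radial_weak_gradient: "weak_gradient UNIV (radial n) (radial_grad n :: 'a::euclidean_space \<Rightarrow> 'a)"
proof (rule weak_gradient_classical[OF radial_continuous])
  fix x b :: 'a
  let ?k = "(real (Suc n))\<^sup>2"
  have "((\<lambda>t. (x + t *\<^sub>R b) \<bullet> (x + t *\<^sub>R b)) has_real_derivative 2 * (x \<bullet> b)) (at 0)"
  proof -
    have "((\<lambda>t. x \<bullet> x + 2 * t * (x \<bullet> b) + t\<^sup>2 * (b \<bullet> b)) has_real_derivative 2 * (x \<bullet> b)) (at 0)"
      by (auto intro!: derivative_eq_intros)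
    moreover have "(x + t *\<^sub>R b) \<bullet> (x + t *\<^sub>R b) = x \<bullet> x + 2 * t * (x \<bullet> b) + t\<^sup>2 * (b \<bullet> b)" for t
      by (simp add: inner_add_left inner_add_right inner_commute power2_eq_square algebra_simps)
    ultimately show ?thesis by simp
  qed
  from DERIV_diff[OF DERIV_const DERIV_cdivide[OF this, of ?k], of 1]
  have "((\<lambda>t. 1 - (x + t *\<^sub>R b) \<bullet> (x + t *\<^sub>R b) / ?k) has_real_derivative - (2 * (x \<bullet> b) / ?k)) (at 0)"
    by (simp del: of_nat_Suc)
  from DERIV_chain2[OF DERIV_pos_part_square this]
  show "((\<lambda>t. radial n (x + t *\<^sub>R b)) has_real_derivative radial_grad n x \<bullet> b) (at 0)"
    unfolding radial_def radial_grad_def by (simp add: mult_ac del: of_nat_Suc)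
qed simp

lemma radial_facts:
  "0 \<le> radial n x" "radial n x \<le> 1" "norm x \<ge> real (Suc n) \<Longrightarrow> radial n x = 0"
  "norm (radial_grad n x) \<le> 4 / real (Suc n)" "(\<lambda>n. radial n x) \<longlonglongrightarrow> 1"
proof -
  let ?k = "real (Suc n)" and ?m = "max 0 (1 - (x \<bullet> x) / (real (Suc n))\<^sup>2)"
  have k: "?k > 0" by simp
  have m: "0 \<le> ?m" "?m \<le> 1" by (auto simp del: of_nat_Suc)
  show "0 \<le> radial n x" by (simp add: radial_def)
  show "radial n x \<le> 1" unfolding radial_def using m by (intro power_le_one)
  have z: "?m = 0" if "norm x \<ge> ?k"
  proof -
    have "?k\<^sup>2 \<le> (norm x)\<^sup>2" using that by (intro power_mono) auto
    then have "1 \<le> (x \<bullet> x) / ?k\<^sup>2" using k by (simp add: power2_norm_eq_inner del: of_nat_Suc)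
    then show ?thesis by (simp del: of_nat_Suc)
  qed
  then show "norm x \<ge> ?k \<Longrightarrow> radial n x = 0" by (simp add: radial_def del: of_nat_Suc)
  show "norm (radial_grad n x) \<le> 4 / ?k"
  proof (cases "norm x \<ge> ?k")
    case True
    then show ?thesis using z[OF True] unfolding radial_grad_def by simp
  next
    case False
    have "norm (radial_grad n x) = 4 / ?k\<^sup>2 * ?m * norm x"
      unfolding radial_grad_def using m(1) by (simp add: abs_mult del: of_nat_Suc)
    also have "\<dots> \<le> 4 / ?k\<^sup>2 * 1 * ?k"
      using m False by (intro mult_mono) auto
    also have "\<dots> = 4 / ?k" by (simp add: power2_eq_square del: of_nat_Suc)
    finally show ?thesis .
  qed
  have "(\<lambda>n. (max 0 (1 - (x \<bullet> x) * (1 / real (Suc n))\<^sup>2))\<^sup>2) \<longlonglongrightarrow> (max 0 (1 - (x \<bullet> x) * 0\<^sup>2))\<^sup>2"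
    using LIMSEQ_Suc[OF lim_1_over_n] by (intro tendsto_intros)
  then show "(\<lambda>n. radial n x) \<longlonglongrightarrow> 1" by (simp add: radial_def power_divide del: of_nat_Suc)
qed

section \<open>Cutoffs and their convergence\<close>

context bounded_exponent
begin

definition cutoff :: "nat \<Rightarrow> ('a \<Rightarrow> real) \<Rightarrow> ('a \<Rightarrow> real) \<Rightarrow> 'a \<Rightarrow> real" where
  "cutoff n v f x = trunc n (v x) * dome (f x) * radial n x"
definition cutoff_grad :: "nat \<Rightarrow> ('a \<Rightarrow> real) \<Rightarrow> ('a \<Rightarrow> 'a) \<Rightarrow> ('a \<Rightarrow> real) \<Rightarrow> ('a \<Rightarrow> 'a) \<Rightarrow> 'a \<Rightarrow> 'a" where
  "cutoff_grad n v W f F x = (trunc n (v x) * dome (f x)) *\<^sub>R radial_grad n x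
     + radial n x *\<^sub>R (trunc n (v x) *\<^sub>R (dome' (f x) *\<^sub>R F x) + dome (f x) *\<^sub>R (trunc' n (v x) *\<^sub>R W x))"

lemma cutoff_le: "\<bar>cutoff n v f x\<bar> \<le> \<bar>v x\<bar>"
proof -
  have "\<bar>trunc n (v x)\<bar> * \<bar>dome (f x)\<bar> * \<bar>radial n x\<bar> \<le> \<bar>v x\<bar> * 1 * 1"
    using trunc_le dome_facts(3,4)[of "f x"] radial_facts(1,2)[of n x] by (intro mult_mono) auto
  then show ?thesis by (simp add: cutoff_def abs_mult)
qed

text \<open>The subtracted term is the only one containing \<open>W\<close>. The gradient of the
  radial factor costs (4/k) |v| with k = n + 1, and the derivative of \<open>dome\<close> costs 4 k
  |F|, since \<open>trunc n\<close> is bounded by k only. The second cost grows and has to be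
  outweighed by the smallness of \<open>F\<close>.\<close>

lemma cutoff_grad_le:
  "norm (cutoff_grad n v W f F x - (radial n x * dome (f x) * trunc' n (v x)) *\<^sub>R W x)
    \<le> 4 / real (Suc n) * norm (v x) + 4 * real (Suc n) * norm (F x)"
proof -
  have eq: "cutoff_grad n v W f F x - (radial n x * dome (f x) * trunc' n (v x)) *\<^sub>R W x
    = (trunc n (v x) * dome (f x)) *\<^sub>R radial_grad n x + (radial n x * trunc n (v x) * dome' (f x)) *\<^sub>R F x"
    by (simp add: cutoff_grad_def algebra_simps)
  have "norm ((trunc n (v x) * dome (f x)) *\<^sub>R radial_grad n x) = \<bar>trunc n (v x)\<bar> * \<bar>dome (f x)\<bar> * norm (radial_grad n x)"
    by (simp add: abs_mult)
  also have "\<dots> \<le> \<bar>v x\<bar> * 1 * (4 / real (Suc n))"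
    using trunc_le dome_facts(3,4)[of "f x"] radial_facts(4)[of n x] by (intro mult_mono) auto
  finally have 1: "norm ((trunc n (v x) * dome (f x)) *\<^sub>R radial_grad n x) \<le> 4 / real (Suc n) * norm (v x)"
    by (simp add: mult.commute)
  have "norm ((radial n x * trunc n (v x) * dome' (f x)) *\<^sub>R F x) = \<bar>radial n x\<bar> * \<bar>trunc n (v x)\<bar> * \<bar>dome' (f x)\<bar> * norm (F x)"
    by (simp add: abs_mult)
  also have "\<dots> \<le> 1 * real (Suc n) * 4 * norm (F x)"
    using trunc_bounded dome_facts(2)[of "f x"] radial_facts(1,2)[of n x]
    by (intro mult_mono mult_nonneg_nonneg) (auto simp del: of_nat_Suc)
  finally have 2: "norm ((radial n x * trunc n (v x) * dome' (f x)) *\<^sub>R F x) \<le> 4 * real (Suc n) * norm (F x)"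
    by (simp add: mult_ac)
  show ?thesis unfolding eq using norm_triangle_mono[OF 1 2] .
qed

lemma cutoff_weak_gradient:
  assumes v: "weak_gradient UNIV v W" and f: "weak_gradient UNIV f F"
  shows "weak_gradient UNIV (cutoff n v f) (cutoff_grad n v W f F)"
proof -
  have 1: "weak_gradient UNIV (\<lambda>x. trunc n (v x)) (\<lambda>x. trunc' n (v x) *\<^sub>R W x)"
    by (rule weak_gradient_chain[OF v trunc_DERIV trunc_cont trunc'_bounded])
  have 2: "weak_gradient UNIV (\<lambda>x. dome (f x)) (\<lambda>x. dome' (f x) *\<^sub>R F x)"
    by (rule weak_gradient_chain[OF f dome_DERIV dome_facts(1,2)])
  have bc: "\<bar>dome t\<bar> \<le> 1" for t using dome_facts(3,4)[of t] by simp
  have br: "\<bar>radial n x\<bar> \<le> 1" for x :: 'a using radial_facts(1,2)[of n x] by simp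
  have 3: "weak_gradient UNIV (\<lambda>x. trunc n (v x) * dome (f x))
     (\<lambda>x. trunc n (v x) *\<^sub>R (dome' (f x) *\<^sub>R F x) + dome (f x) *\<^sub>R (trunc' n (v x) *\<^sub>R W x))"
    by (rule weak_gradient_product[OF 1 2 trunc_bounded bc])
  have b3: "\<bar>trunc n (v x) * dome (f x)\<bar> \<le> real (Suc n) * 1" for x
    unfolding abs_mult using trunc_bounded bc by (intro mult_mono) auto
  show ?thesis
    unfolding cutoff_def[abs_def] cutoff_grad_def[abs_def]
    by (rule weak_gradient_product[OF 3 radial_weak_gradient b3 br])
qed

lemma cutoff_measurable:
  assumes [measurable]: "v \<in> borel_measurable lebesgue" "W \<in> borel_measurable lebesgue" "f \<in> borel_measurable lebesgue" "F \<in> borel_measurable lebesgue"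
  shows "cutoff n v f \<in> borel_measurable lebesgue" "cutoff_grad n v W f F \<in> borel_measurable lebesgue"
    "(\<lambda>x. (radial n x * dome (f x) * trunc' n (v x)) *\<^sub>R W x) \<in> borel_measurable lebesgue"
proof -
  have [measurable]: "dome \<in> borel_measurable borel" "dome' \<in> borel_measurable borel"
    "trunc n \<in> borel_measurable borel" "trunc' n \<in> borel_measurable borel"
  proof -
    have "continuous_on UNIV dome"
      using dome_DERIV by (meson DERIV_isCont continuous_at_imp_continuous_on)
    then show "dome \<in> borel_measurable borel" "dome' \<in> borel_measurable borel"
      "trunc n \<in> borel_measurable borel" "trunc' n \<in> borel_measurable borel"
      using dome_facts(1) trunc_continuous trunc_cont by (blast intro: borel_measurable_continuous_onI)+
  qed
  have [measurable]: "(radial n :: 'a \<Rightarrow> real) \<in> borel_measurable lebesgue" "(radial_grad n :: 'a \<Rightarrow> 'a) \<in> borel_measurable lebesgue"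
    using continuous_lebesgue_measurable radial_continuous by blast+
  show "cutoff n v f \<in> borel_measurable lebesgue" "cutoff_grad n v W f F \<in> borel_measurable lebesgue"
    "(\<lambda>x. (radial n x * dome (f x) * trunc' n (v x)) *\<^sub>R W x) \<in> borel_measurable lebesgue"
    unfolding cutoff_def[abs_def] cutoff_grad_def[abs_def] by measurable
qed

lemma sob_cutoff:
  assumes v: "sob v W" and f: "sob f F"
  shows "sob (cutoff n v f) (cutoff_grad n v W f F)"
proof -
  note vD = sobD[OF v] and fD = sobD[OF f]
  note [measurable] = vD(1,2) fD(1,2)
  note m = cutoff_measurable[OF vD(1,2) fD(1,2), of n]
  have "modular p UNIV (cutoff n v f) < \<infinity>"
    by (rule modular_finite_scale[OF vD(1,3), where C=1]) (use cutoff_le in auto)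
  moreover have "modular p UNIV (cutoff_grad n v W f F) < \<infinity>"
  proof -
    let ?a = "\<lambda>x. 4 / real (Suc n) * norm (v x) + 4 * real (Suc n) * norm (F x)"
    have 1: "modular p UNIV (\<lambda>x. 4 / real (Suc n) * norm (v x)) < \<infinity>"
      by (rule modular_finite_scale[OF vD(1,3), where C="4 / real (Suc n)"]) (simp del: of_nat_Suc)
    have 2: "modular p UNIV (\<lambda>x. 4 * real (Suc n) * norm (F x)) < \<infinity>"
      by (rule modular_finite_scale[OF fD(2,4), where C="4 * real (Suc n)"]) (simp del: of_nat_Suc)
    have 3: "modular p UNIV ?a < \<infinity>"
      by (rule modular_finite_sum[OF _ _ 1 2]) (auto simp del: of_nat_Suc)
    have 4: "modular p UNIV (\<lambda>x. 11 * norm (W x)) < \<infinity>"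
      by (rule modular_finite_scale[OF vD(2,4), where C=11]) simp
    show ?thesis
    proof (rule modular_finite_sum[OF _ _ 3 4])
      show "AE x in lebesgue. norm (cutoff_grad n v W f F x) \<le> norm (?a x) + norm (11 * norm (W x))"
      proof (rule AE_I2)
        fix x
        let ?w = "(radial n x * dome (f x) * trunc' n (v x)) *\<^sub>R W x"
        have "\<bar>radial n x\<bar> * \<bar>dome (f x)\<bar> * \<bar>trunc' n (v x)\<bar> * norm (W x) \<le> 1 * 1 * 11 * norm (W x)"
          using trunc'_bounded dome_facts(3,4)[of "f x"] radial_facts(1,2)[of n x] by (intro mult_mono mult_nonneg_nonneg) auto
        then have "norm ?w \<le> 11 * norm (W x)" by (simp add: abs_mult)
        then show "norm (cutoff_grad n v W f F x) \<le> norm (?a x) + norm (11 * norm (W x))"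
          using cutoff_grad_le[of n v W f F x] norm_triangle_sub[of "cutoff_grad n v W f F x" ?w]
            abs_ge_self[of "?a x"] by (simp del: of_nat_Suc)
      qed
    qed measurable
  qed
  ultimately show ?thesis
    using m cutoff_weak_gradient[OF vD(5) fD(5)] by (simp add: sob_def)
qed

text \<open>The factor (4 k)^(-P) in the assumption, with k = n + 1, pays for the coefficient 4 k of
  |F| found in \<open>cutoff_grad_le\<close>. The factor 2^(-n) makes the modulars summable, so that
  \<open>f n\<close> tends to 0 and \<open>dome (f n)\<close> to 1 almost everywhere. Where
  \<open>v\<close> is 0 the slopes \<open>trunc'\<close> tend to no useful limit, but
  \<open>W\<close> is 0 there.\<close>

lemma cutoff_converges:
  assumes v: "sob v W" and f: "\<And>n. sob (f n) (F n)"
    and small: "\<And>n. modular p UNIV (f n) + modular p UNIV (F n) \<le> ennreal ((4 * real (Suc n)) powr (- P) * (1/2) ^ n)"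
  shows "(\<lambda>n. modular p UNIV (\<lambda>x. cutoff n v (f n) x - v x)) \<longlonglongrightarrow> 0"
    "(\<lambda>n. modular p UNIV (\<lambda>x. cutoff_grad n v W (f n) (F n) x - W x)) \<longlonglongrightarrow> 0"
proof -
  note vD = sobD[OF v] and fD = sobD[OF f]
  note [measurable] = vD(1,2) fD(1,2)
  note m = cutoff_measurable[OF vD(1,2) fD(1,2)]
  have geo: "(\<Sum>n. ennreal ((1/2) ^ n)) < \<infinity>"
    using summable_geometric[of "1/2::real"] by (subst suminf_ennreal2) auto
  have "(4 * real (Suc n)) powr (- P) \<le> 1" for n
    using P_ge powr_mono[of "- P" 0 "4 * real (Suc n)"] by simp
  then have "ennreal ((4 * real (Suc n)) powr (- P) * (1/2) ^ n) \<le> ennreal ((1/2) ^ n)" for n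
    by (intro ennreal_leI mult_left_le_one_le) auto
  then have le: "modular p UNIV (f n) + modular p UNIV (F n) \<le> ennreal ((1/2) ^ n)" for n
    using small order_trans by blast
  have "modular p UNIV (f n) \<le> ennreal ((1/2) ^ n)" for n
    using le[of n] by (meson add_increasing2 order_refl order_trans zero_le)
  then have "(\<Sum>n. modular p UNIV (f n)) \<le> (\<Sum>n. ennreal ((1/2) ^ n))"
    by (intro suminf_le) auto
  then have f0: "AE x in lebesgue. (\<lambda>n. f n x) \<longlonglongrightarrow> 0"
    by (intro modular_summable_tendsto fD le_less_trans[OF _ geo])
  have cc: "isCont dome t" for t using dome_DERIV by (rule DERIV_isCont)
  have dome1: "AE x in lebesgue. (\<lambda>n. dome (f n x)) \<longlonglongrightarrow> 1"
    using f0 by eventually_elim (use isCont_tendsto_compose[OF cc[of 0]] dome_facts(6) in fastforce)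
  show "(\<lambda>n. modular p UNIV (\<lambda>x. cutoff n v (f n) x - v x)) \<longlonglongrightarrow> 0"
  proof (rule modular_dominated[where w="\<lambda>x. 2 * v x", OF m(1)])
    show "AE x in lebesgue. norm (cutoff n v (f n) x - v x) \<le> norm (2 * v x)" for n
    proof (rule AE_I2)
      fix x show "norm (cutoff n v (f n) x - v x) \<le> norm (2 * v x)"
        using cutoff_le[of n v "f n" x] by simp
    qed
    show "modular p UNIV (\<lambda>x. 2 * v x) < \<infinity>"
      by (rule modular_finite_scale[OF vD(1,3), where C=2]) (simp add: abs_mult)
    show "AE x in lebesgue. (\<lambda>n. cutoff n v (f n) x) \<longlonglongrightarrow> v x"
      using dome1
    proof eventually_elim
      case (elim x)
      have "(\<lambda>n. trunc n (v x) * dome (f n x) * radial n x) \<longlonglongrightarrow> v x * 1 * 1"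
        by (intro tendsto_mult trunc_tendsto elim radial_facts)
      then show ?case by (simp add: cutoff_def)
    qed
  qed measurable
  define B where "B n x = (radial n x * dome (f n x) * trunc' n (v x)) *\<^sub>R W x" for n x
  have Bm [measurable]: "B n \<in> borel_measurable lebesgue" for n
    unfolding B_def[abs_def] by (rule m(3))
  have B1: "norm (B n x) \<le> 11 * norm (W x)" for n x
  proof -
    have "\<bar>radial n x\<bar> * \<bar>dome (f n x)\<bar> * \<bar>trunc' n (v x)\<bar> * norm (W x) \<le> 1 * 1 * 11 * norm (W x)"
      using trunc'_bounded dome_facts(3,4)[of "f n x"] radial_facts(1,2)[of n x] by (intro mult_mono mult_nonneg_nonneg) auto
    then show ?thesis by (simp add: abs_mult B_def)
  qed
  have cB: "(\<lambda>n. modular p UNIV (\<lambda>x. B n x - W x)) \<longlonglongrightarrow> 0"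
  proof (rule modular_dominated[where w="\<lambda>x. 12 *\<^sub>R W x", OF Bm])
    show "AE x in lebesgue. norm (B n x - W x) \<le> norm (12 *\<^sub>R W x)" for n
    proof (rule AE_I2)
      fix x show "norm (B n x - W x) \<le> norm (12 *\<^sub>R W x)"
        using norm_triangle_ineq4[of "B n x" "W x"] B1[of n x] by simp
    qed
    show "modular p UNIV (\<lambda>x. 12 *\<^sub>R W x) < \<infinity>"
      by (rule modular_finite_scale[OF vD(2,4), where C=12]) simp
    show "AE x in lebesgue. (\<lambda>n. B n x) \<longlonglongrightarrow> W x"
      using dome1 weak_gradient_zero_set[OF vD(5)]
    proof eventually_elim
      case (elim x)
      show ?case
      proof (cases "v x = 0")
        case False
        have "(\<lambda>n. (radial n x * dome (f n x) * trunc' n (v x)) *\<^sub>R W x) \<longlonglongrightarrow> (1 * 1 * 1) *\<^sub>R W x"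
          by (intro tendsto_intros elim(1) radial_facts trunc'_tendsto False)
        then show ?thesis by (simp add: B_def)
      qed (use elim in \<open>simp add: B_def\<close>)
    qed
  qed measurable
  have c1: "(\<lambda>n. modular p UNIV (\<lambda>x. 4 / real (Suc n) * norm (v x) - 0)) \<longlonglongrightarrow> 0"
  proof (rule modular_dominated[where w="\<lambda>x. 4 * v x"])
    show "AE x in lebesgue. norm (4 / real (Suc n) * norm (v x) - 0) \<le> norm (4 * v x)" for n
    proof (rule AE_I2)
      fix x
      have "4 / real (Suc n) * \<bar>v x\<bar> \<le> 4 * \<bar>v x\<bar>" by (intro mult_right_mono) (auto simp: divide_le_eq)
      then show "norm (4 / real (Suc n) * norm (v x) - 0) \<le> norm (4 * v x)"
        by (simp add: abs_mult del: of_nat_Suc)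
    qed
    show "modular p UNIV (\<lambda>x. 4 * v x) < \<infinity>"
      by (rule modular_finite_scale[OF vD(1,3), where C=4]) (simp add: abs_mult)
    show "AE x in lebesgue. (\<lambda>n. 4 / real (Suc n) * norm (v x)) \<longlonglongrightarrow> 0"
    proof (rule AE_I2)
      fix x
      have "(\<lambda>n. 4 * (1 / real (Suc n)) * norm (v x)) \<longlonglongrightarrow> 4 * 0 * norm (v x)"
        using LIMSEQ_Suc[OF lim_1_over_n] by (intro tendsto_intros)
      then show "(\<lambda>n. 4 / real (Suc n) * norm (v x)) \<longlonglongrightarrow> 0" by simp
    qed
  qed measurable
  have c2: "(\<lambda>n. modular p UNIV (\<lambda>x. 4 * real (Suc n) * norm (F n x))) \<longlonglongrightarrow> 0"
  proof (rule ennreal_tendsto_0_le[OF half_power_tendsto_0])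
    fix n
    have "modular p UNIV (\<lambda>x. 4 * real (Suc n) * norm (F n x)) \<le> ennreal ((4 * real (Suc n)) powr P) * modular p UNIV (F n)"
      by (rule modular_scale[OF fD(2)]) (auto simp: abs_mult)
    also have "\<dots> \<le> ennreal ((4 * real (Suc n)) powr P) * ennreal ((4 * real (Suc n)) powr (- P) * (1/2) ^ n)"
      using small[of n] by (intro mult_left_mono) (auto intro: order_trans[rotated] add_increasing)
    also have "\<dots> = ennreal ((4 * real (Suc n)) powr P * (4 * real (Suc n)) powr (- P) * (1/2) ^ n)"
      by (simp add: ennreal_mult[symmetric] mult.assoc del: of_nat_Suc)
    also have "(4 * real (Suc n)) powr P * (4 * real (Suc n)) powr (- P) = 1"
      by (simp add: powr_add[symmetric] del: of_nat_Suc)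
    finally show "modular p UNIV (\<lambda>x. 4 * real (Suc n) * norm (F n x)) \<le> ennreal ((1/2) ^ n)" by simp
  qed
  let ?S = "\<lambda>n. ennreal (2 powr P) * (modular p UNIV (\<lambda>x. 4 / real (Suc n) * norm (v x)) + modular p UNIV (\<lambda>x. 4 * real (Suc n) * norm (F n x)))"
  have cS: "?S \<longlonglongrightarrow> 0"
    using ennreal_tendsto_cmult[OF _ tendsto_add[OF c1 c2], of "ennreal (2 powr P)"] by simp
  have cD: "(\<lambda>n. modular p UNIV (\<lambda>x. cutoff_grad n v W (f n) (F n) x - B n x)) \<longlonglongrightarrow> 0"
  proof (rule ennreal_tendsto_0_le[OF cS])
    fix n
    show "modular p UNIV (\<lambda>x. cutoff_grad n v W (f n) (F n) x - B n x) \<le> ?S n"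
    proof (rule modular_sum)
      show "AE x in lebesgue. norm (cutoff_grad n v W (f n) (F n) x - B n x) \<le>
          norm (4 / real (Suc n) * norm (v x)) + norm (4 * real (Suc n) * norm (F n x))"
        using cutoff_grad_le[of n v W "f n" "F n"] unfolding B_def by (intro AE_I2) (simp del: of_nat_Suc)
    qed measurable
  qed
  let ?R = "\<lambda>n. ennreal (2 powr P) * (modular p UNIV (\<lambda>x. cutoff_grad n v W (f n) (F n) x - B n x) + modular p UNIV (\<lambda>x. B n x - W x))"
  have cR: "?R \<longlonglongrightarrow> 0"
    using ennreal_tendsto_cmult[OF _ tendsto_add[OF cD cB], of "ennreal (2 powr P)"] by simp
  note [measurable] = m(2)
  show "(\<lambda>n. modular p UNIV (\<lambda>x. cutoff_grad n v W (f n) (F n) x - W x)) \<longlonglongrightarrow> 0"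
  proof (rule ennreal_tendsto_0_le[OF cR])
    fix n
    show "modular p UNIV (\<lambda>x. cutoff_grad n v W (f n) (F n) x - W x) \<le> ?R n"
    proof (rule modular_sum)
      show "AE x in lebesgue. norm (cutoff_grad n v W (f n) (F n) x - W x) \<le>
          norm (cutoff_grad n v W (f n) (F n) x - B n x) + norm (B n x - W x)"
        by (intro AE_I2) (metis diff_add_cancel add_diff_eq norm_triangle_ineq)
    qed measurable
  qed
qed

end

section \<open>From the quasicontinuous zero extension to the closure of compactly supported
  functions\<close>

lemma modular_minus_commute: "modular p UNIV (\<lambda>x. f x - g x) = modular p UNIV (\<lambda>x. g x - f x)"
  unfolding modular_UNIV by (subst norm_minus_commute) (rule refl)

context bounded_exponent
begin

lemma Lp_norm_cong_AE:
  assumes "AE x in lebesgue. f x = g x"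
  shows "Lp_norm p UNIV f = Lp_norm p UNIV g"
proof -
  have "modular p UNIV (\<lambda>x. f x /\<^sub>R c) = modular p UNIV (\<lambda>x. g x /\<^sub>R c)" for c
    by (rule modular_cong_AE) (use assms in eventually_elim, simp)
  then show ?thesis by (simp add: Lp_norm_def)
qed

lemma Lp_norm_restrict_le:
  fixes f :: "'a \<Rightarrow> 'b::euclidean_space"
  assumes "\<Omega> \<in> sets lebesgue" "f \<in> borel_measurable lebesgue" "0 < e" "e \<le> 1" "modular p UNIV f \<le> ennreal (e powr P)"
  shows "Lp_norm p \<Omega> f \<le> ennreal e"
  unfolding Lp_norm_extend[OF assms(1)]
proof (rule modular_imp_Lp_norm_le[OF _ assms(3,4)])
  show "(\<lambda>x. if x \<in> \<Omega> then f x else 0) \<in> borel_measurable lebesgue"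
    using assms(1,2) by measurable
  have "modular p UNIV (\<lambda>x. if x \<in> \<Omega> then f x else 0) \<le> modular p UNIV f"
    by (rule modular_mono) simp
  then show "modular p UNIV (\<lambda>x. if x \<in> \<Omega> then f x else 0) \<le> ennreal (e powr P)"
    using assms(5) by (rule order_trans)
qed

lemma Lp_norm_AE_on:
  assumes "\<Omega> \<in> sets lebesgue" "AE x in lebesgue. x \<in> \<Omega> \<longrightarrow> f x = g x"
  shows "Lp_norm p \<Omega> f = Lp_norm p \<Omega> g"
  unfolding Lp_norm_extend[OF assms(1)]
  by (rule Lp_norm_cong_AE) (use assms(2) in eventually_elim, simp)

lemma sob_imp_W1p:
  assumes "sob v W" "open \<Omega>"
  shows "v \<in> W1p p \<Omega>"
proof -
  note vD = sobD[OF assms(1)]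
  have [measurable]: "\<Omega> \<in> sets lebesgue" using assms(2) by simp
  note [measurable] = vD(1,2)
  have "v \<in> Lp_space p \<Omega>"
    unfolding Lp_space_iff[OF \<open>\<Omega> \<in> sets lebesgue\<close>]
    by (intro conjI modular_finite_scale[OF vD(1,3), where C=1]) auto
  moreover have "W \<in> Lp_space p \<Omega>"
    unfolding Lp_space_iff[OF \<open>\<Omega> \<in> sets lebesgue\<close>]
    by (intro conjI modular_finite_scale[OF vD(2,4), where C=1]) auto
  moreover have "weak_gradient \<Omega> v W"
    by (rule weak_gradient_restrict[OF vD(5) open_UNIV assms(2)]) simp
  ultimately show ?thesis by (auto simp: W1p_def)
qed

lemma W1p_norm_le:
  assumes "sob d D" "open \<Omega>" "0 < e" "e \<le> 1"
    "modular p UNIV d \<le> ennreal (e powr P)" "modular p UNIV D \<le> ennreal (e powr P)"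
  shows "W1p_norm p \<Omega> d \<le> ennreal e + ennreal e"
proof -
  note dD = sobD[OF assms(1)]
  have \<Omega>: "\<Omega> \<in> sets lebesgue" using assms(2) by simp
  have "weak_gradient \<Omega> d D"
    by (rule weak_gradient_restrict[OF dD(5) open_UNIV assms(2)]) simp
  then have "Lp_norm p \<Omega> (wgrad \<Omega> d) = Lp_norm p \<Omega> D"
    by (intro Lp_norm_AE_on \<Omega> wgrad_AE assms(2))
  then show ?thesis
    unfolding W1p_norm_def
    using Lp_norm_restrict_le[OF \<Omega> dD(1) assms(3-5)] Lp_norm_restrict_le[OF \<Omega> dD(2) assms(3,4,6)]
    by (simp add: add_mono)
qed

text \<open>Quasicontinuity is used for the supports: off \<open>U n\<close> the function is
  continuous, which makes the sets carrying the cutoffs compact. They lie in \<Omega> because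
  \<open>v\<close> vanishes off \<Omega> at every point.\<close>

lemma zero_extension_in_W1p_0:
  fixes u :: "'a \<Rightarrow> ereal"
  assumes "open \<Omega>" and z: "\<And>x. x \<notin> \<Omega> \<Longrightarrow> u x = 0" and qc: "quasicontinuous_in p UNIV u"
    and w: "w \<in> W1p p UNIV" "AE x in lebesgue. u x = ereal (w x)"
  shows "(\<lambda>x. real_of_ereal (u x)) \<in> W1p_0 p \<Omega>"
proof -
  define v where "v x = real_of_ereal (u x)" for x
  have wv: "AE x in lebesgue. w x = v x"
    using w(2) by eventually_elim (simp add: v_def)
  obtain W where "sob w W" using w(1) W1p_UNIV_iff by blast
  then have v: "sob v W" by (rule sob_cong_AE[OF _ wv]) simp
  note vD = sobD[OF v]
  have vz: "v x = 0" if "x \<notin> \<Omega>" for x using z[OF that] by (simp add: v_def)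
  \<comment> \<open>The capacity bound is chosen to match the smallness assumption of
    \<open>cutoff_converges\<close>.\<close>
  define c where "c n = (4 * real (Suc n)) powr (- P) * (1/2) ^ n" for n
  have c0: "c n > 0" for n by (simp add: c_def del: of_nat_Suc)
  have "\<exists>U f F V. open U \<and> (\<forall>x \<in> UNIV - U. \<bar>u x\<bar> \<noteq> \<infinity>) \<and> continuous_on (UNIV - U) u \<and>
     sob f F \<and> open V \<and> U \<subseteq> V \<and> (\<forall>x\<in>V. f x \<ge> 1) \<and> modular p UNIV f + modular p UNIV F < ennreal (c n)" for n
  proof -
    obtain U where U: "open U" "capacity p U < ennreal (c n)" "\<forall>x \<in> UNIV - U. \<bar>u x\<bar> \<noteq> \<infinity>" "continuous_on (UNIV - U) u"
      using qc c0[of n] unfolding quasicontinuous_in_def by blast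
    obtain f F V where "sob f F" "open V" "U \<subseteq> V" "\<And>x. x \<in> V \<Longrightarrow> f x \<ge> 1" "modular p UNIV f + modular p UNIV F < ennreal (c n)"
      by (rule capacity_lessE[OF U(2)]) (rule that, assumption+)
    with U show ?thesis by blast
  qed
  then obtain U f F V where U: "\<And>n. open (U n)" "\<And>n x. x \<notin> U n \<Longrightarrow> \<bar>u x\<bar> \<noteq> \<infinity>" "\<And>n. continuous_on (UNIV - U n) u"
    and f: "\<And>n. sob (f n) (F n)" "\<And>n. U n \<subseteq> V n" "\<And>n x. x \<in> V n \<Longrightarrow> f n x \<ge> 1"
      "\<And>n. modular p UNIV (f n) + modular p UNIV (F n) < ennreal (c n)"
    by (metis DiffI UNIV_I)
  have sm: "modular p UNIV (f n) + modular p UNIV (F n) \<le> ennreal ((4 * real (Suc n)) powr (- P) * (1/2) ^ n)" for n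
    using f(4)[of n] unfolding c_def by (rule less_imp_le)
  note conv = cutoff_converges[OF v f(1) sm]
  note sc = sob_cutoff[OF v f(1)]
  have supp: "compactly_supported_in (cutoff n v (f n)) \<Omega>" for n
  proof -
    \<comment> \<open>The condition |v| \<ge> 1/(n + 1) is closed relative to the complement of
      \<open>U n\<close>, so the closure of the set where the cutoff is nonzero stays in
      \<open>C\<close> and cannot reach a zero of \<open>v\<close>.\<close>
    define C where "C = {x \<in> UNIV - U n. v x \<in> - ball 0 (1 / real (Suc n))} \<inter> cball 0 (real (Suc n))"
    have "continuous_on (UNIV - U n) (real_of_ereal \<circ> u)"
    proof (rule iffD1[OF continuous_on_iff_real U(3)])
      show "\<bar>u x\<bar> \<noteq> \<infinity>" if "x \<in> UNIV - U n" for x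
        by (rule U(2)[of x n]) (use that in simp)
    qed
    then have "continuous_on (UNIV - U n) v" by (simp add: v_def[abs_def] comp_def)
    then have "closed {x \<in> UNIV - U n. v x \<in> - ball 0 (1 / real (Suc n))}"
      using U(1)[of n] by (intro continuous_closed_preimage[unfolded vimage_def Int_def mem_Collect_eq]) (auto simp: closed_def)
    then have C: "compact C" unfolding C_def by (intro closed_Int_compact) auto
    have sub: "{x. cutoff n v (f n) x \<noteq> 0} \<subseteq> C"
    proof
      fix x assume "x \<in> {x. cutoff n v (f n) x \<noteq> 0}"
      then have nz: "trunc n (v x) \<noteq> 0" "dome (f n x) \<noteq> 0" "radial n x \<noteq> 0" by (auto simp: cutoff_def)
      have "\<bar>v x\<bar> > 1 / real (Suc n)" using trunc_zero nz(1) by (meson not_le)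
      moreover have "x \<notin> U n"
      proof
        assume "x \<in> U n"
        then have "f n x \<ge> 1" using f(2,3) by blast
        then show False using dome_facts(5)[of "f n x"] nz(2) by simp
      qed
      moreover have "norm x \<le> real (Suc n)" using radial_facts(3)[of n x] nz(3) by linarith
      ultimately show "x \<in> C" by (simp add: C_def del: of_nat_Suc)
    qed
    then have cl: "closure {x. cutoff n v (f n) x \<noteq> 0} \<subseteq> C"
      using C by (simp add: closure_minimal compact_imp_closed)
    then have "compact (closure {x. cutoff n v (f n) x \<noteq> 0})"
      using C by (meson bounded_subset closed_closure compact_eq_bounded_closed)
    moreover have "C \<subseteq> \<Omega>"
    proof
      fix x assume "x \<in> C"
      then have "v x \<noteq> 0" by (auto simp: C_def simp del: of_nat_Suc)
      then show "x \<in> \<Omega>" using vz by blast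
    qed
    ultimately show ?thesis using cl by (simp add: compactly_supported_in_def)
  qed
  have "v \<in> W1p_0 p \<Omega>"
    unfolding W1p_0_def
  proof (intro CollectI conjI allI impI)
    show "v \<in> W1p p \<Omega>" by (rule sob_imp_W1p[OF v assms(1)])
    fix e :: real assume "e > 0"
    \<comment> \<open>One \<open>d\<close> is spent on the function and one on the gradient; thirds
      leave a strict inequality.\<close>
    define d where "d = min 1 (e / 3)"
    have d: "0 < d" "d \<le> 1" "d + d < e" using \<open>e > 0\<close> by (auto simp: d_def min_def)
    have dP: "d powr P > 0" using d by simp
    from eventually_conj[OF ennreal_tendsto_0D[OF conv(1) dP] ennreal_tendsto_0D[OF conv(2) dP]]
    obtain n where n: "modular p UNIV (\<lambda>x. cutoff n v (f n) x - v x) < ennreal (d powr P)"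
      "modular p UNIV (\<lambda>x. cutoff_grad n v W (f n) (F n) x - W x) < ennreal (d powr P)"
      by (auto simp: eventually_sequentially)
    have "modular p UNIV (\<lambda>x. v x - cutoff n v (f n) x) \<le> ennreal (d powr P)"
      "modular p UNIV (\<lambda>x. W x - cutoff_grad n v W (f n) (F n) x) \<le> ennreal (d powr P)"
      using n modular_minus_commute[of p v "cutoff n v (f n)"] modular_minus_commute[of p W "cutoff_grad n v W (f n) (F n)"]
      by (simp_all only: less_imp_le)
    from W1p_norm_le[OF sob_diff[OF v sc] assms(1) d(1,2) this]
    have "W1p_norm p \<Omega> (\<lambda>x. v x - cutoff n v (f n) x) \<le> ennreal (d + d)"
      using d by (simp add: ennreal_plus[symmetric] del: ennreal_plus)
    also have "\<dots> < ennreal e" using d by (intro ennreal_lessI) auto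
    finally show "\<exists>w\<in>W1p p UNIV. compactly_supported_in w \<Omega> \<and> W1p_norm p \<Omega> (\<lambda>x. v x - w x) < ennreal e"
      using supp[of n] sc[of n] W1p_UNIV_iff by (intro bexI[of _ "cutoff n v (f n)"]) blast+
  qed
  then show ?thesis by (simp add: v_def[abs_def])
qed

end

section \<open>From the closure to the quasicontinuous zero extension\<close>

context log_exponent
begin

text \<open>The distance in \<Omega> between \<open>v\<close> and a compactly supported
  \<open>w\<close> becomes a modular over the whole space for the zero extensions \<open>g\<close>
  and \<open>G\<close>, because \<open>w\<close> vanishes off its support and \<open>W\<close> does
  so almost everywhere. That \<open>G\<close> is a weak gradient of \<open>g\<close> is not asserted
  here; it will follow from the approximation.\<close>

lemma W1p_0_continuous_approx:
  assumes \<Omega>: "open \<Omega>" and v: "v \<in> W1p_0 p \<Omega>"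
  obtains g G where "g \<in> borel_measurable lebesgue" "G \<in> borel_measurable lebesgue"
    "\<And>x. x \<in> \<Omega> \<Longrightarrow> g x = v x" "\<And>x. x \<notin> \<Omega> \<Longrightarrow> g x = 0"
    "\<And>e. e > 0 \<Longrightarrow> \<exists>f F. continuous_on UNIV f \<and> sob f F \<and> (\<forall>x. x \<notin> \<Omega> \<longrightarrow> f x = 0) \<and>
       modular p UNIV (\<lambda>x. f x - g x) < ennreal e \<and> modular p UNIV (\<lambda>x. F x - G x) < ennreal e"
proof -
  have \<Omega>s [measurable]: "\<Omega> \<in> sets lebesgue" using \<Omega> by simp
  obtain H where "v \<in> Lp_space p \<Omega>" "H \<in> Lp_space p \<Omega>" and wH: "weak_gradient \<Omega> v H"
    using v unfolding W1p_0_def W1p_def by blast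
  define g where "g x = (if x \<in> \<Omega> then v x else 0)" for x
  define G where "G x = (if x \<in> \<Omega> then H x else 0)" for x
  have gm [measurable]: "g \<in> borel_measurable lebesgue" and Gm [measurable]: "G \<in> borel_measurable lebesgue"
    using \<open>v \<in> Lp_space p \<Omega>\<close> \<open>H \<in> Lp_space p \<Omega>\<close> unfolding Lp_space_iff[OF \<Omega>s] g_def[abs_def] G_def[abs_def] by blast+
  show ?thesis
  proof (rule that[of g G, OF gm Gm])
    fix e :: real assume "e > 0"
    \<comment> \<open>The factor 2^P is lost in \<open>modular_sum\<close>; dividing by 3 leaves
      room for two errors \<open>d\<close> with strict inequality.\<close>
    define d where "d = min 1 (e / (3 * 2 powr P))"
    have P2: "(2::real) powr P > 0" by simp
    have d: "0 < d" "d \<le> 1" using \<open>e > 0\<close> by (auto simp: d_def)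
    have "d \<le> e / (3 * 2 powr P)" by (simp add: d_def)
    then have "3 * (2 powr P * d) \<le> e" using P2 by (simp add: field_simps)
    moreover have "0 < 2 powr P * d" using P2 d(1) by (rule mult_pos_pos)
    ultimately have de: "2 powr P * (d + d) < e" by (simp add: distrib_left)
    obtain w where w: "w \<in> W1p p UNIV" "compactly_supported_in w \<Omega>" "W1p_norm p \<Omega> (\<lambda>x. v x - w x) < ennreal d"
      using v d(1) unfolding W1p_0_def by blast
    obtain W where sw: "sob w W" using w(1) W1p_UNIV_iff by blast
    note wD = sobD[OF sw]
    note [measurable] = wD(1,2)
    define K where "K = closure {x. w x \<noteq> 0}"
    have K: "compact K" "K \<subseteq> \<Omega>" using w(2) by (auto simp: compactly_supported_in_def K_def)
    have wz: "w x = 0" if "x \<notin> K" for x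
      using that closure_subset[of "{x. w x \<noteq> 0}"] by (auto simp: K_def)
    have Wz: "AE x in lebesgue. x \<notin> K \<longrightarrow> W x = 0"
      by (rule weak_gradient_vanish[OF wD(5) compact_imp_closed[OF K(1)]]) (rule wz)
    have n1: "Lp_norm p \<Omega> (\<lambda>x. v x - w x) < ennreal d"
      using w(3) unfolding W1p_norm_def by (rule le_less_trans[rotated]) simp
    have n2: "Lp_norm p \<Omega> (wgrad \<Omega> (\<lambda>x. v x - w x)) < ennreal d"
      using w(3) unfolding W1p_norm_def by (rule le_less_trans[rotated]) simp
    have "weak_gradient \<Omega> w W" by (rule weak_gradient_restrict[OF wD(5) open_UNIV \<Omega>]) simp
    from wgrad_AE[OF \<Omega> weak_gradient_diff[OF wH this \<Omega>]]
    have wg: "AE x in lebesgue. x \<in> \<Omega> \<longrightarrow> wgrad \<Omega> (\<lambda>x. v x - w x) x = H x - W x" .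
    have "Lp_norm p \<Omega> (\<lambda>x. v x - w x) = Lp_norm p UNIV (\<lambda>x. g x - w x)"
      unfolding Lp_norm_extend[OF \<Omega>s]
      by (rule arg_cong[where f="Lp_norm p UNIV"]) (use wz K(2) in \<open>auto simp: g_def fun_eq_iff\<close>)
    with n1 have m1: "modular p UNIV (\<lambda>x. g x - w x) \<le> ennreal d"
      by (intro Lp_norm_less_imp_modular d(2)) simp_all
    have "Lp_norm p \<Omega> (wgrad \<Omega> (\<lambda>x. v x - w x)) = Lp_norm p UNIV (\<lambda>x. G x - W x)"
      unfolding Lp_norm_extend[OF \<Omega>s]
    proof (rule Lp_norm_cong_AE)
      show "AE x in lebesgue. (if x \<in> \<Omega> then wgrad \<Omega> (\<lambda>x. v x - w x) x else 0) = G x - W x"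
        using wg Wz
      proof eventually_elim
        case (elim x)
        then show ?case using K(2) by (auto simp: G_def)
      qed
    qed
    with n2 have m2: "modular p UNIV (\<lambda>x. G x - W x) \<le> ennreal d"
      by (intro Lp_norm_less_imp_modular d(2)) simp_all
    obtain f F K' where f: "continuous_on UNIV f" "sob f F" "K' \<subseteq> \<Omega>" "\<And>x. x \<notin> K' \<Longrightarrow> f x = 0"
      "modular p UNIV (\<lambda>x. f x - w x) < ennreal d" "modular p UNIV (\<lambda>x. F x - W x) < ennreal d"
      using sob_approx[OF sw K \<Omega> wz d(1)] by blast
    note fD = sobD[OF f(2)]
    note [measurable] = fD(1,2)
    have fin: "ennreal (2 powr P) * (a + b) < ennreal e" if "a < ennreal d" "b \<le> ennreal d" for a b
    proof -
      have "ennreal (2 powr P) * (a + b) \<le> ennreal (2 powr P) * (ennreal d + ennreal d)"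
        using that by (intro mult_left_mono add_mono) auto
      also have "\<dots> = ennreal (2 powr P * (d + d))"
        using d by (simp add: ennreal_mult ennreal_plus[symmetric] del: ennreal_plus)
      also have "\<dots> < ennreal e" using de \<open>e > 0\<close> by (intro ennreal_lessI)
      finally show ?thesis .
    qed
    have "modular p UNIV (\<lambda>x. f x - g x) \<le> ennreal (2 powr P) * (modular p UNIV (\<lambda>x. f x - w x) + modular p UNIV (\<lambda>x. g x - w x))"
    proof (rule modular_sum)
      show "AE x in lebesgue. norm (f x - g x) \<le> norm (f x - w x) + norm (g x - w x)"
        by (intro AE_I2) (use dist_triangle2 in \<open>metis dist_norm\<close>)
    qed measurable
    also have "\<dots> < ennreal e" by (rule fin[OF f(5) m1])
    finally have r1: "modular p UNIV (\<lambda>x. f x - g x) < ennreal e" .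
    have "modular p UNIV (\<lambda>x. F x - G x) \<le> ennreal (2 powr P) * (modular p UNIV (\<lambda>x. F x - W x) + modular p UNIV (\<lambda>x. G x - W x))"
    proof (rule modular_sum)
      show "AE x in lebesgue. norm (F x - G x) \<le> norm (F x - W x) + norm (G x - W x)"
        by (intro AE_I2) (use dist_triangle2 in \<open>metis dist_norm\<close>)
    qed measurable
    also have "\<dots> < ennreal e" by (rule fin[OF f(6) m2])
    finally have r2: "modular p UNIV (\<lambda>x. F x - G x) < ennreal e" .
    show "\<exists>f F. continuous_on UNIV f \<and> sob f F \<and> (\<forall>x. x \<notin> \<Omega> \<longrightarrow> f x = 0) \<and>
       modular p UNIV (\<lambda>x. f x - g x) < ennreal e \<and> modular p UNIV (\<lambda>x. F x - G x) < ennreal e"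
      using f(1-4) r1 r2 by blast
  qed (auto simp: g_def)
qed

end

context log_exponent
begin

text \<open>Weights absorbing the factors of \<open>capacity_union\<close>, the scaling by \<open>2\<^sup>j\<close> and the triangle inequality.\<close>

definition weight :: "nat \<Rightarrow> real" where
  "weight j = 2 powr (real (j + 2) * P) * 4 powr P * (2 ^ j) powr P * 2 powr P * 4"

lemma weight_pos: "weight j > 0" and weight_ge: "weight j \<ge> 1" and weight_mono: "i \<le> j \<Longrightarrow> weight i \<le> weight j"
proof -
  have p1: "1 \<le> (b::real) powr q" if "b \<ge> 1" "q \<ge> 0" for b q using that by (rule ge_one_powr_ge_zero)
  have "1 * 1 * 1 * 1 * 1 \<le> weight j"
    unfolding weight_def using P_ge by (intro mult_mono p1) (auto intro!: mult_nonneg_nonneg)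
  then show "weight j \<ge> 1" by simp
  then show "weight j > 0" by linarith
  show "i \<le> j \<Longrightarrow> weight i \<le> weight j"
    unfolding weight_def using P_ge by (intro mult_mono powr_mono powr_mono2 power_increasing mult_nonneg_nonneg) auto
qed

lemma zero_extension_quasicontinuous:
  fixes u :: "'a \<Rightarrow> ereal"
  assumes \<Omega>: "open \<Omega>" and qc: "quasicontinuous_in p \<Omega> u" and v: "v \<in> W1p_0 p \<Omega>"
    and uv: "AE x in lebesgue. x \<in> \<Omega> \<longrightarrow> u x = ereal (v x)"
  shows "quasicontinuous_in p UNIV (\<lambda>x. if x \<in> \<Omega> then u x else 0)"
    "\<exists>g \<in> W1p p UNIV. AE x in lebesgue. (if x \<in> \<Omega> then u x else 0) = ereal (g x)"
proof -
  obtain g G where gm [measurable]: "g \<in> borel_measurable lebesgue" and Gm [measurable]: "G \<in> borel_measurable lebesgue"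
    and g: "\<And>x. x \<in> \<Omega> \<Longrightarrow> g x = v x" "\<And>x. x \<notin> \<Omega> \<Longrightarrow> g x = 0"
    and appr: "\<And>e. e > 0 \<Longrightarrow> \<exists>f F. continuous_on UNIV f \<and> sob f F \<and> (\<forall>x. x \<notin> \<Omega> \<longrightarrow> f x = 0) \<and>
       modular p UNIV (\<lambda>x. f x - g x) < ennreal e \<and> modular p UNIV (\<lambda>x. F x - G x) < ennreal e"
    by (rule W1p_0_continuous_approx[OF \<Omega> v]) (rule that, assumption+)
  \<comment> \<open>Divided by the weight, the errors still sum like a geometric series of ratio 1/2
    after all constants have been paid.\<close>
  define \<delta> where "\<delta> j = (1/2) ^ j / weight j" for j
  have \<delta>: "\<delta> j > 0" for j using weight_pos by (simp add: \<delta>_def)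
  have \<delta>_le: "\<delta> j \<le> (1/2) ^ j" for j
    using weight_ge[of j] divide_left_mono[of 1 "weight j" "(1/2::real) ^ j"] by (simp add: \<delta>_def)
  have \<delta>_dec: "\<delta> (Suc j) \<le> \<delta> j" for j
    unfolding \<delta>_def using weight_mono[of j "Suc j"] weight_pos[of j] by (intro frac_le) auto
  define R where "R j f F \<longleftrightarrow> continuous_on UNIV f \<and> sob f F \<and> (\<forall>x. x \<notin> \<Omega> \<longrightarrow> f x = 0) \<and>
       modular p UNIV (\<lambda>x. f x - g x) < ennreal (\<delta> j) \<and> modular p UNIV (\<lambda>x. F x - G x) < ennreal (\<delta> j)" for j f F
  have "\<forall>j. \<exists>f F. R j f F" unfolding R_def using appr[OF \<delta>] by blast
  then obtain f F where "\<And>j. R j (f j) (F j)" by metis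
  then have f: "\<And>j. continuous_on UNIV (f j)" "\<And>j. sob (f j) (F j)" "\<And>j x. x \<notin> \<Omega> \<Longrightarrow> f j x = 0"
      "\<And>j. modular p UNIV (\<lambda>x. f j x - g x) < ennreal (\<delta> j)" "\<And>j. modular p UNIV (\<lambda>x. F j x - G x) < ennreal (\<delta> j)"
    unfolding R_def by blast+
  note fD = sobD[OF f(2)]
  have fm [measurable]: "f j \<in> borel_measurable lebesgue" "F j \<in> borel_measurable lebesgue" for j
    by (rule fD(1), rule fD(2))
  have le_half: "modular p UNIV (\<lambda>x. f j x - g x) \<le> ennreal ((1/2) ^ j)" "modular p UNIV (\<lambda>x. F j x - G x) \<le> ennreal ((1/2) ^ j)" for j
    using f(4)[of j] f(5)[of j] ennreal_leI[OF \<delta>_le[of j]] by (meson less_imp_le order_trans)+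
  \<comment> \<open>Here the zero extension of the gradient proves to be a weak gradient across the
    boundary of \<Omega>, as a limit of gradients on the whole space.\<close>
  have sg: "sob g G"
    by (rule sob_closed[OF f(2) gm Gm ennreal_tendsto_0_le[OF half_power_tendsto_0 le_half(1)] ennreal_tendsto_0_le[OF half_power_tendsto_0 le_half(2)]])
  have ug: "AE x in lebesgue. (if x \<in> \<Omega> then u x else 0) = ereal (g x)"
    using uv by eventually_elim (simp add: g zero_ereal_def)
  show "\<exists>g \<in> W1p p UNIV. AE x in lebesgue. (if x \<in> \<Omega> then u x else 0) = ereal (g x)"
    using sg ug W1p_UNIV_iff by blast
  have "(\<Sum>n. modular p UNIV (\<lambda>x. f n x - g x)) \<le> (\<Sum>n. ennreal ((1/2) ^ n))"
    by (intro suminf_le le_half) auto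
  also have "\<dots> < \<infinity>" using summable_geometric[of "1/2::real"] by (subst suminf_ennreal2) auto
  finally have "AE x in lebesgue. (\<lambda>j. f j x - g x) \<longlonglongrightarrow> 0"
    by (intro modular_summable_tendsto) measurable
  then have fg: "AE x in lebesgue. (\<lambda>j. f j x) \<longlonglongrightarrow> g x"
    by eventually_elim (simp add: LIM_zero_iff)
  \<comment> \<open>Scaled so that |D j| > 1 exactly where consecutive approximants differ by more
    than 2^(-j).\<close>
  define D where "D j x = 2 ^ j * (f j x - f (Suc j) x)" for j x
  define E where "E j x = (2 ^ j) *\<^sub>R (F j x - F (Suc j) x)" for j x
  have Dm [measurable]: "D j \<in> borel_measurable lebesgue" "E j \<in> borel_measurable lebesgue" for j
    unfolding D_def[abs_def] E_def[abs_def] by measurable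
  have small: "ennreal (2 powr P) * (a + b) \<le> ennreal (2 powr P * (2 * \<delta> j))"
    if "a < ennreal (\<delta> j)" "b < ennreal (\<delta> (Suc j))" for a b j
  proof -
    have "b \<le> ennreal (\<delta> j)" using that(2) ennreal_leI[OF \<delta>_dec[of j]] by (meson less_imp_le order_trans)
    then have "ennreal (2 powr P) * (a + b) \<le> ennreal (2 powr P) * (ennreal (\<delta> j) + ennreal (\<delta> j))"
      using that by (intro mult_left_mono add_mono) auto
    also have "\<dots> = ennreal (2 powr P * (2 * \<delta> j))"
      using \<delta>[of j] by (simp add: ennreal_mult ennreal_plus[symmetric] del: ennreal_plus)
    finally show ?thesis .
  qed
  have DE: "sob (D j) (E j)" "modular p UNIV (D j) + modular p UNIV (E j) \<le> ennreal ((2 ^ j) powr P * 2 powr P * 4 * \<delta> j)" for j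
  proof -
    have sd: "sob (\<lambda>x. f j x - f (Suc j) x) (\<lambda>x. F j x - F (Suc j) x)" by (rule sob_diff[OF f(2) f(2)])
    note sdD = sobD[OF sd]
    have "modular p UNIV (\<lambda>x. f j x - f (Suc j) x) \<le> ennreal (2 powr P) * (modular p UNIV (\<lambda>x. f j x - g x) + modular p UNIV (\<lambda>x. f (Suc j) x - g x))"
    proof (rule modular_sum)
      show "AE x in lebesgue. norm (f j x - f (Suc j) x) \<le> norm (f j x - g x) + norm (f (Suc j) x - g x)"
        by (intro AE_I2) (use dist_triangle2 in \<open>metis dist_norm\<close>)
    qed measurable
    also note small[OF f(4) f(4)]
    finally have 1: "modular p UNIV (\<lambda>x. f j x - f (Suc j) x) \<le> ennreal (2 powr P * (2 * \<delta> j))" .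
    have "modular p UNIV (\<lambda>x. F j x - F (Suc j) x) \<le> ennreal (2 powr P) * (modular p UNIV (\<lambda>x. F j x - G x) + modular p UNIV (\<lambda>x. F (Suc j) x - G x))"
    proof (rule modular_sum)
      show "AE x in lebesgue. norm (F j x - F (Suc j) x) \<le> norm (F j x - G x) + norm (F (Suc j) x - G x)"
        by (intro AE_I2) (use dist_triangle2 in \<open>metis dist_norm\<close>)
    qed measurable
    also note small[OF f(5) f(5)]
    finally have 2: "modular p UNIV (\<lambda>x. F j x - F (Suc j) x) \<le> ennreal (2 powr P * (2 * \<delta> j))" .
    have D1: "modular p UNIV (D j) \<le> ennreal ((2 ^ j) powr P) * modular p UNIV (\<lambda>x. f j x - f (Suc j) x)"
      by (rule modular_scale) (auto simp: D_def abs_mult)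
    have E1: "modular p UNIV (E j) \<le> ennreal ((2 ^ j) powr P) * modular p UNIV (\<lambda>x. F j x - F (Suc j) x)"
      by (rule modular_scale) (auto simp: E_def)
    have "modular p UNIV (D j) + modular p UNIV (E j) \<le>
      ennreal ((2 ^ j) powr P) * ennreal (2 powr P * (2 * \<delta> j)) + ennreal ((2 ^ j) powr P) * ennreal (2 powr P * (2 * \<delta> j))"
      using 1 2 by (intro add_mono order_trans[OF D1] order_trans[OF E1] mult_left_mono) auto
    also have "\<dots> = ennreal ((2 ^ j) powr P * (2 powr P * (2 * \<delta> j)) + (2 ^ j) powr P * (2 powr P * (2 * \<delta> j)))"
      using \<delta>[of j] by (simp add: ennreal_mult[symmetric] ennreal_plus[symmetric] del: ennreal_plus)
    also have "(2 ^ j) powr P * (2 powr P * (2 * \<delta> j)) + (2 ^ j) powr P * (2 powr P * (2 * \<delta> j)) = (2 ^ j) powr P * 2 powr P * 4 * \<delta> j"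
      by simp
    finally show "modular p UNIV (D j) + modular p UNIV (E j) \<le> ennreal ((2 ^ j) powr P * 2 powr P * 4 * \<delta> j)" .
    have "modular p UNIV (D j) < \<infinity>"
      by (rule modular_finite_scale[OF sdD(1,3), where C="2 ^ j"]) (simp add: D_def abs_mult)
    moreover have "modular p UNIV (E j) < \<infinity>"
      by (rule modular_finite_scale[OF sdD(2,4), where C="2 ^ j"]) (simp add: E_def)
    moreover have "weak_gradient UNIV (D j) (E j)"
      unfolding D_def[abs_def] E_def[abs_def] by (rule weak_gradient_scale[OF sdD(5) open_UNIV])
    ultimately show "sob (D j) (E j)" using Dm by (simp add: sob_def)
  qed
  show "quasicontinuous_in p UNIV (\<lambda>x. if x \<in> \<Omega> then u x else 0)"
    unfolding quasicontinuous_in_def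
  proof (intro allI impI)
    fix \<epsilon> :: real assume \<epsilon>: "\<epsilon> > 0"
    \<comment> \<open>The factor attached to index 0 in \<open>capacity_union\<close>.\<close>
    define A where "A = 2 powr P * 4 powr P"
    have A: "A > 0" by (simp add: A_def)
    \<comment> \<open>The differences from \<open>m\<close> on then contribute less than
      \<epsilon>/4 to the capacity, their bounds summing to twice 2^(-m).\<close>
    obtain m where m: "(1/2) ^ m < \<epsilon> / 8"
      using real_arch_pow_inv[of "\<epsilon> / 8" "1/2"] \<epsilon> by auto
    obtain U where U: "open U" "capacity p U < ennreal (\<epsilon> / 4 / A)" "\<forall>x \<in> \<Omega> - U. \<bar>u x\<bar> \<noteq> \<infinity>" "continuous_on (\<Omega> - U) u"
      using qc \<epsilon> A unfolding quasicontinuous_in_def by (metis divide_pos_pos zero_less_numeral)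
    obtain h H W where h: "sob h H" "open W" "U \<subseteq> W" "\<And>x. x \<in> W \<Longrightarrow> h x \<ge> 1" "modular p UNIV h + modular p UNIV H < ennreal (\<epsilon> / 4 / A)"
      by (rule capacity_lessE[OF U(2)]) (rule that, assumption+)
    \<comment> \<open>Index 0 is reserved for the exceptional set of \<open>u\<close> and the later
      indices for the differences, so that one application of \<open>capacity_union\<close> covers
      everything.\<close>
    define f' where "f' k = (case k of 0 \<Rightarrow> h | Suc j \<Rightarrow> D (m + j))" for k
    define F' where "F' k = (case k of 0 \<Rightarrow> H | Suc j \<Rightarrow> E (m + j))" for k
    define V where "V k = (case k of 0 \<Rightarrow> W | Suc j \<Rightarrow> {x. 1 < \<bar>D (m + j) x\<bar>})" for k
    define c where "c k = (case k of 0 \<Rightarrow> \<epsilon> / 4 | Suc j \<Rightarrow> (1/2) ^ m * (1/2) ^ j)" for k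
    have s': "sob (f' k) (F' k)" for k by (cases k) (simp_all add: f'_def F'_def h DE)
    have oV: "open (V k)" for k
    proof (cases k)
      case (Suc j)
      have "continuous_on UNIV (\<lambda>x. \<bar>D (m + j) x\<bar>)" unfolding D_def by (intro continuous_intros f)
      then show ?thesis using Suc by (simp add: V_def open_Collect_less continuous_on_const)
    qed (simp add: V_def h)
    have V1: "\<bar>f' k x\<bar> \<ge> 1" if "x \<in> V k" for k x
      using that h(4)[of x] by (cases k) (auto simp: V_def f'_def)
    have term_le: "ennreal (2 powr (real (Suc k) * P) * 4 powr P) * (modular p UNIV (f' k) + modular p UNIV (F' k)) \<le> ennreal (c k)" for k
    proof (cases k)
      case 0
      have "ennreal A * (modular p UNIV h + modular p UNIV H) \<le> ennreal A * ennreal (\<epsilon> / 4 / A)"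
        using h(5) by (intro mult_left_mono) auto
      also have "\<dots> = ennreal (\<epsilon> / 4)" using A \<epsilon> by (simp add: ennreal_mult[symmetric])
      finally show ?thesis using 0 by (simp add: f'_def F'_def c_def A_def)
    next
      case (Suc j)
      let ?b = "(2 ^ (m + j)) powr P * 2 powr P * 4 :: real"
      have "ennreal (2 powr (real (Suc k) * P) * 4 powr P) * (modular p UNIV (f' k) + modular p UNIV (F' k))
        \<le> ennreal (2 powr (real (Suc k) * P) * 4 powr P) * ennreal (?b * \<delta> (m + j))"
        using DE(2)[of "m + j"] Suc by (intro mult_left_mono) (auto simp: f'_def F'_def)
      also have "\<dots> = ennreal (2 powr (real (Suc k) * P) * 4 powr P * ?b * \<delta> (m + j))"
        using \<delta>[of "m + j"] by (simp add: ennreal_mult[symmetric] mult.assoc)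
      also have "\<dots> \<le> ennreal (weight (m + j) * \<delta> (m + j))"
      proof (intro ennreal_leI mult_right_mono)
        \<comment> \<open>The index is shifted by one: k = j + 1, so \<open>Suc k\<close> is j + 2,
          at most the m + j + 2 occurring in \<open>weight (m + j)\<close>.\<close>
        have "2 powr (real (Suc k) * P) \<le> 2 powr (real (m + j + 2) * P)"
          using Suc P_ge by (intro powr_mono mult_right_mono) auto
        then have "2 powr (real (Suc k) * P) * (4 powr P * ?b) \<le> 2 powr (real (m + j + 2) * P) * (4 powr P * ?b)"
          by (intro mult_right_mono) auto
        then show "2 powr (real (Suc k) * P) * 4 powr P * ?b \<le> weight (m + j)"
          by (simp add: weight_def mult.assoc)
        show "0 \<le> \<delta> (m + j)" using \<delta>[of "m + j"] by simp
      qed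
      also have "weight (m + j) * \<delta> (m + j) = (1/2) ^ m * (1/2) ^ j"
        using weight_pos[of "m + j"] by (simp add: \<delta>_def power_add)
      finally show ?thesis using Suc by (simp add: c_def)
    qed
    have csum: "c sums (\<epsilon> / 4 + (1/2) ^ m * 2)"
    proof -
      have "(\<lambda>j. (1/2) ^ m * (1/2::real) ^ j) sums ((1/2) ^ m * 2)"
        using geometric_sums[of "1/2::real"] by (intro sums_mult) simp
      then have "(\<lambda>j. c (Suc j)) sums ((1/2) ^ m * 2)" by (simp add: c_def)
      then show ?thesis using sums_Suc_iff[of c "(1/2) ^ m * 2"] by (simp add: c_def add.commute)
    qed
    have c0: "c k \<ge> 0" for k using \<epsilon> by (cases k) (auto simp: c_def)
    define N where "N = (\<Union>k. V k)"
    have oN: "open N" unfolding N_def using oV by blast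
    have "capacity p N \<le> ennreal (\<epsilon> / 4 + (1/2) ^ m * 2)"
      unfolding N_def
    proof (rule capacity_union[OF s' oV V1])
      have "(\<Sum>k. ennreal (2 powr (real (Suc k) * P) * 4 powr P) * (modular p UNIV (f' k) + modular p UNIV (F' k))) \<le> (\<Sum>k. ennreal (c k))"
        by (intro suminf_le term_le) auto
      also have "\<dots> = ennreal (\<epsilon> / 4 + (1/2) ^ m * 2)"
        using csum c0 by (subst suminf_ennreal2) (auto simp: sums_iff)
      finally show "(\<Sum>k. ennreal (2 powr (real (Suc k) * P) * 4 powr P) * (modular p UNIV (f' k) + modular p UNIV (F' k))) \<le> ennreal (\<epsilon> / 4 + (1/2) ^ m * 2)" .
      show "ennreal (\<epsilon> / 4 + (1/2) ^ m * 2) < \<infinity>" using ennreal_less_top by simp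
    qed
    also have "\<dots> < ennreal \<epsilon>" using m \<epsilon> by (intro ennreal_lessI) auto
    finally have capN: "capacity p N < ennreal \<epsilon>" .
    have "V 0 \<subseteq> N" unfolding N_def by blast
    then have UN: "U \<subseteq> N" using h(3) by (simp add: V_def)
    define S where "S = UNIV - N"
    have dS: "\<bar>f (Suc (m + j)) x - f (m + j) x\<bar> \<le> (1/2) ^ (m + j)" if "x \<in> S" for j x
    proof -
      have "x \<notin> V (Suc j)" using that by (auto simp: S_def N_def)
      then have "2 ^ (m + j) * \<bar>f (m + j) x - f (Suc (m + j)) x\<bar> \<le> 1"
        by (simp add: V_def D_def abs_mult)
      then show ?thesis by (simp add: power_divide field_simps abs_minus_commute)
    qed
    define d where "d j x = f (Suc (m + j)) x - f (m + j) x" for j x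
    \<comment> \<open>The bounds on consecutive differences form a Weierstrass majorant; the
      telescoping sum then makes the limit \<open>w\<close> continuous relative to
      \<open>S\<close>.\<close>
    have "uniform_limit S (\<lambda>n x. \<Sum>j<n. d j x) (\<lambda>x. \<Sum>j. d j x) sequentially"
    proof (rule Weierstrass_m_test)
      show "norm (d j x) \<le> (1/2) ^ (m + j)" if "x \<in> S" for j x using dS[OF that, of j] by (simp add: d_def)
      show "summable (\<lambda>j. (1/2::real) ^ (m + j))"
        unfolding power_add by (intro summable_mult summable_geometric) simp
    qed
    moreover have tele: "(\<Sum>j<n. d j x) = f (m + n) x - f m x" for n x
      unfolding d_def using sum_lessThan_telescope[of "\<lambda>j. f (m + j) x" n] by simp
    ultimately have ul: "uniform_limit S (\<lambda>n x. f (m + n) x - f m x) (\<lambda>x. \<Sum>j. d j x) sequentially" by simp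
    define w where "w x = f m x + (\<Sum>j. d j x)" for x
    have cf: "continuous_on S (f j)" for j using continuous_on_subset[OF f(1)] by blast
    have "continuous_on S (\<lambda>x. \<Sum>j. d j x)"
      by (rule uniform_limit_theorem[OF _ ul]) (auto intro!: always_eventually continuous_intros cf)
    then have cw: "continuous_on S w" unfolding w_def by (intro continuous_intros cf)
    have lim: "(\<lambda>n. f n x) \<longlonglongrightarrow> w x" if "x \<in> S" for x
    proof -
      have "(\<lambda>n. f m x + (f (m + n) x - f m x)) \<longlonglongrightarrow> w x"
        unfolding w_def by (intro tendsto_intros tendsto_uniform_limitI[OF ul that])
      then have "(\<lambda>n. f (n + m) x) \<longlonglongrightarrow> w x" by (simp add: add.commute)
      then show ?thesis by (rule LIMSEQ_offset)
    qed
    \<comment> \<open>Every approximant vanishes off \<Omega>, so the limit does at each point of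
      \<open>S\<close> outside \<Omega>, including the boundary.\<close>
    have w0: "w x = 0" if "x \<in> S" "x \<notin> \<Omega>" for x
      using lim[OF that(1)] f(3)[OF that(2)] by (simp add: LIMSEQ_const_iff)
    \<comment> \<open>On this set \<open>u\<close> is finite and continuous, because
      \<open>N\<close> contains its exceptional set \<open>U\<close>. Differing from
      \<open>w\<close> is then a relatively open condition, cut out by an open set
      \<open>B\<close>.\<close>
    define T where "T = \<Omega> \<inter> S"
    have TU: "T \<subseteq> \<Omega> - U" using UN by (auto simp: T_def S_def)
    have fin: "\<bar>u x\<bar> \<noteq> \<infinity>" if "x \<in> T" for x
      by (rule U(3)[rule_format]) (use TU that in blast)
    have "continuous_on T u" using continuous_on_subset[OF U(4) TU] .
    then have "continuous_on T (real_of_ereal \<circ> u)" by (rule iffD1[OF continuous_on_iff_real, rotated]) (rule fin)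
    then have "continuous_on T (\<lambda>x. real_of_ereal (u x) - w x)"
      using continuous_on_subset[OF cw] by (intro continuous_on_diff) (auto simp: comp_def T_def)
    then have "openin (top_of_set T) (T \<inter> (\<lambda>x. real_of_ereal (u x) - w x) -` (- {0}))"
      by (rule continuous_openin_preimage_gen) (simp add: open_Compl)
    then obtain B where B: "open B" "T \<inter> (\<lambda>x. real_of_ereal (u x) - w x) -` (- {0}) = T \<inter> B"
      unfolding openin_open by blast
    have Biff: "x \<in> B \<longleftrightarrow> u x \<noteq> ereal (w x)" if "x \<in> T" for x
    proof -
      have "u x = ereal (real_of_ereal (u x))" using fin[OF that] by (simp add: ereal_real)
      moreover have "x \<in> B \<longleftrightarrow> real_of_ereal (u x) - w x \<noteq> 0" using B(2) that by blast
      ultimately show ?thesis by (metis ereal.inject right_minus_eq)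
    qed
    \<comment> \<open>Outside \<open>N\<close> this adds exactly the points of \<Omega> where
      \<open>u\<close> and \<open>w\<close> differ, a null set since both agree with
      \<open>g\<close> almost everywhere. Intersecting with the open set \<Omega> keeps
      \<open>Q\<close> open.\<close>
    define Q where "Q = N \<union> (B \<inter> \<Omega>)"
    have oQ: "open Q" unfolding Q_def using oN B(1) \<Omega> by blast
    have "AE x in lebesgue. x \<in> Q \<longrightarrow> x \<in> N"
      using ug fg
    proof eventually_elim
      case (elim x)
      show ?case
      proof (rule impI, rule ccontr)
        assume x: "x \<in> Q" "x \<notin> N"
        then have "x \<in> S" "x \<in> \<Omega>" "x \<in> B" by (auto simp: Q_def S_def)
        moreover then have "w x = g x" using lim elim(2) LIMSEQ_unique by blast
        ultimately show False using elim(1) Biff[of x] by (simp add: T_def)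
      qed
    qed
    from capacity_null_diff[OF oQ this] have capQ: "capacity p Q < ennreal \<epsilon>"
      using capN by (rule le_less_trans)
    have eq: "(if x \<in> \<Omega> then u x else 0) = ereal (w x)" if "x \<in> UNIV - Q" for x
    proof (cases "x \<in> \<Omega>")
      case True
      then have "x \<in> T" "x \<notin> B" using that by (auto simp: Q_def T_def S_def)
      then show ?thesis using Biff True by simp
    next
      case False
      then have "x \<in> S" using that by (auto simp: Q_def S_def)
      then show ?thesis using w0 False by (simp add: zero_ereal_def)
    qed
    have "continuous_on (UNIV - Q) (\<lambda>x. ereal (w x))"
      by (intro continuous_on_ereal continuous_on_subset[OF cw]) (auto simp: Q_def S_def)
    then have "continuous_on (UNIV - Q) (\<lambda>x. if x \<in> \<Omega> then u x else 0)"
      using eq by (subst continuous_on_cong[OF refl]) auto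
    then show "\<exists>U. open U \<and> capacity p U < ennreal \<epsilon> \<and> (\<forall>x\<in>UNIV - U. \<bar>if x \<in> \<Omega> then u x else 0\<bar> \<noteq> \<infinity>) \<and>
        continuous_on (UNIV - U) (\<lambda>x. if x \<in> \<Omega> then u x else 0)"
      using oQ capQ eq by (intro exI[of _ Q] conjI ballI) auto
  qed
qed

end

text \<open>The set where \<open>p\<close> exceeds \<open>P\<close> is open and null, hence
  empty.\<close>

lemma continuous_AE_le:
  fixes p :: "'a::euclidean_space \<Rightarrow> real"
  assumes "continuous_on UNIV p" "AE x in lebesgue. p x \<le> P"
  shows "p x \<le> P"
proof (rule ccontr)
  assume "\<not> p x \<le> P"
  then have ne: "x \<in> {x. P < p x}" by simp
  have "open {x. P < p x}" using assms(1) by (intro open_Collect_less) auto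
  moreover have "{x. P < p x} \<in> null_sets lebesgue"
    using assms(2) by (simp add: completion.AE_iff_null_sets not_le)
  ultimately show False using ne open_not_negligible[of "{x. P < p x}"] negligible_iff_null_sets by blast
qed

theorem proposition2p5:
  fixes p :: "real ^ 'n \<Rightarrow> real"
    and \<Omega> :: "(real ^ 'n) set"
    and u :: "real ^ 'n \<Rightarrow> ereal"
  assumes "p \<in> borel_measurable lebesgue"
    and "\<forall>x. p x \<ge> 1"
    and "1 < essinf lebesgue (\<lambda>x. ereal (p x))"
    and "essinf lebesgue (\<lambda>x. ereal (p x)) \<le> esssup lebesgue (\<lambda>x. ereal (p x))"
    and "esssup lebesgue (\<lambda>x. ereal (p x)) < \<infinity>"
    and "log_Hoelder p"
    and "open \<Omega>" and "\<Omega> \<noteq> {}"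
    and "quasicontinuous_in p \<Omega> u"
  shows "ae_in_space \<Omega> u (W1p_0 p \<Omega>) \<longleftrightarrow>
    quasicontinuous_in p UNIV (\<lambda>x. if x \<in> \<Omega> then u x else 0) \<and>
    ae_in_space UNIV (\<lambda>x. if x \<in> \<Omega> then u x else 0) (W1p p UNIV)"
proof -
  define s where "s = esssup lebesgue (\<lambda>x. ereal (p x))"
  \<comment> \<open>The lower bound excludes the value -\<infinity>, so the essential supremum is a
    real number.\<close>
  have "1 < s" using assms(3,4) unfolding s_def by (rule less_le_trans)
  then obtain P where P: "s = ereal P" using assms(5) by (cases s) (auto simp: s_def)
  have "AE x in lebesgue. ereal (p x) \<le> s" unfolding s_def by (rule esssup_AE)
  then have "AE x in lebesgue. p x \<le> P" by (simp add: P)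
  then have "p x \<le> P" for x by (rule continuous_AE_le[OF log_Hoelder_continuous[OF assms(6)]])
  then interpret log_exponent p P
    using assms(1,2,6) by unfold_locales auto
  let ?u = "\<lambda>x. if x \<in> \<Omega> then u x else 0"
  have \<Omega>: "\<Omega> \<in> sets lebesgue" using assms(7) by simp
  show ?thesis
  proof
    assume "ae_in_space \<Omega> u (W1p_0 p \<Omega>)"
    then obtain v where v: "v \<in> W1p_0 p \<Omega>" "AE x in lebesgue. x \<in> \<Omega> \<longrightarrow> u x = ereal (v x)"
      unfolding ae_in_space_def AE_lebesgue_on[OF \<Omega>] by blast
    show "quasicontinuous_in p UNIV ?u \<and> ae_in_space UNIV ?u (W1p p UNIV)"
      unfolding ae_in_space_def lebesgue_on_UNIV
      using zero_extension_quasicontinuous[OF assms(7,9) v] by blast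
  next
    assume r: "quasicontinuous_in p UNIV ?u \<and> ae_in_space UNIV ?u (W1p p UNIV)"
    then obtain w where w: "w \<in> W1p p UNIV" "AE x in lebesgue. ?u x = ereal (w x)"
      unfolding ae_in_space_def lebesgue_on_UNIV by blast
    \<comment> \<open>A representative built from \<open>u\<close> itself vanishes off \<Omega> at
      every point and inherits quasicontinuity; the Sobolev function \<open>w\<close> is tied to it
      only almost everywhere.\<close>
    have "(\<lambda>x. real_of_ereal (?u x)) \<in> W1p_0 p \<Omega>"
      by (rule zero_extension_in_W1p_0[OF assms(7) _ _ w]) (use r in auto)
    moreover have "AE x in lebesgue. x \<in> \<Omega> \<longrightarrow> u x = ereal (real_of_ereal (?u x))"
      using w(2) by eventually_elim auto
    ultimately show "ae_in_space \<Omega> u (W1p_0 p \<Omega>)"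
      unfolding ae_in_space_def AE_lebesgue_on[OF \<Omega>]
      by (intro bexI[of _ "\<lambda>x. real_of_ereal (?u x)"])
  qed
qed

end
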